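(* Let $f$ be a smooth probability density on $\mathbb{R}^n$ with respect to $\gamma$, let $d\mu=f\,d\gamma$ with $\int|x|^2d\mu<\infty$, and assume $\mu$ has barycenter $b$ and covariance matrix $\Gamma$. Then for every $0<\varepsilon\le1$, $$2\,\delta(f)+\varepsilon\,\|\Gamma-\mathrm{Id}\|^2\;\ge\;\frac{1}{4\,\varepsilon^3}\,\widetilde{\mathcal{D}}_\varepsilon(\mu_b,\gamma)^4.$$
   Context: $\gamma$ is the standard Gaussian measure on $\mathbb{R}^n$. $\mathrm{H}(g)=\int g\log g\,d\gamma$, $\mathrm{I}(g)=\int\frac{|\nabla g|^2}{g}d\gamma$, $\delta(g)=\frac12\mathrm{I}(g)-\mathrm{H}(g)$. $f_b(x)=f(x+b)e^{-(b\cdot x+|b|^2/2)}$, $d\mu_b=f_b\,d\gamma$. For an $n\times n$ matrix $A$, $\|A\|=\sup_{|\alpha|=1}A\alpha\cdot\alpha$. The Ornstein–Uhlenbeck semigroup is $P_tg(x)=\int g(e^{-t}x+\sqrt{1-e^{-2t}}\,y)\,d\gamma(y)$. For $0<\varepsilon\le1$ let $s\ge0$ with $e^{-4s}=\varepsilon$; for $\nu=g\,d\gamma$, $\widetilde{\mathcal{D}}_\varepsilon(\nu,\gamma)=\sup_\varphi\left|\int[x\varphi-\nabla\varphi]\,d\nu\right|$ (Euclidean norm), the supremum over $\varphi=4\int_s^\infty e^{-4t}P_t\psi\,dt$ with $\psi$ smooth ($C^1$) such that $\int\psi^2\,P_tg\,d\gamma\le1$ for all $t\ge0$ (here $g=f_b$).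 *)

theory Defs
  imports "HOL-Analysis.Analysis"
begin

definition gauss_dens :: "real^'n \<Rightarrow> real" where
  "gauss_dens x = (2 * pi) powr (- real CARD('n) / 2) * exp (- (norm x)\<^sup>2 / 2)"

definition gauss :: "(real^'n) measure" where
  "gauss = density lborel (\<lambda>x. ennreal (gauss_dens x))"

definition partial :: "(real^'n \<Rightarrow> real) \<Rightarrow> 'n \<Rightarrow> real^'n \<Rightarrow> real" where
  "partial f i x = frechet_derivative f (at x) (axis i 1)"

definition grad :: "(real^'n \<Rightarrow> real) \<Rightarrow> real^'n \<Rightarrow> real^'n" where
  "grad f x = (\<chi> i. partial f i x)"

fun Ck :: "nat \<Rightarrow> (real^'n \<Rightarrow> real) \<Rightarrow> bool" where
  "Ck 0 f = continuous_on UNIV f"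
| "Ck (Suc k) f = (continuous_on UNIV f \<and> (\<forall>x. f differentiable (at x))
                     \<and> (\<forall>i. Ck k (partial f i)))"

definition smooth :: "(real^'n \<Rightarrow> real) \<Rightarrow> bool" where
  "smooth f \<longleftrightarrow> (\<forall>k. Ck k f)"

definition Ent :: "(real^'n \<Rightarrow> real) \<Rightarrow> real" where
  "Ent g = (\<integral>x. g x * ln (g x) \<partial>gauss)"

definition Fisher :: "(real^'n \<Rightarrow> real) \<Rightarrow> ennreal" where
  "Fisher g = (\<integral>\<^sup>+x. ennreal ((norm (grad g x))\<^sup>2 / g x) \<partial>gauss)"

text \<open>Deficit, meaningful when the Fisher information is finite.\<close>
definition deficit :: "(real^'n \<Rightarrow> real) \<Rightarrow> real" where
  "deficit g = enn2real (Fisher g) / 2 - Ent g"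

definition shift :: "(real^'n \<Rightarrow> real) \<Rightarrow> real^'n \<Rightarrow> real^'n \<Rightarrow> real" where
  "shift f b x = f (x + b) * exp (- (b \<bullet> x + (norm b)\<^sup>2 / 2))"

definition qnorm :: "real^'n^'n \<Rightarrow> real" where
  "qnorm A = Sup {(A *v \<alpha>) \<bullet> \<alpha> | \<alpha>. norm \<alpha> = 1}"

definition barycenter :: "(real^'n \<Rightarrow> real) \<Rightarrow> real^'n" where
  "barycenter f = (\<integral>x. f x *\<^sub>R x \<partial>gauss)"

definition covariance :: "(real^'n \<Rightarrow> real) \<Rightarrow> real^'n^'n" where
  "covariance f = (\<chi> i j. \<integral>x. f x * (x $ i - barycenter f $ i) * (x $ j - barycenter f $ j) \<partial>gauss)"

definition OU :: "real \<Rightarrow> (real^'n \<Rightarrow> real) \<Rightarrow> real^'n \<Rightarrow> real" where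
  "OU t g x = (\<integral>y. g (exp (- t) *\<^sub>R x + sqrt (1 - exp (-2 * t)) *\<^sub>R y) \<partial>gauss)"

text \<open>Nonnegative version of P_t g (for g >= 0), avoiding junk values.\<close>
definition OU_nn :: "real \<Rightarrow> (real^'n \<Rightarrow> real) \<Rightarrow> real^'n \<Rightarrow> ennreal" where
  "OU_nn t g x = (\<integral>\<^sup>+y. ennreal (g (exp (- t) *\<^sub>R x + sqrt (1 - exp (-2 * t)) *\<^sub>R y)) \<partial>gauss)"

definition s_of :: "real \<Rightarrow> real" where
  "s_of \<epsilon> = - ln \<epsilon> / 4"   (* the s >= 0 with exp(-4 s) = \<epsilon> *)

definition phi_of :: "real \<Rightarrow> (real^'n \<Rightarrow> real) \<Rightarrow> real^'n \<Rightarrow> real" where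
  "phi_of \<epsilon> \<psi> x = 4 * (LINT t:{s_of \<epsilon>..}|lborel. exp (-4 * t) * OU t \<psi> x)"

text \<open>Admissible test functions phi (with the implicit well-definedness requirements).\<close>
definition admissible :: "real \<Rightarrow> (real^'n \<Rightarrow> real) \<Rightarrow> (real^'n \<Rightarrow> real) set" where
  "admissible \<epsilon> g = {phi_of \<epsilon> \<psi> | \<psi>.
      Ck 1 \<psi>
    \<and> (\<forall>t\<ge>0. (\<integral>\<^sup>+x. ennreal ((\<psi> x)\<^sup>2) * OU_nn t g x \<partial>gauss) \<le> 1)
    \<and> (\<forall>t\<ge>0. \<forall>x. integrable gauss (\<lambda>y. \<psi> (exp (- t) *\<^sub>R x + sqrt (1 - exp (-2 * t)) *\<^sub>R y)))
    \<and> (\<forall>x. set_integrable lborel {s_of \<epsilon>..} (\<lambda>t. exp (-4 * t) * OU t \<psi> x))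
    \<and> (\<forall>x. phi_of \<epsilon> \<psi> differentiable (at x))
    \<and> integrable (density gauss (\<lambda>x. ennreal (g x)))
         (\<lambda>x. phi_of \<epsilon> \<psi> x *\<^sub>R x - grad (phi_of \<epsilon> \<psi>) x)}"

definition Dtilde :: "real \<Rightarrow> (real^'n \<Rightarrow> real) \<Rightarrow> ereal" where
  "Dtilde \<epsilon> g = (SUP \<phi>\<in>admissible \<epsilon> g.
      ereal (norm (\<integral>x. (\<phi> x *\<^sub>R x - grad \<phi> x) \<partial>density gauss (\<lambda>x. ennreal (g x)))))"

end

theory Submission
  imports Defs "HOL-Probability.Distributions" "HOL-Real_Asymp.Real_Asymp"
begin

text \<open>
  For \<open>f\<close> centered and \<open>\<bar>\<alpha>\<bar> = 1\<close> put \<open>J(r) = \<integral> (P\<^sub>t \<partial>\<^sub>\<alpha> f)\<^sup>2 / P\<^sub>t f d\<gamma>\<close> with \<open>r = exp (- 2 t)\<close>, and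
  \<open>c = (\<Gamma> - Id) \<alpha> \<bullet> \<alpha>\<close>. Testing the Cauchy--Schwarz defect between two times against an affine
  function of the Gaussian increment gives \<open>J(y) - J(x) \<ge> (y - x) (J(x) - c)\<^sup>2 (1 - (y - x) c)\<close>, a
  finite-difference Riccati inequality that needs no second derivatives of \<open>log P\<^sub>t f\<close>.
  De Bruijn's identity in the form \<open>H(f) \<le> 1/2 \<integral>\<^sub>0\<^sup>1 I(r) dr\<close>, with \<open>I\<close> the sum of \<open>J\<close> over an
  orthonormal basis, then yields \<open>2 \<delta>(f) \<ge> \<integral>\<^sub>0\<^sup>1 r (J - c)\<^sup>2 dr\<close>.
  On the other side, integration by parts and reversibility of \<open>P\<^sub>t\<close> give
  \<open>\<integral> (x \<phi> - \<nabla>\<phi>) \<bullet> \<alpha> d\<mu> = 4 \<integral>\<^sub>s\<^sup>\<infinity> exp (- 4 t) \<integral> \<psi> P\<^sub>t \<partial>\<^sub>\<alpha> f d\<gamma> dt\<close>, and the inner integral is at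
  most \<open>J\<close> to the power \<open>1/2\<close>; Young's inequality bounds the fourth power of the whole by
  \<open>2 \<epsilon>\<^sup>3 \<integral>\<^sub>0 r J\<^sup>2 dr\<close> over \<open>r \<le> sqrt \<epsilon>\<close>. Finally \<open>J\<^sup>2 \<le> 2 (J - c)\<^sup>2 + 2 max(c, 0)\<^sup>2\<close>.
\<close>

section \<open>Gaussian measure and integration by parts\<close>

text \<open>A single unit vector \<alpha> suffices: the norm of the vector pairing is its component
  along its own direction, and of the information orthogonal to \<alpha> only the monotonicity along
  the semigroup enters the deficit. The obstacle is regularity. The density may vanish, and finite
  Fisher information is the only integral bound on its gradient. So the quotient |g|^2 / f is
  treated through its minorants 2 u T - v T^2, which are linear in (u, v), increments replace
  derivatives in time, and de Bruijn's identity is proved for bounded densities; in the limit Fatou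
  leaves an inequality, in the direction that the deficit requires. The weight r comes, formally,
  from \<integral> (J(1) - J(r)) dr = \<integral> r J'(r) dr over [0, 1]. Changes of variables for
  two independent Gaussians rest on one fact: an orthogonal reflection of the pair preserves their
  joint law. Composition of Mehler operators, reversibility and the entropy production all use it.
  The 4 in the denominator is 2 from substituting r = exp (- 2 t) times 2 from J^2 \<le> 2 (J - c)^2
  + 2 max(c, 0)^2. Centering lowers the Fisher information by |b|^2 and the entropy by |b|^2 / 2, so
  the deficit is unchanged.\<close>

lemma integral_lborel_translate:
  fixes h :: "'a::euclidean_space \<Rightarrow> 'b::{banach,second_countable_topology}"
  assumes [measurable]: "h \<in> borel_measurable borel"
  shows "(\<integral>x. h (x + c) \<partial>lborel) = (\<integral>x. h x \<partial>lborel)"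
proof -
  have "(\<integral>x. h x \<partial>lborel) = (\<integral>x. h x \<partial>(distr lborel borel ((+) c)))"
    by (simp add: lborel_distr_plus)
  also have "\<dots> = (\<integral>x. h (c + x) \<partial>lborel)"
    by (rule integral_distr) auto
  finally show ?thesis by (simp add: add.commute)
qed

lemma integrable_lborel_translate:
  fixes h :: "'a::euclidean_space \<Rightarrow> 'b::{banach,second_countable_topology}"
  assumes "integrable lborel h"
  shows "integrable lborel (\<lambda>x. h (x + c))"
proof -
  have "integrable (distr lborel borel ((+) c)) h"
    using assms by (simp add: lborel_distr_plus)
  then have "integrable lborel (\<lambda>x. h (c + x))"
    by (rule integrable_distr[rotated]) auto
  then show ?thesis by (simp add: add.commute)
qed

text \<open>Integrating the increment of \<open>w\<close> along \<open>v\<close> over the whole space gives \<open>0\<close> by translation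
  invariance; this replaces slicing the space into lines.\<close>

lemma integral_directional_derivative_eq_0:
  fixes w w' :: "'a::euclidean_space \<Rightarrow> real"
  assumes w: "integrable lborel w" and w': "integrable lborel w'"
    and d: "\<And>x. ((\<lambda>t. w (x + t *\<^sub>R v)) has_real_derivative w' x) (at 0)"
  shows "(\<integral>x. w' x \<partial>lborel) = 0"
proof -
  have [measurable]: "w \<in> borel_measurable borel" "w' \<in> borel_measurable borel"
    using w w' by (auto dest: borel_measurable_integrable)
  let ?h = "\<lambda>p::real \<times> 'a. indicator {0..1} (fst p) * w' (snd p + fst p *\<^sub>R v)"
  have h: "integrable (lborel \<Otimes>\<^sub>M lborel) ?h"
  proof (rule lborel_pair.Fubini_integrable)
    have "(\<integral>y. norm (?h (t, y)) \<partial>lborel) = indicator {0..1} t * (\<integral>y. \<bar>w' y\<bar> \<partial>lborel)" for t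
      using integral_lborel_translate[of "\<lambda>y. \<bar>w' y\<bar>" "t *\<^sub>R v"]
      by (simp add: abs_mult)
    then show "integrable lborel (\<lambda>t. \<integral>y. norm (?h (t, y)) \<partial>lborel)"
      by simp
    show "AE t in lborel. integrable lborel (\<lambda>y. ?h (t, y))"
      using integrable_lborel_translate[OF w'] by simp
  qed measurable
  \<comment> \<open>The fundamental theorem yields a gauge integral along the segment. Lebesgue
    integrability on the segment, which Fubini supplies for almost every \<open>x\<close>,
    identifies it with the Bochner integral.\<close>
  have ftc: "(\<integral>t. ?h (t, x) \<partial>lborel) = w (x + v) - w x"
    if i: "integrable lborel (\<lambda>t. ?h (t, x))" for x
  proof -
    have "((\<lambda>t. w (x + t *\<^sub>R v)) has_real_derivative w' (x + t *\<^sub>R v)) (at t)" for t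
    proof -
      have "((\<lambda>s. w (x + (s + t) *\<^sub>R v)) has_real_derivative w' (x + t *\<^sub>R v)) (at 0)"
        using d[of "x + t *\<^sub>R v"] by (simp add: algebra_simps)
      then show ?thesis using DERIV_shift[of "\<lambda>t. w (x + t *\<^sub>R v)" _ 0 t] by simp
    qed
    then have "((\<lambda>t. w' (x + t *\<^sub>R v)) has_integral w (x + 1 *\<^sub>R v) - w (x + 0 *\<^sub>R v)) {0..1}"
      by (intro fundamental_theorem_of_calculus)
        (auto simp: has_real_derivative_iff_has_vector_derivative intro: has_vector_derivative_at_within)
    moreover have s: "set_integrable lborel {0..1} (\<lambda>t. w' (x + t *\<^sub>R v))"
      using i by (simp add: set_integrable_def)
    ultimately have "(LINT t:{0..1}|lborel. w' (x + t *\<^sub>R v)) = w (x + v) - w x"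
      using set_borel_integral_eq_integral(2)[OF s] by (simp add: integral_unique)
    then show ?thesis by (simp add: set_lebesgue_integral_def)
  qed
  have h': "integrable (lborel \<Otimes>\<^sub>M lborel) (\<lambda>(x, t). ?h (t, x))"
    using lborel_pair.integrable_product_swap[OF h] .
  have "(\<integral>x. w' x \<partial>lborel) = (\<integral>t. indicator {0..1} t * (\<integral>x. w' x \<partial>lborel) \<partial>(lborel :: real measure))"
    by simp
  also have "\<dots> = (\<integral>t. (\<integral>x. ?h (t, x) \<partial>lborel) \<partial>lborel)"
    using integral_lborel_translate[of w'] by simp
  also have "\<dots> = (\<integral>x. (\<integral>t. ?h (t, x) \<partial>lborel) \<partial>lborel)"
    by (rule lborel_pair.Fubini_integral[symmetric, of "\<lambda>t x. ?h (t, x)"]) (use h in \<open>simp add: case_prod_unfold\<close>)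
  also have "\<dots> = (\<integral>x. w (x + v) - w x \<partial>lborel)"
  proof (rule integral_cong_AE)
    show "AE x in lborel. (\<integral>t. ?h (t, x) \<partial>lborel) = w (x + v) - w x"
      using lborel_pair.AE_integrable_fst'[OF h'] by eventually_elim (use ftc in simp)
  qed measurable
  also have "\<dots> = 0"
    using w integrable_lborel_translate[OF w, of v] by (simp add: integral_lborel_translate)
  finally show ?thesis .
qed

section \<open>Normalization, moments and integration by parts for the Gaussian\<close>

lemma gauss_dens_pos: "0 < gauss_dens x"
  by (simp add: gauss_dens_def)

lemma continuous_on_gauss_dens: "continuous_on UNIV gauss_dens"
  unfolding gauss_dens_def by (intro continuous_intros) auto

lemma borel_measurable_gauss_dens [measurable]: "gauss_dens \<in> borel_measurable borel"
  by (rule borel_measurable_continuous_onI[OF continuous_on_gauss_dens])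

lemma space_gauss [simp]: "space gauss = UNIV"
  by (simp add: gauss_def)

lemma sets_gauss [simp, measurable_cong]: "sets gauss = sets borel"
  by (simp add: gauss_def)

lemma exp_neg_norm_sq_prod:
  fixes x :: "'a::euclidean_space"
  shows "exp (- k * (norm x)\<^sup>2) = (\<Prod>b\<in>Basis. exp (- k * (x \<bullet> b)\<^sup>2))"
proof -
  have "(norm x)\<^sup>2 = (\<Sum>b\<in>Basis. (x \<bullet> b)\<^sup>2)"
    unfolding power2_norm_eq_inner euclidean_inner[of x x] by (simp add: power2_eq_square)
  then show ?thesis
    by (simp only: sum_distrib_left exp_sum[OF finite_Basis])
qed

text \<open>The exponential factors over the coordinates into one-dimensional normal densities. The
  scale is left free: 1 normalizes \<open>gauss\<close>, and \<open>sqrt 2\<close> controls the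
  majorant for second moments.\<close>

lemma nn_integral_exp_neg_norm_sq:
  fixes \<sigma> :: real
  assumes "0 < \<sigma>"
  shows "(\<integral>\<^sup>+(x::'a::euclidean_space). ennreal (exp (- (norm x)\<^sup>2 / (2 * \<sigma>\<^sup>2))) \<partial>lborel)
    = ennreal (sqrt (2 * pi * \<sigma>\<^sup>2) ^ DIM('a))"
proof -
  have 1: "(\<integral>\<^sup>+x. ennreal (exp (- (1 / (2 * \<sigma>\<^sup>2)) * x\<^sup>2)) \<partial>lborel) = ennreal (sqrt (2 * pi * \<sigma>\<^sup>2))"
  proof -
    have "(\<integral>\<^sup>+x. ennreal (normal_density 0 \<sigma> x) \<partial>lborel) = 1"
      using assms by (simp add: nn_integral_eq_integral)
    moreover have "ennreal (exp (- (1 / (2 * \<sigma>\<^sup>2)) * x\<^sup>2))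
        = ennreal (sqrt (2 * pi * \<sigma>\<^sup>2)) * ennreal (normal_density 0 \<sigma> x)" for x
      using assms by (simp add: normal_density_def flip: ennreal_mult')
    ultimately show ?thesis by (simp add: nn_integral_cmult)
  qed
  have "(\<integral>\<^sup>+(x::'a). ennreal (exp (- (norm x)\<^sup>2 / (2 * \<sigma>\<^sup>2))) \<partial>lborel)
     = (\<integral>\<^sup>+(x::'a). (\<Prod>b\<in>Basis. ennreal (exp (- (1 / (2 * \<sigma>\<^sup>2)) * (x \<bullet> b)\<^sup>2))) \<partial>lborel)"
  proof (rule nn_integral_cong)
    fix x :: 'a
    have "exp (- (norm x)\<^sup>2 / (2 * \<sigma>\<^sup>2)) = (\<Prod>b\<in>Basis. exp (- (1 / (2 * \<sigma>\<^sup>2)) * (x \<bullet> b)\<^sup>2))"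
      unfolding exp_neg_norm_sq_prod[symmetric] by simp
    then show "ennreal (exp (- (norm x)\<^sup>2 / (2 * \<sigma>\<^sup>2)))
        = (\<Prod>b\<in>Basis. ennreal (exp (- (1 / (2 * \<sigma>\<^sup>2)) * (x \<bullet> b)\<^sup>2)))"
      by (simp only: prod_ennreal[OF exp_ge_zero])
  qed
  also have "\<dots> = (\<Prod>b\<in>(Basis::'a set). (\<integral>\<^sup>+x. ennreal (exp (- (1 / (2 * \<sigma>\<^sup>2)) * x\<^sup>2)) \<partial>lborel))"
    by (rule nn_integral_lborel_prod) auto
  finally show ?thesis unfolding 1 by (simp add: ennreal_power)
qed

lemma gauss_dens_eq: "gauss_dens (x :: real^'n) = exp (- (norm x)\<^sup>2 / 2) / sqrt (2 * pi) ^ CARD('n)"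
proof -
  have "(2 * pi) powr (- real CARD('n) / 2) = ((2 * pi) powr (1/2)) powr (- real CARD('n))"
    by (subst powr_powr) simp
  also have "\<dots> = sqrt (2 * pi) powr (- real CARD('n))"
    by (subst powr_half_sqrt) auto
  also have "\<dots> = 1 / sqrt (2 * pi) ^ CARD('n)"
    by (subst powr_minus, subst powr_realpow) (auto simp: divide_inverse)
  finally show ?thesis by (simp add: gauss_dens_def)
qed

lemma prob_space_gauss: "prob_space (gauss :: (real^'n) measure)"
proof
  have "emeasure gauss (space gauss :: (real^'n) set)
    = (\<integral>\<^sup>+(x::real^'n). ennreal (1 / sqrt (2 * pi) ^ CARD('n)) * ennreal (exp (- (norm x)\<^sup>2 / 2)) \<partial>lborel)"
    by (auto simp: gauss_def emeasure_density gauss_dens_eq simp flip: ennreal_mult intro!: nn_integral_cong)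
  also have "\<dots> = ennreal (1 / sqrt (2 * pi) ^ CARD('n)) * ennreal (sqrt (2 * pi) ^ CARD('n))"
    using nn_integral_exp_neg_norm_sq[of 1, where ?'a = "real^'n"] by (simp add: nn_integral_cmult)
  also have "\<dots> = 1"
    by (simp flip: ennreal_mult add: ennreal_1)
  finally show "emeasure gauss (space gauss :: (real^'n) set) = 1" .
qed

interpretation gauss: prob_space "gauss :: (real^'n) measure"
  by (rule prob_space_gauss)

lemma measure_gauss_UNIV [simp]: "measure (gauss :: (real^'n) measure) UNIV = 1"
  using gauss.prob_space by simp

interpretation gauss2: pair_prob_space "gauss :: (real^'n) measure" "gauss :: (real^'m) measure" ..

lemma integrable_gauss_iff:
  fixes h :: "real^'n \<Rightarrow> 'b::{banach,second_countable_topology}"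
  assumes "h \<in> borel_measurable borel"
  shows "integrable gauss h \<longleftrightarrow> integrable lborel (\<lambda>x. gauss_dens x *\<^sub>R h x)"
  unfolding gauss_def using assms by (intro integrable_density) (auto simp: less_imp_le gauss_dens_pos)

lemma integral_gauss_eq:
  fixes h :: "real^'n \<Rightarrow> 'b::{banach,second_countable_topology}"
  assumes "h \<in> borel_measurable borel"
  shows "integral\<^sup>L gauss h = (\<integral>x. gauss_dens x *\<^sub>R h x \<partial>lborel)"
  unfolding gauss_def using assms by (intro integral_density) (auto simp: less_imp_le gauss_dens_pos)

lemma integrable_gauss_norm_sq: "integrable (gauss :: (real^'n) measure) (\<lambda>x. (norm x)\<^sup>2)"
proof -
  let ?k = "1 / sqrt (2 * pi) ^ CARD('n)"
  have "integrable lborel (\<lambda>x::real^'n. ?k * (4 * exp (- (norm x)\<^sup>2 / 4)))"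
  proof (intro integrable_mult_right integrableI_bounded)
    have "sqrt 2 * sqrt 2 = (2::real)" by simp
    then show "(\<integral>\<^sup>+(x::real^'n). ennreal (norm (exp (- (norm x)\<^sup>2 / 4))) \<partial>lborel) < \<infinity>"
      using nn_integral_exp_neg_norm_sq[of "sqrt 2", where ?'a = "real^'n"] by (simp add: ennreal_power)
  qed auto
  moreover have "norm (gauss_dens x *\<^sub>R (norm x)\<^sup>2) \<le> ?k * (4 * exp (- (norm x)\<^sup>2 / 4))" for x :: "real^'n"
  proof -
    \<comment> \<open>Half of the Gaussian exponent absorbs the quadratic factor and leaves an
      integrable Gaussian profile of variance 2.\<close>
    have "(norm x)\<^sup>2 / 4 \<le> exp ((norm x)\<^sup>2 / 4)"
      using exp_ge_add_one_self[of "(norm x)\<^sup>2 / 4"] by linarith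
    then have "(norm x)\<^sup>2 * exp (- (norm x)\<^sup>2 / 2) \<le> (4 * exp ((norm x)\<^sup>2 / 4)) * exp (- (norm x)\<^sup>2 / 2)"
      by (intro mult_right_mono) auto
    also have "\<dots> = 4 * exp (- (norm x)\<^sup>2 / 4)"
      by (simp flip: exp_add)
    finally show ?thesis
      by (simp add: gauss_dens_eq abs_mult divide_right_mono mult.commute)
  qed
  ultimately show ?thesis
    by (subst integrable_gauss_iff, simp)
      (erule Bochner_Integration.integrable_bound, auto)
qed

lemma integrable_gauss_inner_sq: "integrable (gauss :: (real^'n) measure) (\<lambda>x. (\<alpha> \<bullet> x)\<^sup>2)"
proof (rule Bochner_Integration.integrable_bound)
  show "integrable (gauss :: (real^'n) measure) (\<lambda>x. (norm \<alpha>)\<^sup>2 * (norm x)\<^sup>2)"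
    by (intro integrable_mult_right integrable_gauss_norm_sq)
  show "AE x in gauss. norm ((\<alpha> \<bullet> x)\<^sup>2) \<le> norm ((norm \<alpha>)\<^sup>2 * (norm x)\<^sup>2)"
    using Cauchy_Schwarz_ineq2[of \<alpha>] by (auto simp: power_mult_distrib[symmetric] abs_le_square_iff[symmetric] abs_mult)
qed auto

lemma gauss_dens_line_deriv:
  "((\<lambda>t. gauss_dens (x + t *\<^sub>R v)) has_real_derivative - (v \<bullet> x) * gauss_dens x) (at 0)"
proof -
  have *: "(norm (x + t *\<^sub>R v))\<^sup>2 = (norm x)\<^sup>2 + 2 * t * (v \<bullet> x) + t\<^sup>2 * (norm v)\<^sup>2" for t
    unfolding power2_norm_eq_inner
    by (simp add: inner_add_left inner_add_right inner_commute power2_eq_square algebra_simps)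
  show ?thesis unfolding gauss_dens_def *
    by (auto intro!: derivative_eq_intros)
qed

text \<open>Only the combination \<open>u' - u (v \<bullet> x)\<close> has to be integrable here, not its two terms.\<close>

lemma gauss_ibp:
  fixes u u' :: "real^'n \<Rightarrow> real"
  assumes u: "integrable gauss u" and u': "integrable gauss (\<lambda>x. u' x - u x * (v \<bullet> x))"
    and d: "\<And>x. ((\<lambda>t. u (x + t *\<^sub>R v)) has_real_derivative u' x) (at 0)"
  shows "(\<integral>x. u' x - u x * (v \<bullet> x) \<partial>gauss) = 0"
proof -
  have [measurable]: "u \<in> borel_measurable borel" "(\<lambda>x. u' x - u x * (v \<bullet> x)) \<in> borel_measurable borel"
    using u u' by (auto dest: borel_measurable_integrable)
  have "(\<integral>x. gauss_dens x * (u' x - u x * (v \<bullet> x)) \<partial>lborel) = 0"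
  proof (rule integral_directional_derivative_eq_0)
    show "integrable lborel (\<lambda>x. gauss_dens x * u x)"
      "integrable lborel (\<lambda>x. gauss_dens x * (u' x - u x * (v \<bullet> x)))"
      using u u' by (auto simp: integrable_gauss_iff)
    show "((\<lambda>t. gauss_dens (x + t *\<^sub>R v) * u (x + t *\<^sub>R v)) has_real_derivative
         gauss_dens x * (u' x - u x * (v \<bullet> x))) (at 0)" for x
      by (rule DERIV_cong[OF DERIV_mult[OF gauss_dens_line_deriv d]]) (simp add: algebra_simps)
  qed
  then show ?thesis by (simp add: integral_gauss_eq)
qed

lemma integrable_gauss_inner: "integrable (gauss :: (real^'n) measure) (\<lambda>x. \<alpha> \<bullet> x)"
proof (rule Bochner_Integration.integrable_bound)
  show "integrable (gauss :: (real^'n) measure) (\<lambda>x. 1 + (\<alpha> \<bullet> x)\<^sup>2)"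
    by (intro Bochner_Integration.integrable_add integrable_gauss_inner_sq) simp
  have "\<bar>y\<bar> \<le> 1 + y\<^sup>2" for y :: real
    using sum_squares_bound[of "\<bar>y\<bar>" 1] by simp
  then show "AE x in gauss. norm (\<alpha> \<bullet> x) \<le> norm (1 + (\<alpha> \<bullet> x)\<^sup>2)" by auto
qed auto

lemma integrable_gauss_norm: "integrable (gauss :: (real^'n) measure) norm"
proof (rule Bochner_Integration.integrable_bound)
  show "integrable (gauss :: (real^'n) measure) (\<lambda>x. 1 + (norm x)\<^sup>2)"
    by (intro Bochner_Integration.integrable_add integrable_gauss_norm_sq) simp
  have "y \<le> 1 + y\<^sup>2" for y :: real
    using sum_squares_bound[of y 1] zero_le_power2[of y] unfolding power_one mult_1_right by linarith
  then show "AE x in gauss. norm (norm x) \<le> norm (1 + (norm x)\<^sup>2)" by auto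
qed auto

lemma integral_gauss_inner [simp]: "(\<integral>x. \<alpha> \<bullet> x \<partial>gauss) = 0"
  using gauss_ibp[of "\<lambda>_. 1" "\<lambda>_. 0" \<alpha>] integrable_gauss_inner[of \<alpha>] by simp

lemma integral_gauss_inner_sq [simp]: "(\<integral>x. (\<alpha> \<bullet> x)\<^sup>2 \<partial>gauss) = (norm \<alpha>)\<^sup>2"
proof -
  have "(\<integral>x. (norm \<alpha>)\<^sup>2 - (\<alpha> \<bullet> x) * (\<alpha> \<bullet> x) \<partial>gauss) = 0"
  proof (rule gauss_ibp)
    show "integrable gauss (\<lambda>x. (norm \<alpha>)\<^sup>2 - (\<alpha> \<bullet> x) * (\<alpha> \<bullet> x))"
      using integrable_gauss_inner_sq[of \<alpha>] by (simp add: power2_eq_square)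
    show "((\<lambda>t. \<alpha> \<bullet> (x + t *\<^sub>R \<alpha>)) has_real_derivative (norm \<alpha>)\<^sup>2) (at 0)" for x
      by (auto intro!: derivative_eq_intros simp: inner_add_right power2_norm_eq_inner)
  qed (rule integrable_gauss_inner)
  then show ?thesis
    using integrable_gauss_inner_sq[of \<alpha>] by (simp add: power2_eq_square)
qed

section \<open>Reflection invariance\<close>

lemma nn_integral_lborel_translate:
  fixes h :: "'a::euclidean_space \<Rightarrow> ennreal"
  assumes [measurable]: "h \<in> borel_measurable borel"
  shows "(\<integral>\<^sup>+x. h (x + c) \<partial>lborel) = (\<integral>\<^sup>+x. h x \<partial>lborel)"
proof -
  have "(\<integral>\<^sup>+x. h x \<partial>lborel) = (\<integral>\<^sup>+x. h x \<partial>(distr lborel borel ((+) c)))"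
    by (simp add: lborel_distr_plus)
  also have "\<dots> = (\<integral>\<^sup>+x. h (c + x) \<partial>lborel)"
    by (rule nn_integral_distr) auto
  finally show ?thesis by (simp add: add.commute)
qed

lemma nn_integral_lborel_uminus:
  fixes h :: "'a::euclidean_space \<Rightarrow> ennreal"
  assumes [measurable]: "h \<in> borel_measurable borel"
  shows "(\<integral>\<^sup>+x. h (- x) \<partial>lborel) = (\<integral>\<^sup>+x. h x \<partial>lborel)"
proof -
  have "(\<integral>\<^sup>+x. h x \<partial>lborel) = (\<integral>\<^sup>+x. h x \<partial>(distr lborel borel uminus))"
    using lborel_affine[of "-1" "0::'a"] by (simp add: density_1)
  also have "\<dots> = (\<integral>\<^sup>+x. h (- x) \<partial>lborel)"
    by (rule nn_integral_distr) auto
  finally show ?thesis by simp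
qed

context
  fixes h :: "'a::euclidean_space \<times> 'a \<Rightarrow> ennreal"
  assumes h[measurable]: "h \<in> borel_measurable (borel \<Otimes>\<^sub>M borel)"
begin

text \<open>Integrating the moving coordinate first turns the shear into a translation whose amount
  is fixed by the other coordinate.\<close>

lemma nn_integral_shear_fst:
  "(\<integral>\<^sup>+p. h (fst p + k *\<^sub>R snd p, snd p) \<partial>(lborel \<Otimes>\<^sub>M lborel)) = (\<integral>\<^sup>+p. h p \<partial>(lborel \<Otimes>\<^sub>M lborel))"
  by (subst (1 2) lborel_pair.nn_integral_snd[symmetric])
    (auto intro!: nn_integral_cong simp: nn_integral_lborel_translate[of "\<lambda>x. h (x, _)"])

lemma nn_integral_shear_snd:
  "(\<integral>\<^sup>+p. h (fst p, snd p + k *\<^sub>R fst p) \<partial>(lborel \<Otimes>\<^sub>M lborel)) = (\<integral>\<^sup>+p. h p \<partial>(lborel \<Otimes>\<^sub>M lborel))"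
  by (subst (1 2) lborel.nn_integral_fst[symmetric])
    (auto intro!: nn_integral_cong simp: nn_integral_lborel_translate[of "\<lambda>y. h (_, y)"])

lemma nn_integral_flip_snd:
  "(\<integral>\<^sup>+p. h (fst p, - snd p) \<partial>(lborel \<Otimes>\<^sub>M lborel)) = (\<integral>\<^sup>+p. h p \<partial>(lborel \<Otimes>\<^sub>M lborel))"
  by (subst (1 2) lborel.nn_integral_fst[symmetric])
    (auto intro!: nn_integral_cong simp: nn_integral_lborel_uminus[of "\<lambda>y. h (_, y)"])

end

text \<open>A reflection instead of a rotation because it is its own inverse: the old coordinates
  are the same expressions in the new ones. Its first component agrees with that of a rotation and,
  for c = exp (- t), is the point at which Mehler's formula evaluates.\<close>

definition reflect2 :: "real \<Rightarrow> real \<Rightarrow> 'a::real_vector \<times> 'a \<Rightarrow> 'a \<times> 'a" where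
  "reflect2 c s p = (c *\<^sub>R fst p + s *\<^sub>R snd p, s *\<^sub>R fst p - c *\<^sub>R snd p)"

lemma measurable_reflect2 [measurable]:
  "reflect2 c s \<in> (borel \<Otimes>\<^sub>M borel) \<rightarrow>\<^sub>M (borel \<Otimes>\<^sub>M (borel :: 'a::euclidean_space measure))"
  unfolding reflect2_def by measurable

lemma reflect2_reflect2:
  assumes "c\<^sup>2 + s\<^sup>2 = 1"
  shows "reflect2 c s (reflect2 c s p) = p"
proof -
  have "c * c + s * s = 1" using assms by (simp add: power2_eq_square)
  then have "(c * c) *\<^sub>R x + (s * s) *\<^sub>R x = x" for x :: 'a
    by (metis scaleR_add_left scaleR_one)
  then show ?thesis
    by (cases p) (simp add: reflect2_def algebra_simps)
qed

text \<open>A reflection is a sign change after a product of three shears.\<close>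

lemma nn_integral_lborel_reflect2:
  fixes h :: "'a::euclidean_space \<times> 'a \<Rightarrow> ennreal"
  assumes [measurable]: "h \<in> borel_measurable (borel \<Otimes>\<^sub>M borel)" and cs: "c\<^sup>2 + s\<^sup>2 = 1" and c: "0 \<le> c"
  shows "(\<integral>\<^sup>+p. h (reflect2 c s p) \<partial>(lborel \<Otimes>\<^sub>M lborel)) = (\<integral>\<^sup>+p. h p \<partial>(lborel \<Otimes>\<^sub>M lborel))"
proof (cases "s = 0")
  case True
  with cs c have "c = 1" by (simp add: power2_eq_1_iff)
  with True show ?thesis using nn_integral_flip_snd[of h] by (simp add: reflect2_def)
next
  case False
  \<comment> \<open>For c = cos \<theta> and s = sin \<theta> this is tan (\<theta> / 2), the outer
    factor in the factorization of a rotation into three shears; \<open>k2\<close> is the other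
    half-angle formula k = s / (1 + c).\<close>
  define k where "k = (1 - c) / s"
  have k: "k * s = 1 - c" using False by (simp add: k_def)
  have k2: "k * c + k = s"
  proof -
    have "s * (k * c + k) = (k * s) * (1 + c)" by (simp add: algebra_simps)
    also have "\<dots> = s * s" using cs by (simp add: k algebra_simps power2_eq_square)
    finally show ?thesis using False by simp
  qed
  let ?F = "\<lambda>p::'a\<times>'a. (fst p, - snd p)"
  let ?U = "\<lambda>p::'a\<times>'a. (fst p + k *\<^sub>R snd p, snd p)"
  let ?L = "\<lambda>p::'a\<times>'a. (fst p, snd p + (- s) *\<^sub>R fst p)"
  have "reflect2 c s p = ?F (?U (?L (?U p)))" for p :: "'a \<times> 'a"
  proof -
    obtain x y where p: "p = (x, y)" by (cases p)
    have 2: "y + (- s) *\<^sub>R (x + k *\<^sub>R y) = c *\<^sub>R y - s *\<^sub>R x"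
    proof -
      have "y + (- s) *\<^sub>R (x + k *\<^sub>R y) = (1 - k * s) *\<^sub>R y - s *\<^sub>R x" by (simp add: algebra_simps)
      then show ?thesis by (simp add: k)
    qed
    have 1: "x + k *\<^sub>R y + k *\<^sub>R (c *\<^sub>R y - s *\<^sub>R x) = c *\<^sub>R x + s *\<^sub>R y"
    proof -
      have "x + k *\<^sub>R y + k *\<^sub>R (c *\<^sub>R y - s *\<^sub>R x) = (1 - k * s) *\<^sub>R x + (k * c + k) *\<^sub>R y"
        by (simp add: algebra_simps)
      then show ?thesis by (simp add: k k2)
    qed
    show ?thesis
      by (simp only: p reflect2_def fst_conv snd_conv 2 1 minus_diff_eq)
  qed
  then have "(\<integral>\<^sup>+p. h (reflect2 c s p) \<partial>(lborel \<Otimes>\<^sub>M lborel))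
      = (\<integral>\<^sup>+p. h (?F (?U (?L (?U p)))) \<partial>(lborel \<Otimes>\<^sub>M lborel))" by simp
  also have "\<dots> = (\<integral>\<^sup>+p. h (?F (?U (?L p))) \<partial>(lborel \<Otimes>\<^sub>M lborel))"
    by (rule nn_integral_shear_fst[of "\<lambda>p. h (?F (?U (?L p)))"]) measurable
  also have "\<dots> = (\<integral>\<^sup>+p. h (?F (?U p)) \<partial>(lborel \<Otimes>\<^sub>M lborel))"
    by (rule nn_integral_shear_snd[of "\<lambda>p. h (?F (?U p))"]) measurable
  also have "\<dots> = (\<integral>\<^sup>+p. h (?F p) \<partial>(lborel \<Otimes>\<^sub>M lborel))"
    by (rule nn_integral_shear_fst[of "\<lambda>p. h (?F p)"]) measurable
  also have "\<dots> = (\<integral>\<^sup>+p. h p \<partial>(lborel \<Otimes>\<^sub>M lborel))"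
    by (rule nn_integral_flip_snd) measurable
  finally show ?thesis .
qed

lemma gauss2_eq: "gauss \<Otimes>\<^sub>M gauss = density (lborel \<Otimes>\<^sub>M lborel)
    (\<lambda>p :: (real^'n) \<times> (real^'n). ennreal (gauss_dens (fst p)) * ennreal (gauss_dens (snd p)))"
proof -
  have "sigma_finite_measure (density lborel (\<lambda>x::real^'n. ennreal (gauss_dens x)))"
    using gauss.sigma_finite_measure_axioms by (simp add: gauss_def)
  then show ?thesis unfolding gauss_def
    by (subst pair_measure_density) (auto simp: case_prod_unfold lborel.sigma_finite_measure_axioms)
qed

lemma gauss_dens_reflect2:
  fixes p :: "(real^'n) \<times> (real^'n)"
  assumes "c\<^sup>2 + s\<^sup>2 = 1"
  shows "gauss_dens (fst (reflect2 c s p)) * gauss_dens (snd (reflect2 c s p)) = gauss_dens (fst p) * gauss_dens (snd p)"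
proof -
  have "(norm (c *\<^sub>R x + s *\<^sub>R y))\<^sup>2 + (norm (s *\<^sub>R x - c *\<^sub>R y))\<^sup>2 = (norm x)\<^sup>2 + (norm y)\<^sup>2" for x y :: "real^'n"
  proof -
    have "(norm (c *\<^sub>R x + s *\<^sub>R y))\<^sup>2 + (norm (s *\<^sub>R x - c *\<^sub>R y))\<^sup>2 = (c\<^sup>2 + s\<^sup>2) * ((norm x)\<^sup>2 + (norm y)\<^sup>2)"
      unfolding power2_norm_eq_inner
      by (simp add: inner_add_left inner_add_right inner_diff_left inner_diff_right inner_commute
          power2_eq_square algebra_simps)
    then show ?thesis using assms by simp
  qed
  from this[of "fst p" "snd p"] show ?thesis
    by (simp add: gauss_dens_def reflect2_def exp_add[symmetric] algebra_simps add_divide_distrib[symmetric]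
      flip: minus_add_distrib)
qed

text \<open>Lebesgue measure and the product density are invariant separately, the density because
  it depends only on the Euclidean norm of the pair.\<close>

lemma distr_reflect2:
  assumes cs: "c\<^sup>2 + s\<^sup>2 = 1" and c: "0 \<le> c"
  shows "distr (gauss \<Otimes>\<^sub>M gauss) (borel \<Otimes>\<^sub>M borel) (reflect2 c s) = gauss \<Otimes>\<^sub>M (gauss :: (real^'n) measure)"
proof (rule measure_eqI)
  fix A :: "((real^'n) \<times> (real^'n)) set"
  assume "A \<in> sets (distr (gauss \<Otimes>\<^sub>M gauss) (borel \<Otimes>\<^sub>M borel) (reflect2 c s))"
  then have A[measurable]: "A \<in> sets (borel \<Otimes>\<^sub>M borel)" by simp
  let ?D = "\<lambda>p :: (real^'n) \<times> (real^'n). ennreal (gauss_dens (fst p)) * ennreal (gauss_dens (snd p))"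
  have D: "?D (reflect2 c s p) = ?D p" for p
    using gauss_dens_reflect2[OF cs, of p] by (simp add: less_imp_le gauss_dens_pos flip: ennreal_mult)
  have [measurable]: "reflect2 c s \<in> (lborel \<Otimes>\<^sub>M lborel) \<rightarrow>\<^sub>M (borel \<Otimes>\<^sub>M (borel :: (real^'n) measure))"
    using measurable_reflect2 by (simp cong: measurable_cong_sets)
  have s: "reflect2 c s -` A \<in> sets (lborel \<Otimes>\<^sub>M lborel)"
    using measurable_sets[OF measurable_reflect2 A] by (simp add: space_pair_measure cong: sets_pair_measure_cong)
  have "emeasure (distr (gauss \<Otimes>\<^sub>M gauss) (borel \<Otimes>\<^sub>M borel) (reflect2 c s)) A
      = emeasure (gauss \<Otimes>\<^sub>M gauss) (reflect2 c s -` A)"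
    by (subst emeasure_distr) (auto simp: space_pair_measure)
  also have "\<dots> = (\<integral>\<^sup>+p. ?D (reflect2 c s p) * indicator A (reflect2 c s p) \<partial>(lborel \<Otimes>\<^sub>M lborel))"
    unfolding gauss2_eq using s
    by (subst emeasure_density) (auto simp: D indicator_def cong: nn_integral_cong)
  also have "\<dots> = (\<integral>\<^sup>+p. ?D p * indicator A p \<partial>(lborel \<Otimes>\<^sub>M lborel))"
    by (rule nn_integral_lborel_reflect2[of "\<lambda>p. ?D p * indicator A p", OF _ cs c]) measurable
  also have "\<dots> = emeasure (gauss \<Otimes>\<^sub>M gauss) A"
    unfolding gauss2_eq by (subst emeasure_density) auto
  finally show "emeasure (distr (gauss \<Otimes>\<^sub>M gauss) (borel \<Otimes>\<^sub>M borel) (reflect2 c s)) A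
    = emeasure (gauss \<Otimes>\<^sub>M gauss) A" .
qed (simp cong: sets_pair_measure_cong)

lemma distr_rotate_fst:
  assumes cs: "c\<^sup>2 + s\<^sup>2 = 1" and c: "0 \<le> c"
  shows "distr (gauss \<Otimes>\<^sub>M gauss) borel (\<lambda>p. c *\<^sub>R fst p + s *\<^sub>R snd p) = (gauss :: (real^'n) measure)"
proof -
  have "distr (gauss \<Otimes>\<^sub>M gauss) borel (\<lambda>p. c *\<^sub>R fst p + s *\<^sub>R snd p)
      = distr (distr (gauss \<Otimes>\<^sub>M gauss) (borel \<Otimes>\<^sub>M borel) (reflect2 c s)) borel (fst :: (real^'n)\<times>(real^'n) \<Rightarrow> _)"
    by (subst distr_distr) (auto simp: comp_def reflect2_def)
  also have "\<dots> = distr (gauss \<Otimes>\<^sub>M (gauss :: (real^'n) measure)) gauss fst"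
    unfolding distr_reflect2[OF assms] by (rule distr_cong) auto
  also have "\<dots> = gauss" by (rule gauss.distr_pair_fst)
  finally show ?thesis .
qed

section \<open>The Mehler operators and relative Fisher information\<close>

lemma integrable_reflect2:
  fixes h :: "(real^'n) \<times> (real^'n) \<Rightarrow> 'b::{banach,second_countable_topology}"
  assumes "c\<^sup>2 + s\<^sup>2 = 1" "0 \<le> c" and "integrable (gauss \<Otimes>\<^sub>M gauss) h"
  shows "integrable (gauss \<Otimes>\<^sub>M gauss) (\<lambda>p. h (reflect2 c s p))"
proof -
  have "integrable (distr (gauss \<Otimes>\<^sub>M gauss) (borel \<Otimes>\<^sub>M borel) (reflect2 c s)) h"
    using assms by (simp add: distr_reflect2)
  then show ?thesis by (rule integrable_distr[rotated]) measurable
qed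

lemma integral_reflect2:
  fixes h :: "(real^'n) \<times> (real^'n) \<Rightarrow> 'b::{banach,second_countable_topology}"
  assumes "c\<^sup>2 + s\<^sup>2 = 1" "0 \<le> c" and [measurable]: "h \<in> borel_measurable (borel \<Otimes>\<^sub>M borel)"
  shows "(\<integral>p. h (reflect2 c s p) \<partial>(gauss \<Otimes>\<^sub>M gauss)) = (\<integral>p. h p \<partial>(gauss \<Otimes>\<^sub>M gauss))"
proof -
  have "(\<integral>p. h p \<partial>(gauss \<Otimes>\<^sub>M gauss)) = (\<integral>p. h p \<partial>(distr (gauss \<Otimes>\<^sub>M gauss) (borel \<Otimes>\<^sub>M borel) (reflect2 c s)))"
    using assms by (simp add: distr_reflect2)
  also have "\<dots> = (\<integral>p. h (reflect2 c s p) \<partial>(gauss \<Otimes>\<^sub>M gauss))"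
    by (rule integral_distr) measurable
  finally show ?thesis ..
qed

lemma integrable_rotate_fst:
  fixes h :: "real^'n \<Rightarrow> 'b::{banach,second_countable_topology}"
  assumes "c\<^sup>2 + s\<^sup>2 = 1" "0 \<le> c" and "integrable gauss h"
  shows "integrable (gauss \<Otimes>\<^sub>M gauss) (\<lambda>p. h (c *\<^sub>R fst p + s *\<^sub>R snd p))"
proof -
  have "integrable (distr (gauss \<Otimes>\<^sub>M gauss) borel (\<lambda>p. c *\<^sub>R fst p + s *\<^sub>R snd p)) h"
    using assms by (simp add: distr_rotate_fst)
  then show ?thesis by (rule integrable_distr[rotated]) measurable
qed

lemma integral_rotate_fst:
  fixes h :: "real^'n \<Rightarrow> 'b::{banach,second_countable_topology}"
  assumes "c\<^sup>2 + s\<^sup>2 = 1" "0 \<le> c" and [measurable]: "h \<in> borel_measurable borel"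
  shows "(\<integral>p. h (c *\<^sub>R fst p + s *\<^sub>R snd p) \<partial>(gauss \<Otimes>\<^sub>M gauss)) = (\<integral>x. h x \<partial>gauss)"
proof -
  have "(\<integral>x. h x \<partial>gauss) = (\<integral>x. h x \<partial>(distr (gauss \<Otimes>\<^sub>M gauss) borel (\<lambda>p. c *\<^sub>R fst p + s *\<^sub>R snd p)))"
    using assms by (simp add: distr_rotate_fst)
  also have "\<dots> = (\<integral>p. h (c *\<^sub>R fst p + s *\<^sub>R snd p) \<partial>(gauss \<Otimes>\<^sub>M gauss))"
    by (rule integral_distr) measurable
  finally show ?thesis ..
qed

lemma AE_rotate_fst:
  fixes P :: "real^'n \<Rightarrow> bool"
  assumes "c\<^sup>2 + s\<^sup>2 = 1" "0 \<le> c" and "AE x in gauss. P x"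
  shows "AE p in gauss \<Otimes>\<^sub>M gauss. P (c *\<^sub>R fst p + s *\<^sub>R snd p)"
proof (rule AE_distrD[where M'=borel and f="\<lambda>p. c *\<^sub>R fst p + s *\<^sub>R snd p" and P=P])
  show "AE x in distr (gauss \<Otimes>\<^sub>M gauss) borel (\<lambda>p. c *\<^sub>R fst p + s *\<^sub>R snd p). P x"
    unfolding distr_rotate_fst[OF assms(1,2)] by (rule assms(3))
qed measurable

lemma integrable_gauss2_prod:
  fixes h :: "real^'n \<Rightarrow> real" and k :: "real^'m \<Rightarrow> real"
  assumes h: "integrable gauss h" and k: "integrable gauss k"
  shows "integrable (gauss \<Otimes>\<^sub>M gauss) (\<lambda>p. h (fst p) * k (snd p))"
    and "(\<integral>p. h (fst p) * k (snd p) \<partial>(gauss \<Otimes>\<^sub>M gauss)) = (\<integral>x. h x \<partial>gauss) * (\<integral>x. k x \<partial>gauss)"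
proof -
  have [measurable]: "h \<in> borel_measurable borel" "k \<in> borel_measurable borel"
    using h k by (auto dest: borel_measurable_integrable)
  show i: "integrable (gauss \<Otimes>\<^sub>M gauss) (\<lambda>p. h (fst p) * k (snd p))"
  proof (rule gauss2.Fubini_integrable)
    show "integrable gauss (\<lambda>x. \<integral>y. norm (h (fst (x, y)) * k (snd (x, y))) \<partial>gauss)"
      using h by (simp add: abs_mult)
    show "AE x in gauss. integrable gauss (\<lambda>y. h (fst (x, y)) * k (snd (x, y)))"
      using k by simp
  qed measurable
  show "(\<integral>p. h (fst p) * k (snd p) \<partial>(gauss \<Otimes>\<^sub>M gauss)) = (\<integral>x. h x \<partial>gauss) * (\<integral>x. k x \<partial>gauss)"
    using gauss2.integral_fst'[OF i] by simp
qed

text \<open>Jensen's inequality for the jointly convex (u, v) \<mapsto> |u|^2 / v. It follows from 2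
  T |g| \<le> |g|^2 / f + T^2 f: the choice T = 1 gives integrability of \<open>g\<close>, and T =
  \<integral> |g| / \<integral> f gives the bound. The convention x / 0 = 0 makes the assumption on
  the zeros of \<open>f\<close> essential.\<close>

lemma cauchy_schwarz_quotient:
  fixes f :: "'a \<Rightarrow> real" and g :: "'a \<Rightarrow> 'b::{banach,second_countable_topology}"
  assumes f: "integrable M f" and f_nn: "\<And>x. 0 \<le> f x" and g[measurable]: "g \<in> borel_measurable M"
    and f0: "AE x in M. f x = 0 \<longrightarrow> g x = 0" and q: "integrable M (\<lambda>x. (norm (g x))\<^sup>2 / f x)"
  shows "integrable M g"
    and "(norm (\<integral>x. g x \<partial>M))\<^sup>2 / (\<integral>x. f x \<partial>M) \<le> (\<integral>x. (norm (g x))\<^sup>2 / f x \<partial>M)"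
proof -
  have young: "AE x in M. 2 * T * norm (g x) \<le> (norm (g x))\<^sup>2 / f x + T\<^sup>2 * f x" for T
    using f0
  proof eventually_elim
    fix x assume 0: "f x = 0 \<longrightarrow> g x = 0"
    show "2 * T * norm (g x) \<le> (norm (g x))\<^sup>2 / f x + T\<^sup>2 * f x"
    proof (cases "f x = 0")
      case False
      then have p: "0 < f x" using f_nn[of x] by simp
      have "0 \<le> (norm (g x) - T * f x)\<^sup>2 / f x" using p by simp
      also have "\<dots> = (norm (g x))\<^sup>2 / f x + T\<^sup>2 * f x - 2 * T * norm (g x)"
        using p by (simp add: field_simps power2_eq_square)
      finally show ?thesis by simp
    qed (use 0 in simp)
  qed
  show gi: "integrable M g"
  proof (rule Bochner_Integration.integrable_bound)
    show "integrable M (\<lambda>x. (norm (g x))\<^sup>2 / f x + f x)" using f q by simp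
    show "AE x in M. norm (g x) \<le> norm ((norm (g x))\<^sup>2 / f x + f x)"
      using young[of 1]
    proof eventually_elim
      case (elim x)
      moreover have "0 \<le> (norm (g x))\<^sup>2 / f x + f x" using f_nn[of x] by simp
      ultimately show ?case using norm_ge_zero[of "g x"] by simp
    qed
  qed measurable
  let ?n = "\<integral>x. norm (g x) \<partial>M" and ?m = "\<integral>x. f x \<partial>M" and ?q = "\<integral>x. (norm (g x))\<^sup>2 / f x \<partial>M"
  have le: "2 * T * ?n \<le> ?q + T\<^sup>2 * ?m" for T
  proof -
    have "(\<integral>x. 2 * T * norm (g x) \<partial>M) \<le> (\<integral>x. (norm (g x))\<^sup>2 / f x + T\<^sup>2 * f x \<partial>M)"
      using young gi f q by (intro integral_mono_AE) auto
    then show ?thesis using f q by simp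
  qed
  have m: "0 \<le> ?m" and q0: "0 \<le> ?q" using f_nn by simp_all
  have "(norm (\<integral>x. g x \<partial>M))\<^sup>2 / ?m \<le> ?n\<^sup>2 / ?m"
    using m by (intro divide_right_mono power_mono integral_norm_bound) auto
  also have "\<dots> \<le> ?q"
  proof (cases "?m = 0")
    case False
    with le[of "?n / ?m"] m show ?thesis by (simp add: field_simps power2_eq_square)
  qed (use q0 in simp)
  finally show "(norm (\<integral>x. g x \<partial>M))\<^sup>2 / ?m \<le> ?q" .
qed

section \<open>Mehler's formula and the semigroup law\<close>

abbreviation co :: "real \<Rightarrow> real" where
  "co a \<equiv> sqrt (1 - a\<^sup>2)"

lemma co_sq: "0 \<le> a \<Longrightarrow> a \<le> 1 \<Longrightarrow> a\<^sup>2 + (co a)\<^sup>2 = 1"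
  by (simp add: power_le_one)

lemma sq_co: "0 \<le> a \<Longrightarrow> a \<le> 1 \<Longrightarrow> (co a)\<^sup>2 = 1 - a\<^sup>2"
  by (simp add: power_le_one)

text \<open>The Ornstein--Uhlenbeck operator \<open>P\<^sub>t\<close> with \<open>a = exp (- t)\<close>.\<close>

definition mehler :: "real \<Rightarrow> (real^'n \<Rightarrow> 'b::{banach,second_countable_topology}) \<Rightarrow> real^'n \<Rightarrow> 'b" where
  "mehler a h x = (\<integral>y. h (a *\<^sub>R x + co a *\<^sub>R y) \<partial>gauss)"

lemma borel_measurable_mehler [measurable]:
  assumes [measurable]: "h \<in> borel_measurable borel"
  shows "mehler a h \<in> borel_measurable borel"
  unfolding mehler_def by measurable

lemma mehler_one [simp]: "mehler 1 h x = h x"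
  by (simp add: mehler_def)

lemma mehler_nonneg: "(\<And>x. 0 \<le> h x) \<Longrightarrow> 0 \<le> mehler a (h :: _ \<Rightarrow> real) x"
  by (simp add: mehler_def)

context
  fixes a :: real
  assumes a: "0 \<le> a" "a \<le> 1"
begin

lemma AE_integrable_mehler:
  fixes h :: "real^'n \<Rightarrow> 'b::{banach,second_countable_topology}"
  assumes "integrable gauss h"
  shows "AE x in gauss. integrable gauss (\<lambda>y. h (a *\<^sub>R x + co a *\<^sub>R y))"
  using gauss2.AE_integrable_fst'[OF integrable_rotate_fst[OF co_sq[OF a] a(1) assms]] by simp

lemma integrable_mehler: "integrable gauss h \<Longrightarrow> integrable gauss (mehler a h)"
  using gauss2.integrable_fst'[OF integrable_rotate_fst[OF co_sq[OF a] a(1)]]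
  unfolding mehler_def by fastforce

lemma integral_mehler:
  assumes "integrable gauss h"
  shows "(\<integral>x. mehler a h x \<partial>gauss) = (\<integral>x. h x \<partial>gauss)"
  using gauss2.integral_fst'[OF integrable_rotate_fst[OF co_sq[OF a] a(1) assms]]
    integral_rotate_fst[OF co_sq[OF a] a(1), of h] assms
  unfolding mehler_def using borel_measurable_integrable[OF assms] by simp

lemma AE_mehler:
  fixes P :: "real^'n \<Rightarrow> bool"
  assumes "AE x in gauss. P x"
  shows "AE x in gauss. AE y in gauss. P (a *\<^sub>R x + co a *\<^sub>R y)"
  using gauss2.AE_pair[OF AE_rotate_fst[OF co_sq[OF a] a(1) assms]] by simp

end

lemma co_mult_pos:
  assumes "0 \<le> a" "a \<le> 1" "0 \<le> b" "b \<le> 1" "a * b \<noteq> 1"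
  shows "0 < co (a * b)"
proof -
  have "a * b \<le> 1" using assms by (simp add: mult_le_one)
  with assms have "a * b < 1" by simp
  then have "(a * b)\<^sup>2 < 1" using assms by (simp add: power_less_one_iff abs_square_less_1)
  then show ?thesis by simp
qed

text \<open>Additivity of variances: the noises of two successive steps have sizes
  \<open>b * co a\<close> and \<open>co b\<close>, and the squares add up to that of
  \<open>co (a * b)\<close>. The normalized coefficients form a unit vector.\<close>

lemma mehler_rotation_coeffs:
  assumes a: "0 \<le> a" "a \<le> 1" and b: "0 \<le> b" "b \<le> 1" and n: "a * b \<noteq> 1"
  shows "(b * co a / co (a * b))\<^sup>2 + (co b / co (a * b))\<^sup>2 = 1"
proof -
  have p: "0 < co (a * b)" by (rule co_mult_pos[OF a b n])
  then have ab: "(co (a * b))\<^sup>2 = 1 - (a * b)\<^sup>2" by (simp only: real_sqrt_gt_0_iff real_sqrt_pow2 less_imp_le)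
  have "(b * co a)\<^sup>2 + (co b)\<^sup>2 = (co (a * b))\<^sup>2"
    unfolding ab unfolding power_mult_distrib sq_co[OF a] sq_co[OF b] by (simp add: algebra_simps)
  moreover have "(co (a * b))\<^sup>2 \<noteq> 0" using p by simp
  ultimately have "((b * co a)\<^sup>2 + (co b)\<^sup>2) / (co (a * b))\<^sup>2 = 1" by (metis divide_self)
  then show ?thesis by (simp only: power_divide add_divide_distrib)
qed

text \<open>The two independent noises combine into a single standard Gaussian of size
  \<open>co (a * b)\<close>. Fixing \<open>x\<close> lets integrability be imposed along one kernel;
  almost every \<open>x\<close> satisfies it.\<close>

lemma mehler_mehler_at:
  assumes a: "0 \<le> a" "a \<le> 1" and b: "0 \<le> b" "b \<le> 1"
    and i: "integrable gauss (\<lambda>y. h ((a * b) *\<^sub>R x + co (a * b) *\<^sub>R y))"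
  shows "mehler a (mehler b h) x = mehler (a * b) h x"
proof (cases "a * b = 1")
  \<comment> \<open>Here the total noise \<open>co (a * b)\<close> is 0 and cannot be divided by;
    both steps are then trivial.\<close>
  case True
  moreover have "a * b \<le> a" "a * b \<le> b" using a b by (auto simp: mult_left_le mult_left_le_one_le)
  ultimately have "a = 1" "b = 1" using a b by auto
  then show ?thesis by simp
next
  case False
  let ?k = "b * co a / co (a * b)" and ?l = "co b / co (a * b)"
  have p: "0 < co (a * b)" by (rule co_mult_pos[OF a b False])
  have kl: "?k\<^sup>2 + ?l\<^sup>2 = 1" by (rule mehler_rotation_coeffs[OF a b False])
  have k0: "0 \<le> ?k" using a b p by (simp add: power_le_one)
  have eq: "b *\<^sub>R (a *\<^sub>R x + co a *\<^sub>R y) + co b *\<^sub>R z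
      = (a * b) *\<^sub>R x + co (a * b) *\<^sub>R (?k *\<^sub>R y + ?l *\<^sub>R z)" for y z
    using p by (simp add: algebra_simps)
  have "mehler a (mehler b h) x
    = (\<integral>y. (\<integral>z. h ((a * b) *\<^sub>R x + co (a * b) *\<^sub>R (?k *\<^sub>R fst (y, z) + ?l *\<^sub>R snd (y, z))) \<partial>gauss) \<partial>gauss)"
    by (simp only: mehler_def eq fst_conv snd_conv)
  also have "\<dots> = (\<integral>p. h ((a * b) *\<^sub>R x + co (a * b) *\<^sub>R (?k *\<^sub>R fst p + ?l *\<^sub>R snd p)) \<partial>(gauss \<Otimes>\<^sub>M gauss))"
    by (rule gauss2.integral_fst'[OF integrable_rotate_fst[OF kl k0 i]])
  also have "\<dots> = mehler (a * b) h x"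
    unfolding mehler_def
    by (rule integral_rotate_fst[OF kl k0]) (use borel_measurable_integrable[OF i] in simp)
  finally show ?thesis .
qed

lemma mehler_mehler:
  assumes a: "0 \<le> a" "a \<le> 1" and b: "0 \<le> b" "b \<le> 1" and h: "integrable gauss h"
  shows "AE x in gauss. mehler a (mehler b h) x = mehler (a * b) h x"
proof -
  have "0 \<le> a * b" "a * b \<le> 1" using a b by (auto simp: mult_le_one)
  from AE_integrable_mehler[OF this h] show ?thesis
    by eventually_elim (rule mehler_mehler_at[OF a b])
qed

text \<open>The vanishing condition guards against division by zero: where \<open>f\<close> is 0 and
  \<open>g\<close> is not, the quotient should be infinite but evaluates to 0. The target of
  \<open>g\<close> is arbitrary so that full gradients and directional derivatives are covered
  together.\<close>

definition wpair :: "(real^'n \<Rightarrow> real) \<Rightarrow> (real^'n \<Rightarrow> 'b::{banach,second_countable_topology}) \<Rightarrow> bool" where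
  "wpair f g \<longleftrightarrow> (\<forall>x. 0 \<le> f x) \<and> integrable gauss f \<and> g \<in> borel_measurable borel
    \<and> (AE x in gauss. f x = 0 \<longrightarrow> g x = 0) \<and> integrable gauss (\<lambda>x. (norm (g x))\<^sup>2 / f x)"

text \<open>For \<open>g\<close> the gradient of \<open>f\<close>, formally the gradient of P_t f is
  a P_t g with a = exp (- t), so \<open>info f g a\<close> is the Fisher information of P_t f
  without its factor a^2. Dropping the factor is what makes \<integral> \<open>info\<close> dr / 2,
  with r = a^2, the entropy.\<close>

definition info :: "(real^'n \<Rightarrow> real) \<Rightarrow> (real^'n \<Rightarrow> 'b::{banach,second_countable_topology}) \<Rightarrow> real \<Rightarrow> real" where
  "info f g a = (\<integral>x. (norm (mehler a g x))\<^sup>2 / mehler a f x \<partial>gauss)"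

lemma wpairD:
  assumes "wpair f g"
  shows "0 \<le> f x" "integrable gauss f" "f \<in> borel_measurable borel" "g \<in> borel_measurable borel"
    "AE x in gauss. f x = 0 \<longrightarrow> g x = 0" "integrable gauss (\<lambda>x. (norm (g x))\<^sup>2 / f x)" "integrable gauss g"
proof -
  show w: "0 \<le> f x" "integrable gauss f" "g \<in> borel_measurable borel"
    "AE x in gauss. f x = 0 \<longrightarrow> g x = 0" "integrable gauss (\<lambda>x. (norm (g x))\<^sup>2 / f x)" for x
    using assms unfolding wpair_def by blast+
  show "f \<in> borel_measurable borel"
    using borel_measurable_integrable[OF w(2)] by simp
  show "integrable gauss g"
    by (rule cauchy_schwarz_quotient(1)[of gauss f g]) (use w in auto)
qed

lemma info_one: "info f g 1 = (\<integral>x. (norm (g x))\<^sup>2 / f x \<partial>gauss)"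
  by (simp add: info_def)

text \<open>\<open>cauchy_schwarz_quotient\<close> for the Mehler kernel at a fixed point. If the
  average of \<open>f\<close> is 0 there, \<open>f\<close> vanishes almost everywhere along the
  kernel, and so does \<open>g\<close>.\<close>

lemma wpair_mehler_aux:
  assumes w: "wpair f g" and a: "0 \<le> a" "a \<le> 1"
  shows "AE x in gauss. (mehler a f x = 0 \<longrightarrow> mehler a g x = 0)
     \<and> (norm (mehler a g x))\<^sup>2 / mehler a f x \<le> mehler a (\<lambda>x. (norm (g x))\<^sup>2 / f x) x"
  using AE_integrable_mehler[OF a wpairD(2)[OF w]] AE_integrable_mehler[OF a wpairD(6)[OF w]]
    AE_mehler[OF a wpairD(5)[OF w]]
proof eventually_elim
  case (elim x)
  note [measurable] = wpairD(4)[OF w]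
  have "(norm (mehler a g x))\<^sup>2 / mehler a f x \<le> mehler a (\<lambda>x. (norm (g x))\<^sup>2 / f x) x"
    unfolding mehler_def using elim wpairD(1)[OF w]
    by (intro cauchy_schwarz_quotient(2)) auto
  moreover have "mehler a g x = 0" if "mehler a f x = 0"
  proof -
    have "AE y in gauss. f (a *\<^sub>R x + co a *\<^sub>R y) = 0"
      using that elim(1) wpairD(1)[OF w] unfolding mehler_def
      by (subst (asm) integral_nonneg_eq_0_iff_AE) auto
    with elim(3) have "AE y in gauss. g (a *\<^sub>R x + co a *\<^sub>R y) = 0"
      by eventually_elim auto
    then show ?thesis unfolding mehler_def by (rule integral_eq_zero_AE)
  qed
  ultimately show ?case by blast
qed

lemma wpair_mehler:
  assumes w: "wpair f g" and a: "0 \<le> a" "a \<le> 1"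
  shows "wpair (mehler a f) (mehler a g)" and "info f g a \<le> info f g 1" and "0 \<le> info f g a"
proof -
  note [measurable] = wpairD(3,4)[OF w]
  note nn = mehler_nonneg[of f, OF wpairD(1)[OF w]]
  have i: "integrable gauss (\<lambda>x. (norm (mehler a g x))\<^sup>2 / mehler a f x)"
  proof (rule Bochner_Integration.integrable_bound[OF integrable_mehler[OF a wpairD(6)[OF w]]])
    show "AE x in gauss. norm ((norm (mehler a g x))\<^sup>2 / mehler a f x)
        \<le> norm (mehler a (\<lambda>x. (norm (g x))\<^sup>2 / f x) x)"
      using wpair_mehler_aux[OF assms] by eventually_elim (use nn in auto)
  qed measurable
  show "wpair (mehler a f) (mehler a g)"
    unfolding wpair_def using nn integrable_mehler[OF a wpairD(2)[OF w]] wpair_mehler_aux[OF assms] i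
    by auto
  have "info f g a \<le> (\<integral>x. mehler a (\<lambda>x. (norm (g x))\<^sup>2 / f x) x \<partial>gauss)"
    unfolding info_def using wpair_mehler_aux[OF assms]
    by (intro integral_mono_AE[OF i integrable_mehler[OF a wpairD(6)[OF w]]]) auto
  then show "info f g a \<le> info f g 1"
    using integral_mehler[OF a wpairD(6)[OF w]] by (simp add: info_one)
  show "0 \<le> info f g a" unfolding info_def by (rule Bochner_Integration.integral_nonneg) (use nn in simp)
qed

lemma info_mehler:
  assumes w: "wpair f g" and a: "0 \<le> a" "a \<le> 1" and b: "0 \<le> b" "b \<le> 1"
  shows "info (mehler a f) (mehler a g) b = info f g (b * a)"
proof -
  note [measurable] = wpairD(3,4)[OF w]
  have "AE x in gauss. (norm (mehler b (mehler a g) x))\<^sup>2 / mehler b (mehler a f) x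
     = (norm (mehler (b * a) g x))\<^sup>2 / mehler (b * a) f x"
    using mehler_mehler[OF b a wpairD(7)[OF w]] mehler_mehler[OF b a wpairD(2)[OF w]]
    by eventually_elim simp
  then show ?thesis unfolding info_def by (intro integral_cong_AE) measurable
qed

text \<open>Since a = (a / b) * b, the semigroup law reduces the comparison to the contraction from
  time zero for the pair already evolved by \<open>b\<close>.\<close>

lemma info_mono:
  assumes w: "wpair f g" and ab: "0 \<le> a" "a \<le> b" "b \<le> 1"
  shows "info f g a \<le> info f g b"
proof (cases "b = 0")
  case False
  then have "info (mehler b f) (mehler b g) (a / b) \<le> info (mehler b f) (mehler b g) 1"
    using ab by (intro wpair_mehler(2) wpair_mehler(1)[OF w]) auto
  then show ?thesis
    using ab False by (simp add: info_mehler[OF w])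
qed (use ab in simp)

text \<open>The quotient is the supremum over T of the left-hand side, attained at T = u / v. Every
  T gives a lower bound linear in (u, v), so it can be integrated term by term.\<close>

lemma mult_le_quotient_add:
  fixes u v T :: real
  assumes "0 \<le> v" "v = 0 \<longrightarrow> u = 0"
  shows "2 * u * T - v * T\<^sup>2 \<le> u\<^sup>2 / v"
proof (cases "v = 0")
  case False
  have "0 \<le> (u - v * T)\<^sup>2 / v" using assms by simp
  also have "\<dots> = u\<^sup>2 / v - (2 * u * T - v * T\<^sup>2)"
    using False by (simp add: field_simps power2_eq_square)
  finally show ?thesis by simp
qed (use assms in simp)

lemma abs_mult_le_quotient_add:
  fixes u v T :: real
  assumes "0 \<le> v" "v = 0 \<longrightarrow> u = 0"
  shows "\<bar>u * T\<bar> \<le> u\<^sup>2 / v + v * T\<^sup>2"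
proof -
  have "2 * \<bar>u\<bar> * \<bar>T\<bar> - v * \<bar>T\<bar>\<^sup>2 \<le> \<bar>u\<bar>\<^sup>2 / v"
    by (rule mult_le_quotient_add) (use assms in auto)
  moreover have "0 \<le> \<bar>u\<bar> * \<bar>T\<bar>" by simp
  ultimately show ?thesis unfolding abs_mult power2_abs by linarith
qed

lemma integrable_mult_by_quotient:
  fixes u v T :: "'a \<Rightarrow> real"
  assumes "integrable M (\<lambda>x. (u x)\<^sup>2 / v x)" "integrable M (\<lambda>x. v x * (T x)\<^sup>2)"
    and "AE x in M. 0 \<le> v x \<and> (v x = 0 \<longrightarrow> u x = 0)"
    and [measurable]: "u \<in> borel_measurable M" "T \<in> borel_measurable M"
  shows "integrable M (\<lambda>x. u x * T x)"
proof (rule Bochner_Integration.integrable_bound)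
  show "integrable M (\<lambda>x. (u x)\<^sup>2 / v x + v x * (T x)\<^sup>2)" using assms by simp
  show "AE x in M. norm (u x * T x) \<le> norm ((u x)\<^sup>2 / v x + v x * (T x)\<^sup>2)"
    using assms(3) by eventually_elim (use abs_mult_le_quotient_add in \<open>fastforce simp: abs_mult\<close>)
qed measurable

lemma integrable_mult_between:
  fixes v T :: "'a \<Rightarrow> real"
  assumes "integrable M v" "integrable M (\<lambda>x. v x * (T x)\<^sup>2)" and [measurable]: "T \<in> borel_measurable M"
  shows "integrable M (\<lambda>x. v x * T x)"
proof (rule Bochner_Integration.integrable_bound)
  show "integrable M (\<lambda>x. \<bar>v x\<bar> + \<bar>v x * (T x)\<^sup>2\<bar>)" using assms by (simp add: integrable_abs)
  have "\<bar>t\<bar> \<le> 1 + t\<^sup>2" for t :: real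
    using sum_squares_bound[of "\<bar>t\<bar>" 1] by simp
  then have "\<bar>u\<bar> * \<bar>t\<bar> \<le> \<bar>u\<bar> * (1 + t\<^sup>2)" for u t :: real
    by (intro mult_left_mono) auto
  then show "AE x in M. norm (v x * T x) \<le> norm (\<bar>v x\<bar> + \<bar>v x * (T x)\<^sup>2\<bar>)"
    by (simp add: abs_mult distrib_left)
qed (use assms(1) in measurable)

section \<open>Moments of a function under Gaussian mixing\<close>

context
  fixes h :: "real^'n \<Rightarrow> real" and \<alpha> :: "real^'n"
  assumes h: "integrable gauss h" and \<alpha>: "norm \<alpha> = 1"
begin

text \<open>This is the situation after a reflection: \<open>h\<close> sits on one variable alone,
  and the other is an independent Gaussian of mean zero, so its contribution drops out.\<close>

lemma linear_weight:
  assumes h1: "integrable gauss (\<lambda>x. h x * (\<alpha> \<bullet> x))"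
  shows "integrable (gauss \<Otimes>\<^sub>M gauss) (\<lambda>q. h (fst q) * (\<alpha> \<bullet> (u *\<^sub>R fst q + v *\<^sub>R snd q)))"
    and "(\<integral>q. h (fst q) * (\<alpha> \<bullet> (u *\<^sub>R fst q + v *\<^sub>R snd q)) \<partial>(gauss \<Otimes>\<^sub>M gauss)) = u * (\<integral>x. h x * (\<alpha> \<bullet> x) \<partial>gauss)"
proof -
  have eq: "h (fst q) * (\<alpha> \<bullet> (u *\<^sub>R fst q + v *\<^sub>R snd q))
      = u * ((\<lambda>x. h x * (\<alpha> \<bullet> x)) (fst q) * (\<lambda>_. 1) (snd q)) + v * (h (fst q) * (\<alpha> \<bullet> snd q))" for q
    by (simp add: inner_add_right algebra_simps)
  note 1 = integrable_gauss2_prod[OF h1, of "\<lambda>_::real^'n. 1", simplified]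
  note 2 = integrable_gauss2_prod[OF h integrable_gauss_inner[of \<alpha>]]
  show "integrable (gauss \<Otimes>\<^sub>M gauss) (\<lambda>q. h (fst q) * (\<alpha> \<bullet> (u *\<^sub>R fst q + v *\<^sub>R snd q)))"
    unfolding eq using 1 2 by (auto intro!: Bochner_Integration.integrable_add)
  show "(\<integral>q. h (fst q) * (\<alpha> \<bullet> (u *\<^sub>R fst q + v *\<^sub>R snd q)) \<partial>(gauss \<Otimes>\<^sub>M gauss)) = u * (\<integral>x. h x * (\<alpha> \<bullet> x) \<partial>gauss)"
    unfolding eq using 1 2 by simp
qed

lemma square_weight:
  assumes h2: "integrable gauss (\<lambda>x. h x * (\<alpha> \<bullet> x)\<^sup>2)"
  shows "integrable (gauss \<Otimes>\<^sub>M gauss) (\<lambda>q. h (fst q) * (\<alpha> \<bullet> (u *\<^sub>R fst q + v *\<^sub>R snd q))\<^sup>2)"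
    and "(\<integral>q. h (fst q) * (\<alpha> \<bullet> (u *\<^sub>R fst q + v *\<^sub>R snd q))\<^sup>2 \<partial>(gauss \<Otimes>\<^sub>M gauss))
       = u\<^sup>2 * (\<integral>x. h x * (\<alpha> \<bullet> x)\<^sup>2 \<partial>gauss) + v\<^sup>2 * (\<integral>x. h x \<partial>gauss)"
proof -
  have h1: "integrable gauss (\<lambda>x. h x * (\<alpha> \<bullet> x))"
    by (rule integrable_mult_between[OF h h2]) simp
  have eq: "h (fst q) * (\<alpha> \<bullet> (u *\<^sub>R fst q + v *\<^sub>R snd q))\<^sup>2
      = u\<^sup>2 * ((\<lambda>x. h x * (\<alpha> \<bullet> x)\<^sup>2) (fst q) * (\<lambda>_. 1) (snd q))
        + v\<^sup>2 * (h (fst q) * (\<lambda>x. (\<alpha> \<bullet> x)\<^sup>2) (snd q))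
        + 2 * u * v * ((\<lambda>x. h x * (\<alpha> \<bullet> x)) (fst q) * (\<alpha> \<bullet> snd q))" for q
    by (simp add: inner_add_right power2_eq_square algebra_simps)
  note 1 = integrable_gauss2_prod[OF h2, of "\<lambda>_::real^'n. 1", simplified]
  note 2 = integrable_gauss2_prod[OF h integrable_gauss_inner_sq[of \<alpha>]]
  note 3 = integrable_gauss2_prod[OF h1 integrable_gauss_inner[of \<alpha>]]
  show "integrable (gauss \<Otimes>\<^sub>M gauss) (\<lambda>q. h (fst q) * (\<alpha> \<bullet> (u *\<^sub>R fst q + v *\<^sub>R snd q))\<^sup>2)"
    unfolding eq using 1 2 3 by (auto intro!: Bochner_Integration.integrable_add)
  show "(\<integral>q. h (fst q) * (\<alpha> \<bullet> (u *\<^sub>R fst q + v *\<^sub>R snd q))\<^sup>2 \<partial>(gauss \<Otimes>\<^sub>M gauss))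
       = u\<^sup>2 * (\<integral>x. h x * (\<alpha> \<bullet> x)\<^sup>2 \<partial>gauss) + v\<^sup>2 * (\<integral>x. h x \<partial>gauss)"
    unfolding eq using 1 2 3 \<alpha> by simp
qed

context
  fixes a :: real
  assumes a: "0 \<le> a" "a \<le> 1"
begin

text \<open>By involutivity both original coordinates are linear in the reflected pair, whose first
  entry is the mixed point. Moments of \<open>h\<close> at the mixed point against
  \<open>fst p\<close> or \<open>snd p\<close> thus become \<open>linear_weight\<close> and
  \<open>square_weight\<close>.\<close>

lemma mix_eq_reflect2:
  "fst (reflect2 a (co a) p) = a *\<^sub>R fst p + co a *\<^sub>R snd p"
  "a *\<^sub>R fst (reflect2 a (co a) p) + co a *\<^sub>R snd (reflect2 a (co a) p) = fst (p :: (real^'n) \<times> (real^'n))"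
  "co a *\<^sub>R fst (reflect2 a (co a) p) + (- a) *\<^sub>R snd (reflect2 a (co a) p) = snd (p :: (real^'n) \<times> (real^'n))"
  using reflect2_reflect2[OF co_sq[OF a], of p]
  by (auto simp: reflect2_def prod_eq_iff)

lemma mix_linear_fst:
  assumes h1: "integrable gauss (\<lambda>x. h x * (\<alpha> \<bullet> x))"
  shows "integrable (gauss \<Otimes>\<^sub>M gauss) (\<lambda>p. h (a *\<^sub>R fst p + co a *\<^sub>R snd p) * (\<alpha> \<bullet> fst p))"
    and "(\<integral>p. h (a *\<^sub>R fst p + co a *\<^sub>R snd p) * (\<alpha> \<bullet> fst p) \<partial>(gauss \<Otimes>\<^sub>M gauss)) = a * (\<integral>x. h x * (\<alpha> \<bullet> x) \<partial>gauss)"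
  using integrable_reflect2[OF co_sq[OF a] a(1) linear_weight(1)[OF h1, of a "co a"]]
    integral_reflect2[OF co_sq[OF a] a(1), of "\<lambda>q. h (fst q) * (\<alpha> \<bullet> (a *\<^sub>R fst q + co a *\<^sub>R snd q))"]
    linear_weight(2)[OF h1, of a "co a"] borel_measurable_integrable[OF h]
  unfolding mix_eq_reflect2(2,3) unfolding mix_eq_reflect2(1) by simp_all

lemma mix_linear_snd:
  assumes h1: "integrable gauss (\<lambda>x. h x * (\<alpha> \<bullet> x))"
  shows "integrable (gauss \<Otimes>\<^sub>M gauss) (\<lambda>p. h (a *\<^sub>R fst p + co a *\<^sub>R snd p) * (\<alpha> \<bullet> snd p))"
    and "(\<integral>p. h (a *\<^sub>R fst p + co a *\<^sub>R snd p) * (\<alpha> \<bullet> snd p) \<partial>(gauss \<Otimes>\<^sub>M gauss)) = co a * (\<integral>x. h x * (\<alpha> \<bullet> x) \<partial>gauss)"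
  using integrable_reflect2[OF co_sq[OF a] a(1) linear_weight(1)[OF h1, of "co a" "- a"]]
    integral_reflect2[OF co_sq[OF a] a(1), of "\<lambda>q. h (fst q) * (\<alpha> \<bullet> (co a *\<^sub>R fst q + (- a) *\<^sub>R snd q))"]
    linear_weight(2)[OF h1, of "co a" "- a"] borel_measurable_integrable[OF h]
  unfolding mix_eq_reflect2(2,3) unfolding mix_eq_reflect2(1) by simp_all

lemma mix_square_fst:
  assumes h2: "integrable gauss (\<lambda>x. h x * (\<alpha> \<bullet> x)\<^sup>2)"
  shows "integrable (gauss \<Otimes>\<^sub>M gauss) (\<lambda>p. h (a *\<^sub>R fst p + co a *\<^sub>R snd p) * (\<alpha> \<bullet> fst p)\<^sup>2)"
    and "(\<integral>p. h (a *\<^sub>R fst p + co a *\<^sub>R snd p) * (\<alpha> \<bullet> fst p)\<^sup>2 \<partial>(gauss \<Otimes>\<^sub>M gauss))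
      = a\<^sup>2 * (\<integral>x. h x * (\<alpha> \<bullet> x)\<^sup>2 \<partial>gauss) + (1 - a\<^sup>2) * (\<integral>x. h x \<partial>gauss)"
  using integrable_reflect2[OF co_sq[OF a] a(1) square_weight(1)[OF h2, of a "co a"]]
    integral_reflect2[OF co_sq[OF a] a(1), of "\<lambda>q. h (fst q) * (\<alpha> \<bullet> (a *\<^sub>R fst q + co a *\<^sub>R snd q))\<^sup>2"]
    square_weight(2)[OF h2, of a "co a"] borel_measurable_integrable[OF h]
  unfolding mix_eq_reflect2(2,3) unfolding mix_eq_reflect2(1) sq_co[OF a] by simp_all

lemma mix_square_snd:
  assumes h2: "integrable gauss (\<lambda>x. h x * (\<alpha> \<bullet> x)\<^sup>2)"
  shows "integrable (gauss \<Otimes>\<^sub>M gauss) (\<lambda>p. h (a *\<^sub>R fst p + co a *\<^sub>R snd p) * (\<alpha> \<bullet> snd p)\<^sup>2)"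
    and "(\<integral>p. h (a *\<^sub>R fst p + co a *\<^sub>R snd p) * (\<alpha> \<bullet> snd p)\<^sup>2 \<partial>(gauss \<Otimes>\<^sub>M gauss))
      = (1 - a\<^sup>2) * (\<integral>x. h x * (\<alpha> \<bullet> x)\<^sup>2 \<partial>gauss) + a\<^sup>2 * (\<integral>x. h x \<partial>gauss)"
  using integrable_reflect2[OF co_sq[OF a] a(1) square_weight(1)[OF h2, of "co a" "- a"]]
    integral_reflect2[OF co_sq[OF a] a(1), of "\<lambda>q. h (fst q) * (\<alpha> \<bullet> (co a *\<^sub>R fst q + (- a) *\<^sub>R snd q))\<^sup>2"]
    square_weight(2)[OF h2, of "co a" "- a"] borel_measurable_integrable[OF h]
  unfolding mix_eq_reflect2(2,3) unfolding mix_eq_reflect2(1) sq_co[OF a] by simp_all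

lemma mehler_linear:
  assumes h1: "integrable gauss (\<lambda>x. h x * (\<alpha> \<bullet> x))"
  shows "integrable gauss (\<lambda>x. mehler a h x * (\<alpha> \<bullet> x))"
    and "(\<integral>x. mehler a h x * (\<alpha> \<bullet> x) \<partial>gauss) = a * (\<integral>x. h x * (\<alpha> \<bullet> x) \<partial>gauss)"
  using gauss2.integrable_fst'[OF mix_linear_fst(1)[OF h1]] gauss2.integral_fst'[OF mix_linear_fst(1)[OF h1]]
    mix_linear_fst(2)[OF h1]
  by (simp_all add: mehler_def)

text \<open>The excess of the second moment over the mass is the coefficient of the degree-two
  Hermite polynomial (\<alpha> \<bullet> x)^2 - 1, an eigenfunction of the semigroup with eigenvalue
  a^2.\<close>

lemma mehler_square:
  assumes h2: "integrable gauss (\<lambda>x. h x * (\<alpha> \<bullet> x)\<^sup>2)"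
  shows "integrable gauss (\<lambda>x. mehler a h x * (\<alpha> \<bullet> x)\<^sup>2)"
    and "(\<integral>x. mehler a h x * (\<alpha> \<bullet> x)\<^sup>2 \<partial>gauss)
      = a\<^sup>2 * (\<integral>x. h x * (\<alpha> \<bullet> x)\<^sup>2 \<partial>gauss) + (1 - a\<^sup>2) * (\<integral>x. h x \<partial>gauss)"
  using gauss2.integrable_fst'[OF mix_square_fst(1)[OF h2]] gauss2.integral_fst'[OF mix_square_fst(1)[OF h2]]
    mix_square_fst(2)[OF h2]
  by (simp_all add: mehler_def)

end

end

text \<open>The gradient is a separate parameter so that the truncated and the shifted densities,
  whose gradients are given by formulas, instantiate the same locale.\<close>

locale c1_density =
  fixes f :: "real^'n \<Rightarrow> real" and g :: "real^'n \<Rightarrow> real^'n"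
  assumes deriv: "\<And>x. (f has_derivative (\<lambda>h. g x \<bullet> h)) (at x)"
    and g_cont: "continuous_on UNIV g"
    and f_nonneg: "\<And>x. 0 \<le> f x"
    and f_int: "integrable gauss f"
    and fisher: "integrable gauss (\<lambda>x. (norm (g x))\<^sup>2 / f x)"
begin

lemma f_cont: "continuous_on UNIV f"
  using deriv by (intro continuous_at_imp_continuous_on) (auto intro: has_derivative_continuous)

lemma f_meas [measurable]: "f \<in> borel_measurable borel"
  by (rule borel_measurable_continuous_onI[OF f_cont])

lemma g_meas [measurable]: "g \<in> borel_measurable borel"
  by (rule borel_measurable_continuous_onI[OF g_cont])

text \<open>A zero of a nonnegative function is a minimum.\<close>

lemma g_zero: "f x = 0 \<Longrightarrow> g x = 0"
proof -
  assume "f x = 0"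
  then have "(\<lambda>h. g x \<bullet> h) = (\<lambda>h. 0)"
    by (intro differential_zero_maxmin[of x UNIV f]) (use deriv f_nonneg in auto)
  then have "g x \<bullet> g x = 0" by metis
  then show "g x = 0" by simp
qed

lemma wpair_g: "wpair f g"
  unfolding wpair_def using f_nonneg f_int g_zero fisher by auto

text \<open>Serves for the directional derivative along \<alpha> and for the remainder of the
  gradient orthogonal to \<alpha>.\<close>

lemma wpair_bounded_linear:
  fixes L :: "real^'n \<Rightarrow> 'b::{banach,second_countable_topology}"
  assumes L: "bounded_linear L"
  shows "wpair f (\<lambda>x. L (g x))"
proof -
  interpret L: bounded_linear L by fact
  have [measurable]: "L \<in> borel_measurable borel"
    by (intro borel_measurable_continuous_onI linear_continuous_on L)
  obtain K where K: "norm (L x) \<le> norm x * K" for x using L.bounded by blast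
  have "integrable gauss (\<lambda>x. (norm (L (g x)))\<^sup>2 / f x)"
  proof (rule Bochner_Integration.integrable_bound)
    show "integrable gauss (\<lambda>x. K\<^sup>2 * ((norm (g x))\<^sup>2 / f x))" by (intro integrable_mult_right fisher)
    have "(norm (L (g x)))\<^sup>2 / f x \<le> K\<^sup>2 * ((norm (g x))\<^sup>2 / f x)" for x
      using divide_right_mono[OF power_mono[OF K[of "g x"] norm_ge_zero, of 2] f_nonneg[of x]]
      by (simp add: power_mult_distrib mult.commute)
    then show "AE x in gauss. norm ((norm (L (g x)))\<^sup>2 / f x) \<le> norm (K\<^sup>2 * ((norm (g x))\<^sup>2 / f x))"
      using f_nonneg by simp
  qed measurable
  then show ?thesis
    unfolding wpair_def using f_nonneg f_int g_zero L.zero by auto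
qed

lemma wpair_dir: "wpair f (\<lambda>x. g x \<bullet> \<alpha>)"
  by (rule wpair_bounded_linear[OF bounded_linear_inner_left])

lemma g_int: "integrable gauss g"
  by (rule wpairD(7)[OF wpair_g])

lemma line_deriv: "((\<lambda>t. f (x + t *\<^sub>R \<alpha>)) has_real_derivative g x \<bullet> \<alpha>) (at 0)"
proof -
  have "((\<lambda>t. x + t *\<^sub>R \<alpha>) has_derivative (\<lambda>t. t *\<^sub>R \<alpha>)) (at (0::real))"
    by (auto intro!: derivative_eq_intros)
  moreover have "(f has_derivative (\<lambda>h. g x \<bullet> h)) (at (x + 0 *\<^sub>R \<alpha>))"
    using deriv[of x] by simp
  ultimately have "(f \<circ> (\<lambda>t. x + t *\<^sub>R \<alpha>) has_derivative (\<lambda>h. g x \<bullet> h) \<circ> (\<lambda>t. t *\<^sub>R \<alpha>)) (at 0)"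
    by (rule diff_chain_at)
  then show ?thesis
    by (simp add: has_field_derivative_def comp_def mult_commute_abs)
qed

end

section \<open>The finite-difference Riccati inequality\<close>

locale c1_prob = c1_density f g for f :: "real^'n \<Rightarrow> real" and g +
  assumes mass: "(\<integral>x. f x \<partial>gauss) = 1"
    and moment: "integrable gauss (\<lambda>x. (norm x)\<^sup>2 * f x)"

locale c1_prob_dir = c1_prob f g for f :: "real^'n \<Rightarrow> real" and g +
  fixes \<alpha> :: "real^'n"
  assumes unit: "norm \<alpha> = 1"
begin

definition ga :: "real^'n \<Rightarrow> real" where "ga x = g x \<bullet> \<alpha>"

text \<open>The moment is taken about the origin; for a centered density this is (\<Gamma> - Id)
  \<alpha> \<bullet> \<alpha>.\<close>

definition cc :: real where "cc = (\<integral>x. f x * (\<alpha> \<bullet> x)\<^sup>2 \<partial>gauss) - 1"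

lemma ga_meas [measurable]: "ga \<in> borel_measurable borel"
  unfolding ga_def by measurable

lemma wpair_ga: "wpair f ga"
  unfolding ga_def by (rule wpair_dir)

lemma ga_int: "integrable gauss ga"
  by (rule wpairD(7)[OF wpair_ga])

lemma f_sq_int: "integrable gauss (\<lambda>x. f x * (\<alpha> \<bullet> x)\<^sup>2)"
proof (rule Bochner_Integration.integrable_bound[OF moment])
  have "(\<alpha> \<bullet> x)\<^sup>2 \<le> (norm x)\<^sup>2" for x
    using Cauchy_Schwarz_ineq2[of \<alpha> x] unit by (simp add: abs_le_square_iff[symmetric])
  then have "f x * (\<alpha> \<bullet> x)\<^sup>2 \<le> f x * (norm x)\<^sup>2" for x
    by (intro mult_left_mono f_nonneg)
  then show "AE x in gauss. norm (f x * (\<alpha> \<bullet> x)\<^sup>2) \<le> norm ((norm x)\<^sup>2 * f x)"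
    using f_nonneg by (simp add: mult.commute)
qed measurable

lemma f_lin_int: "integrable gauss (\<lambda>x. f x * (\<alpha> \<bullet> x))"
  by (rule integrable_mult_between[OF f_int f_sq_int]) simp

lemma ga_lin_int: "integrable gauss (\<lambda>x. ga x * (\<alpha> \<bullet> x))"
proof (rule integrable_mult_by_quotient[where v = f])
  show "integrable gauss (\<lambda>x. (ga x)\<^sup>2 / f x)"
    using wpairD(6)[OF wpair_ga] by simp
  show "AE x in gauss. 0 \<le> f x \<and> (f x = 0 \<longrightarrow> ga x = 0)"
    using f_nonneg by (simp add: g_zero ga_def)
qed (use f_sq_int in simp_all)

text \<open>Integration by parts for f(x) (\<alpha> \<bullet> x), whose derivative along \<alpha>
  has the additional term f because \<alpha> is a unit vector.\<close>

lemma integral_ga_lin: "(\<integral>x. ga x * (\<alpha> \<bullet> x) \<partial>gauss) = cc"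
proof -
  have i: "integrable gauss (\<lambda>x. (ga x * (\<alpha> \<bullet> x) + f x) - f x * (\<alpha> \<bullet> x) * (\<alpha> \<bullet> x))"
    using ga_lin_int f_int f_sq_int by (simp add: power2_eq_square mult.assoc)
  have "(\<integral>x. (ga x * (\<alpha> \<bullet> x) + f x) - f x * (\<alpha> \<bullet> x) * (\<alpha> \<bullet> x) \<partial>gauss) = 0"
  proof (rule gauss_ibp[OF f_lin_int i])
    fix x
    have "((\<lambda>t. \<alpha> \<bullet> (x + t *\<^sub>R \<alpha>)) has_real_derivative 1) (at 0)"
      using unit by (auto intro!: derivative_eq_intros simp: inner_add_right simp flip: power2_norm_eq_inner)
    from DERIV_mult[OF line_deriv this]
    show "((\<lambda>t. f (x + t *\<^sub>R \<alpha>) * (\<alpha> \<bullet> (x + t *\<^sub>R \<alpha>))) has_real_derivative ga x * (\<alpha> \<bullet> x) + f x) (at 0)"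
      by (simp add: ga_def algebra_simps)
  qed
  then show ?thesis
    using ga_lin_int f_int f_sq_int mass by (simp add: power2_eq_square mult.assoc cc_def)
qed

text \<open>Gaussian integration by parts in the noise variable \<open>u\<close>; the chain rule
  contributes \<open>co b\<close>. The identity holds for those \<open>y\<close> at which all three
  integrands are integrable.\<close>

lemma stein:
  assumes b: "0 \<le> b" "b \<le> 1"
  shows "AE y in gauss. integrable gauss (\<lambda>u. f (b *\<^sub>R y + co b *\<^sub>R u))
    \<and> integrable gauss (\<lambda>u. f (b *\<^sub>R y + co b *\<^sub>R u) * (\<alpha> \<bullet> u))
    \<and> (\<integral>u. f (b *\<^sub>R y + co b *\<^sub>R u) * (\<alpha> \<bullet> u) \<partial>gauss) = co b * mehler b ga y"
  using AE_integrable_mehler[OF b f_int] AE_integrable_mehler[OF b ga_int]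
    gauss2.AE_integrable_fst'[OF mix_linear_snd(1)[OF f_int unit b f_lin_int]]
proof eventually_elim
  case (elim y)
  then have i: "integrable gauss (\<lambda>u. co b * ga (b *\<^sub>R y + co b *\<^sub>R u) - f (b *\<^sub>R y + co b *\<^sub>R u) * (\<alpha> \<bullet> u))"
    by simp
  have "(\<integral>u. co b * ga (b *\<^sub>R y + co b *\<^sub>R u) - f (b *\<^sub>R y + co b *\<^sub>R u) * (\<alpha> \<bullet> u) \<partial>gauss) = 0"
  proof (rule gauss_ibp[OF elim(1) i])
    fix u
    show "((\<lambda>t. f (b *\<^sub>R y + co b *\<^sub>R (u + t *\<^sub>R \<alpha>))) has_real_derivative co b * ga (b *\<^sub>R y + co b *\<^sub>R u)) (at 0)"
    proof -
      have 1: "((\<lambda>s. f ((b *\<^sub>R y + co b *\<^sub>R u) + s *\<^sub>R \<alpha>)) has_real_derivative ga (b *\<^sub>R y + co b *\<^sub>R u)) (at (co b * 0))"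
        using line_deriv[of "b *\<^sub>R y + co b *\<^sub>R u" \<alpha>] by (simp add: ga_def)
      have 2: "((\<lambda>t. co b * t) has_real_derivative co b) (at 0)"
        by (auto intro!: derivative_eq_intros)
      have "b *\<^sub>R y + co b *\<^sub>R (u + t *\<^sub>R \<alpha>) = (b *\<^sub>R y + co b *\<^sub>R u) + (co b * t) *\<^sub>R \<alpha>" for t
        by (simp add: scaleR_add_right)
      then show ?thesis using DERIV_chain2[OF 1 2] by (simp only: mult.commute[of "co b"])
    qed
  qed
  then show ?case using elim by (simp add: mehler_def)
qed

text \<open>Applying \<open>stein\<close> to \<open>mehler a f\<close> would require differentiating
  it. Instead both noises are merged into u = k z + l w, a standard Gaussian with z = k u + (a part
  independent of u). Hence testing against \<alpha> \<bullet> z equals k times testing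
  \<open>f\<close> against \<alpha> \<bullet> u at the combined level \<open>r * a\<close>, and k *
  \<open>co (r * a)\<close> = a * \<open>co r\<close>.\<close>

lemma stein_mehler:
  assumes a: "0 \<le> a" "a \<le> 1" and r: "0 \<le> r" "r \<le> 1"
  shows "AE y in gauss. (\<integral>z. mehler a f (r *\<^sub>R y + co r *\<^sub>R z) * (\<alpha> \<bullet> z) \<partial>gauss) = co r * a * mehler (r * a) ga y"
proof (cases "r * a = 1")
  case True
  moreover have "r * a \<le> r" using a r by (simp add: mult_left_le)
  ultimately have "r = 1" using r by simp
  then show ?thesis by simp
next
  case False
  have ra: "0 \<le> r * a" "r * a \<le> 1" using a r by (auto simp: mult_le_one)
  let ?b = "r * a" and ?k = "a * co r / co (r * a)" and ?l = "co a / co (r * a)"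
  have p: "0 < co ?b" by (rule co_mult_pos[OF r a False])
  have kl: "?k\<^sup>2 + ?l\<^sup>2 = 1" by (rule mehler_rotation_coeffs[OF r a False])
  have k0: "0 \<le> ?k" using a r p by (simp add: power_le_one)
  have eq: "a *\<^sub>R (r *\<^sub>R y + co r *\<^sub>R z) + co a *\<^sub>R w = ?b *\<^sub>R y + co ?b *\<^sub>R (?k *\<^sub>R z + ?l *\<^sub>R w)" for y z w :: "real^'n"
    using p by (simp add: algebra_simps)
  show ?thesis using stein[OF ra]
  proof eventually_elim
    case (elim y)
    let ?h = "\<lambda>u. f (?b *\<^sub>R y + co ?b *\<^sub>R u)"
    have h: "integrable gauss ?h" "integrable gauss (\<lambda>u. ?h u * (\<alpha> \<bullet> u))" using elim by auto
    let ?q = "\<lambda>p. ?h (fst (reflect2 ?k ?l p)) * (\<alpha> \<bullet> (?k *\<^sub>R fst (reflect2 ?k ?l p) + ?l *\<^sub>R snd (reflect2 ?k ?l p)))"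
    have q: "?q p = ?h (?k *\<^sub>R fst p + ?l *\<^sub>R snd p) * (\<alpha> \<bullet> fst p)" for p
      using reflect2_reflect2[OF kl, of p] by (simp add: reflect2_def[of _ _ p] prod_eq_iff) (simp add: reflect2_def)
    have i: "integrable (gauss \<Otimes>\<^sub>M gauss) ?q"
      by (rule integrable_reflect2[OF kl k0 linear_weight(1)[OF h(1) unit h(2)]])
    have "(\<integral>z. mehler a f (r *\<^sub>R y + co r *\<^sub>R z) * (\<alpha> \<bullet> z) \<partial>gauss)
      = (\<integral>z. (\<integral>w. ?h (?k *\<^sub>R fst (z, w) + ?l *\<^sub>R snd (z, w)) * (\<alpha> \<bullet> fst (z, w)) \<partial>gauss) \<partial>gauss)"
      unfolding mehler_def eq by simp
    also have "\<dots> = (\<integral>p. ?q p \<partial>(gauss \<Otimes>\<^sub>M gauss))"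
      using gauss2.integral_fst'[OF i] unfolding q .
    also have "\<dots> = (\<integral>q. ?h (fst q) * (\<alpha> \<bullet> (?k *\<^sub>R fst q + ?l *\<^sub>R snd q)) \<partial>(gauss \<Otimes>\<^sub>M gauss))"
      by (rule integral_reflect2[OF kl k0, of "\<lambda>q. ?h (fst q) * (\<alpha> \<bullet> (?k *\<^sub>R fst q + ?l *\<^sub>R snd q))"]) measurable
    also have "\<dots> = ?k * (co ?b * mehler ?b ga y)"
      using linear_weight(2)[OF h(1) unit h(2), of ?k ?l] elim by simp
    also have "\<dots> = co r * a * mehler ?b ga y" using p by simp
    finally show ?case .
  qed
qed

text \<open>The Cauchy--Schwarz defect of \<open>P\<^sub>r (G\<^sup>2 / F) \<ge> (P\<^sub>r G)\<^sup>2 / P\<^sub>r F\<close>, bounded below by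
  testing against \<open>B + \<mu> (\<alpha> \<bullet> z)\<close>, where \<open>B = P\<^sub>r G / P\<^sub>r F\<close> is the equality case.\<close>

lemma info_step:
  assumes a: "0 \<le> a" "a \<le> 1" and r: "0 \<le> r" "r \<le> 1"
  defines "m \<equiv> cc - info f ga (r * a)"
  shows "info f ga (r * a) + (1 - r\<^sup>2) * a\<^sup>2 * m\<^sup>2 * (1 - (1 - r\<^sup>2) * a\<^sup>2 * cc) \<le> info f ga a"
proof -
  let ?F = "mehler a f" and ?G = "mehler a ga" and ?F' = "mehler (r * a) f" and ?G' = "mehler (r * a) ga"
  let ?J' = "info f ga (r * a)"
  let ?\<gamma> = "gauss \<Otimes>\<^sub>M gauss :: ((real^'n) \<times> (real^'n)) measure"
  let ?X = "\<lambda>p::(real^'n) \<times> (real^'n). r *\<^sub>R fst p + co r *\<^sub>R snd p"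
  define B where "B x = ?G' x / ?F' x" for x
  have [measurable]: "B \<in> borel_measurable borel" unfolding B_def by measurable
  have ra: "0 \<le> r * a" "r * a \<le> 1" using a r by (auto simp: mult_le_one)
  note wF = wpair_mehler(1)[OF wpair_ga a] and wF' = wpair_mehler(1)[OF wpair_ga ra]
  have F_nn: "0 \<le> ?F x" for x using wpairD(1)[OF wF] .
  have F_sq: "integrable gauss (\<lambda>x. ?F x * (\<alpha> \<bullet> x)\<^sup>2)" "(\<integral>x. ?F x * (\<alpha> \<bullet> x)\<^sup>2 \<partial>gauss) = 1 + a\<^sup>2 * cc"
    using mehler_square[OF f_int unit a f_sq_int] mass by (simp_all add: cc_def algebra_simps)
  have G_lin: "integrable gauss (\<lambda>x. ?G x * (\<alpha> \<bullet> x))" "(\<integral>x. ?G x * (\<alpha> \<bullet> x) \<partial>gauss) = a * cc"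
    using mehler_linear[OF ga_int unit a ga_lin_int] integral_ga_lin by simp_all
  note F_int = wpairD(2)[OF wF] and G_int = wpairD(7)[OF wF]
  have F_mass: "(\<integral>x. ?F x \<partial>gauss) = 1" using integral_mehler[OF a f_int] mass by simp
  have zero: "AE p in ?\<gamma>. 0 \<le> ?F (?X p) \<and> (?F (?X p) = 0 \<longrightarrow> ?G (?X p) = 0)"
    using AE_rotate_fst[OF co_sq[OF r] r(1) wpairD(5)[OF wF]] F_nn by simp
  have t1: "integrable ?\<gamma> (\<lambda>p. (?G (?X p))\<^sup>2 / ?F (?X p))"
    "(\<integral>p. (?G (?X p))\<^sup>2 / ?F (?X p) \<partial>?\<gamma>) = info f ga a"
  proof -
    have i: "integrable gauss (\<lambda>x. (?G x)\<^sup>2 / ?F x)" using wpairD(6)[OF wF] by simp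
    show "integrable ?\<gamma> (\<lambda>p. (?G (?X p))\<^sup>2 / ?F (?X p))"
      using integrable_rotate_fst[OF co_sq[OF r] r(1) i] .
    show "(\<integral>p. (?G (?X p))\<^sup>2 / ?F (?X p) \<partial>?\<gamma>) = info f ga a"
      using integral_rotate_fst[OF co_sq[OF r] r(1), of "\<lambda>x. (?G x)\<^sup>2 / ?F x"] by (simp add: info_def)
  qed
  have J': "integrable gauss (\<lambda>x. (?G' x)\<^sup>2 / ?F' x)" "(\<integral>x. (?G' x)\<^sup>2 / ?F' x \<partial>gauss) = ?J'"
    using wpairD(6)[OF wF'] by (simp_all add: info_def)
  \<comment> \<open>No case distinction on the zeros of \<open>?F'\<close> arises: there
    \<open>B\<close> and the quotient on the right are both 0 by the convention for
    division.\<close>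
  have FB: "mehler r ?F x * (B x)\<^sup>2 = (?G' x)\<^sup>2 / ?F' x" if "mehler r ?F x = ?F' x" for x
    using that by (simp add: B_def power_divide power2_eq_square)
  have GB: "mehler r ?G x * B x = (?G' x)\<^sup>2 / ?F' x" if "mehler r ?G x = ?G' x" for x
    using that by (simp add: B_def power2_eq_square)
  note sF = mehler_mehler[OF r a f_int] and sG = mehler_mehler[OF r a ga_int]
  have t3: "integrable ?\<gamma> (\<lambda>p. ?F (?X p) * (B (fst p))\<^sup>2)"
  proof (rule gauss2.Fubini_integrable)
    have "integrable gauss (\<lambda>x. mehler r ?F x * (B x)\<^sup>2)"
      by (subst integrable_cong_AE[OF _ _ AE_mp[OF sF AE_I2]]) (use J' FB in auto)
    then show "integrable gauss (\<lambda>x. \<integral>y. norm (?F (?X (x, y)) * (B (fst (x, y)))\<^sup>2) \<partial>gauss)"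
      using F_nn by (simp add: abs_mult mehler_def)
    show "AE x in gauss. integrable gauss (\<lambda>y. ?F (?X (x, y)) * (B (fst (x, y)))\<^sup>2)"
      using AE_integrable_mehler[OF r F_int] by eventually_elim simp
  qed measurable
  have e3: "(\<integral>p. ?F (?X p) * (B (fst p))\<^sup>2 \<partial>?\<gamma>) = ?J'"
  proof -
    have "(\<integral>p. ?F (?X p) * (B (fst p))\<^sup>2 \<partial>?\<gamma>) = (\<integral>x. mehler r ?F x * (B x)\<^sup>2 \<partial>gauss)"
      using gauss2.integral_fst'[OF t3] by (simp add: mehler_def)
    also have "\<dots> = (\<integral>x. (?G' x)\<^sup>2 / ?F' x \<partial>gauss)"
      by (rule integral_cong_AE[OF _ _ AE_mp[OF sF AE_I2]]) (use FB in auto)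
    finally show ?thesis using J' by simp
  qed
  have t2: "integrable ?\<gamma> (\<lambda>p. ?G (?X p) * B (fst p))"
    by (rule integrable_mult_by_quotient[OF t1(1) t3 zero]) measurable
  have e2: "(\<integral>p. ?G (?X p) * B (fst p) \<partial>?\<gamma>) = ?J'"
  proof -
    have "(\<integral>p. ?G (?X p) * B (fst p) \<partial>?\<gamma>) = (\<integral>x. mehler r ?G x * B x \<partial>gauss)"
      using gauss2.integral_fst'[OF t2] by (simp add: mehler_def)
    also have "\<dots> = (\<integral>x. (?G' x)\<^sup>2 / ?F' x \<partial>gauss)"
      by (rule integral_cong_AE[OF _ _ AE_mp[OF sG AE_I2]]) (use GB in auto)
    finally show ?thesis using J' by simp
  qed
  have t4: "integrable ?\<gamma> (\<lambda>p. ?G (?X p) * (\<alpha> \<bullet> snd p))"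
    "(\<integral>p. ?G (?X p) * (\<alpha> \<bullet> snd p) \<partial>?\<gamma>) = co r * (a * cc)"
    using mix_linear_snd[OF G_int unit r G_lin(1)] G_lin(2) by auto
  have t6: "integrable ?\<gamma> (\<lambda>p. ?F (?X p) * (\<alpha> \<bullet> snd p)\<^sup>2)"
    "(\<integral>p. ?F (?X p) * (\<alpha> \<bullet> snd p)\<^sup>2 \<partial>?\<gamma>) = 1 + (1 - r\<^sup>2) * a\<^sup>2 * cc"
    using mix_square_snd[OF F_int unit r F_sq(1)] F_sq(2) F_mass by (auto simp: algebra_simps)
  have t5: "integrable ?\<gamma> (\<lambda>p. ?F (?X p) * B (fst p) * (\<alpha> \<bullet> snd p))"
  proof (rule Bochner_Integration.integrable_bound)
    show "integrable ?\<gamma> (\<lambda>p. ?F (?X p) * (B (fst p))\<^sup>2 + ?F (?X p) * (\<alpha> \<bullet> snd p)\<^sup>2)"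
      using t3 t6 by simp
    have "\<bar>u * v\<bar> \<le> u\<^sup>2 + v\<^sup>2" for u v :: real
      using sum_squares_bound[of "\<bar>u\<bar>" "\<bar>v\<bar>"] abs_ge_zero[of "u * v"] unfolding abs_mult power2_abs by linarith
    then have "w * \<bar>u * v\<bar> \<le> w * (u\<^sup>2 + v\<^sup>2)" if "0 \<le> w" for w u v :: real
      using that by (intro mult_left_mono)
    then show "AE p in ?\<gamma>. norm (?F (?X p) * B (fst p) * (\<alpha> \<bullet> snd p))
       \<le> norm (?F (?X p) * (B (fst p))\<^sup>2 + ?F (?X p) * (\<alpha> \<bullet> snd p)\<^sup>2)"
      using F_nn by (simp add: abs_mult distrib_left mult.assoc)
  qed measurable
  \<comment> \<open>\<open>stein_mehler\<close> converts the noise component into a multiple of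
    \<open>?G'\<close>, and \<open>B\<close> times \<open>?G'\<close> is again the integrand of the
    information at the later time.\<close>
  have e5: "(\<integral>p. ?F (?X p) * B (fst p) * (\<alpha> \<bullet> snd p) \<partial>?\<gamma>) = co r * a * ?J'"
  proof -
    have "(\<integral>p. ?F (?X p) * B (fst p) * (\<alpha> \<bullet> snd p) \<partial>?\<gamma>)
        = (\<integral>x. B x * (\<integral>z. ?F (r *\<^sub>R x + co r *\<^sub>R z) * (\<alpha> \<bullet> z) \<partial>gauss) \<partial>gauss)"
      using gauss2.integral_fst'[OF t5] by (simp add: mult.assoc mult.left_commute)
    also have "\<dots> = (\<integral>x. co r * a * ((?G' x)\<^sup>2 / ?F' x) \<partial>gauss)"
      by (rule integral_cong_AE[OF _ _ AE_mp[OF stein_mehler[OF a r] AE_I2]])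
        (auto simp: B_def power2_eq_square)
    also have "\<dots> = co r * a * ?J'" by (simp only: integral_mult_right_zero J')
    finally show ?thesis .
  qed
  \<comment> \<open>The lower bound is quadratic in \<mu>, and its exact maximizer would have 1 + (1
    - r^2) a^2 cc as denominator. Replacing the denominator by 1 keeps the leading order and leaves
    the factor 1 - (1 - r^2) a^2 cc, with no condition on signs.\<close>
  define \<mu> where "\<mu> = co r * a * m"
  have "2 * ?J' + 2 * \<mu> * (co r * (a * cc)) - ?J' - 2 * \<mu> * (co r * a * ?J') - \<mu>\<^sup>2 * (1 + (1 - r\<^sup>2) * a\<^sup>2 * cc)
    = (\<integral>p. 2 * (?G (?X p) * B (fst p)) + 2 * \<mu> * (?G (?X p) * (\<alpha> \<bullet> snd p)) - ?F (?X p) * (B (fst p))\<^sup>2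
        - 2 * \<mu> * (?F (?X p) * B (fst p) * (\<alpha> \<bullet> snd p)) - \<mu>\<^sup>2 * (?F (?X p) * (\<alpha> \<bullet> snd p)\<^sup>2) \<partial>?\<gamma>)"
    using t2 t3 t4 t5 t6 by (simp add: e2 e3 e5)
  also have "\<dots> \<le> (\<integral>p. (?G (?X p))\<^sup>2 / ?F (?X p) \<partial>?\<gamma>)"
  proof (rule integral_mono_AE)
    show "AE p in ?\<gamma>. 2 * (?G (?X p) * B (fst p)) + 2 * \<mu> * (?G (?X p) * (\<alpha> \<bullet> snd p)) - ?F (?X p) * (B (fst p))\<^sup>2
        - 2 * \<mu> * (?F (?X p) * B (fst p) * (\<alpha> \<bullet> snd p)) - \<mu>\<^sup>2 * (?F (?X p) * (\<alpha> \<bullet> snd p)\<^sup>2)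
       \<le> (?G (?X p))\<^sup>2 / ?F (?X p)"
      using zero
    proof eventually_elim
      case (elim p)
      then show ?case
        using mult_le_quotient_add[of "?F (?X p)" "?G (?X p)" "B (fst p) + \<mu> * (\<alpha> \<bullet> snd p)"]
        by (simp add: power2_eq_square algebra_simps)
    qed
  qed (use t1 t2 t3 t4 t5 t6 in \<open>auto intro!: Bochner_Integration.integrable_diff Bochner_Integration.integrable_add\<close>)
  also have "\<dots> = info f ga a" by (rule t1(2))
  finally have le: "2 * ?J' + 2 * \<mu> * (co r * (a * cc)) - ?J' - 2 * \<mu> * (co r * a * ?J') - \<mu>\<^sup>2 * (1 + (1 - r\<^sup>2) * a\<^sup>2 * cc) \<le> info f ga a" .
  have s2: "co r * co r = 1 - r\<^sup>2" using sq_co[OF r] by (simp add: power2_eq_square)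
  have "2 * (s * a * n) * (s * (a * (n + J))) - 2 * (s * a * n) * (s * a * J) = 2 * ((s * s) * a\<^sup>2 * n\<^sup>2)" for s n J
    by (simp add: power2_eq_square algebra_simps)
  from this[of "co r" m ?J'] have "2 * \<mu> * (co r * (a * cc)) - 2 * \<mu> * (co r * a * ?J') = 2 * ((co r * co r) * a\<^sup>2 * m\<^sup>2)"
    by (simp add: \<mu>_def m_def)
  moreover have "\<mu>\<^sup>2 = (co r * co r) * a\<^sup>2 * m\<^sup>2"
    by (simp only: \<mu>_def power2_eq_square mult_ac)
  moreover have "2 * J + u - J - v - w * (1 + q) = J + S * (1 - q)" if "u - v = 2 * S" "w = S" for J u v w q S :: real
    using that by (simp add: algebra_simps)
  ultimately have "2 * ?J' + 2 * \<mu> * (co r * (a * cc)) - ?J' - 2 * \<mu> * (co r * a * ?J') - \<mu>\<^sup>2 * (1 + (1 - r\<^sup>2) * a\<^sup>2 * cc)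
      = ?J' + (1 - r\<^sup>2) * a\<^sup>2 * m\<^sup>2 * (1 - (1 - r\<^sup>2) * a\<^sup>2 * cc)"
    unfolding s2 by blast
  with le show ?thesis by simp
qed

end

text \<open>On a uniform partition of mesh h the errors telescope to h (m b - m a), which tends to
  0. This form of error admits an \<open>m\<close> with jumps.\<close>

lemma increment_bound_imp_le:
  fixes \<Psi> m :: "real \<Rightarrow> real"
  assumes ab: "a \<le> b"
    and inc: "\<And>x y. a \<le> x \<Longrightarrow> x \<le> y \<Longrightarrow> y \<le> b \<Longrightarrow> \<Psi> x - (y - x) * (m y - m x) \<le> \<Psi> y"
  shows "\<Psi> a \<le> \<Psi> b"
proof -
  have step: "\<Psi> a \<le> \<Psi> b + (b - a) * (m b - m a) * inverse (real (Suc n))" for n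
  proof -
    define h where "h = (b - a) / real (Suc n)"
    have h0: "0 \<le> h" using ab by (simp add: h_def)
    have hn: "a + real (Suc n) * h = b" by (simp add: h_def del: of_nat_Suc)
    have "\<Psi> a \<le> \<Psi> (a + real k * h) + h * (m (a + real k * h) - m a)" if "k \<le> Suc n" for k
      using that
    proof (induction k)
      case (Suc k)
      have "a + real (Suc k) * h \<le> a + real (Suc n) * h"
        using Suc.prems h0 by (intro add_left_mono mult_right_mono) auto
      then have "\<Psi> (a + real k * h) - h * (m (a + real (Suc k) * h) - m (a + real k * h)) \<le> \<Psi> (a + real (Suc k) * h)"
        using inc[of "a + real k * h" "a + real (Suc k) * h"] h0 hn by (simp add: algebra_simps)
      with Suc show ?case by (simp add: algebra_simps)
    qed simp
    from this[of "Suc n"] show ?thesis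
      unfolding hn by (simp add: h_def divide_inverse mult_ac)
  qed
  have "(\<lambda>n. \<Psi> b + (b - a) * (m b - m a) * inverse (real (Suc n))) \<longlonglongrightarrow> \<Psi> b + (b - a) * (m b - m a) * 0"
    by (intro tendsto_intros LIMSEQ_inverse_real_of_nat)
  then show ?thesis
    using step by (intro LIMSEQ_le_const) auto
qed

lemma bounded_measurable_integrable_on:
  fixes h :: "real \<Rightarrow> real"
  assumes [measurable]: "h \<in> borel_measurable borel" and K: "\<And>x. x \<in> {a..b} \<Longrightarrow> \<bar>h x\<bar> \<le> K"
  shows "set_integrable lborel {a..b} h" "h integrable_on {a..b}"
proof -
  have "integrable lborel (\<lambda>x. indicator {a..b} x *\<^sub>R h x)"
  proof (rule Bochner_Integration.integrable_bound)
    show "integrable lborel (\<lambda>x. indicator {a..b} x * K :: real)"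
      by (cases "a \<le> b") (auto intro!: integrable_mult_left integrable_real_indicator)
    show "AE x in lborel. norm (indicator {a..b} x *\<^sub>R h x) \<le> norm (indicator {a..b} x * K :: real)"
      using K by (fastforce simp: indicator_def)
  qed measurable
  then show s: "set_integrable lborel {a..b} h" by (simp add: set_integrable_def)
  show "h integrable_on {a..b}" by (rule set_borel_integral_eq_integral(1)[OF s])
qed

text \<open>The hypothesis is a finite-difference form of the Riccati inequality \<open>J' \<ge> (J - c)\<^sup>2\<close>,
  the conclusion its integral against \<open>\<rho> d\<rho>\<close>.\<close>

lemma riccati_integral:
  fixes J :: "real \<Rightarrow> real"
  assumes J: "mono J"
    and step: "\<And>x y. 0 \<le> x \<Longrightarrow> x \<le> y \<Longrightarrow> y \<le> 1 \<Longrightarrow> J x + (y - x) * (c - J x)\<^sup>2 * (1 - (y - x) * c) \<le> J y"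
  shows "integral {0..1} (\<lambda>\<rho>. \<rho> * (J \<rho> - c)\<^sup>2) \<le> J 1 - integral {0..1} J"
proof -
  have [measurable]: "J \<in> borel_measurable borel" by (rule borel_measurable_mono[OF J])
  \<comment> \<open>Twice the sum, so that it bounds both \<bar>J - c\<bar> and the factor J t + J x
    - 2 c of a difference of squares.\<close>
  define K where "K = 2 * (\<bar>J 0\<bar> + \<bar>J 1\<bar> + \<bar>c\<bar>)"
  have K0: "0 \<le> K" by (simp add: K_def)
  have Jb: "J 0 \<le> J x" "J x \<le> J 1" if "0 \<le> x" "x \<le> 1" for x
    using that monoD[OF J] by auto
  have Jc: "\<bar>J x - c\<bar> \<le> K" if "0 \<le> x" "x \<le> 1" for x
    using Jb[OF that] unfolding K_def by (smt (verit))
  have Jc2: "(J x - c)\<^sup>2 \<le> K\<^sup>2" if "0 \<le> x" "x \<le> 1" for x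
    using Jc[OF that] K0 by (simp add: abs_le_square_iff[symmetric])
  define q where "q \<rho> = \<rho> * (J \<rho> - c)\<^sup>2" for \<rho>
  have [measurable]: "q \<in> borel_measurable borel" unfolding q_def by measurable
  have iJ: "J integrable_on {x..y}" if "0 \<le> x" "y \<le> 1" for x y
  proof (rule bounded_measurable_integrable_on(2))
    fix t assume "t \<in> {x..y}"
    then have "0 \<le> t" "t \<le> 1" using that by auto
    from Jb[OF this] show "\<bar>J t\<bar> \<le> \<bar>J 0\<bar> + \<bar>J 1\<bar>" by linarith
  qed measurable
  have iq: "q integrable_on {x..y}" if "0 \<le> x" "y \<le> 1" for x y
  proof (rule bounded_measurable_integrable_on(2))
    fix t assume "t \<in> {x..y}"
    then have t: "0 \<le> t" "t \<le> 1" using that by auto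
    have "t * (J t - c)\<^sup>2 \<le> 1 * K\<^sup>2" using t Jc2[OF t] by (intro mult_mono) auto
    then show "\<bar>q t\<bar> \<le> K\<^sup>2" using t by (simp add: q_def abs_mult)
  qed measurable
  \<comment> \<open>Formally the derivative is x (J' - (J - c)^2) \<ge> 0, and comparing the
    endpoints 0 and 1 is the claim.\<close>
  define \<Psi> where "\<Psi> x = x * J x - integral {0..x} J - integral {0..x} q" for x
  \<comment> \<open>The linear term pays for the error quadratic in y - x; the multiple of
    \<open>J\<close> pays for the variation of the merely monotone \<open>J\<close> on
    [x, y].\<close>
  define m where "m t = (1 + \<bar>c\<bar>) * K\<^sup>2 * t + K * J t" for t
  have "\<Psi> 0 \<le> \<Psi> 1"
  proof (rule increment_bound_imp_le[of 0 1 \<Psi> m])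
    fix x y :: real assume x: "0 \<le> x" and xy: "x \<le> y" and y: "y \<le> 1"
    have x1: "x \<le> 1" and y0: "0 \<le> y" using x xy y by auto
    have d: "J x \<le> J y" using monoD[OF J xy] .
    have e1: "integral {0..y} J = integral {0..x} J + integral {x..y} J"
      using Henstock_Kurzweil_Integration.integral_combine[OF x xy iJ] y by simp
    have e2: "integral {0..y} q = integral {0..x} q + integral {x..y} q"
      using Henstock_Kurzweil_Integration.integral_combine[OF x xy iq] y by simp
    have b1: "integral {x..y} J \<le> (y - x) * J y"
    proof -
      have "integral {x..y} J \<le> integral {x..y} (\<lambda>_. J y)"
        using iJ[OF x y] monoD[OF J] by (intro integral_le) auto
      then show ?thesis using xy by simp
    qed
    let ?b = "y * ((J x - c)\<^sup>2 + K * (J y - J x))"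
    have b2: "integral {x..y} q \<le> (y - x) * ?b"
    proof -
      have "integral {x..y} q \<le> integral {x..y} (\<lambda>_. ?b)"
      proof (rule integral_le[OF iq[OF x y]])
        fix t assume t: "t \<in> {x..y}"
        then have t01: "0 \<le> t" "t \<le> 1" using x y by auto
        have jt: "J x \<le> J t" "J t \<le> J y" using t monoD[OF J] by auto
        have "(J t - c)\<^sup>2 - (J x - c)\<^sup>2 = (J t - J x) * (J t + J x - 2 * c)"
          by (simp add: power2_eq_square algebra_simps)
        also have "\<dots> \<le> (J t - J x) * K"
          using jt Jb[OF t01] Jb[OF x x1] unfolding K_def by (intro mult_left_mono) (smt (verit))+
        also have "\<dots> \<le> (J y - J x) * K"
          using jt K0 by (intro mult_right_mono) auto
        finally have "(J t - c)\<^sup>2 \<le> (J x - c)\<^sup>2 + K * (J y - J x)" by (simp add: mult.commute)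
        then show "q t \<le> ?b"
          unfolding q_def using t t01 by (intro mult_mono) auto
      qed auto
      then show ?thesis using xy by (simp add: mult_ac)
    qed
    have s: "x * ((y - x) * (J x - c)\<^sup>2 * (1 - (y - x) * c)) \<le> x * (J y - J x)"
      using step[OF x xy y] x by (intro mult_left_mono) (auto simp: power2_commute)
    have b3: "(y - x) * (J x - c)\<^sup>2 + x * (y - x) * c * (J x - c)\<^sup>2 \<le> (y - x) * (1 + \<bar>c\<bar>) * K\<^sup>2"
    proof -
      have "x * c \<le> \<bar>c\<bar>" using x x1 by (smt (verit) mult_left_le_one_le mult_nonneg_nonpos)
      then have "(y - x) * (1 + x * c) * (J x - c)\<^sup>2 \<le> (y - x) * (1 + \<bar>c\<bar>) * (J x - c)\<^sup>2"
        using xy by (intro mult_right_mono mult_left_mono) auto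
      also have "\<dots> \<le> (y - x) * (1 + \<bar>c\<bar>) * K\<^sup>2"
        using xy Jc2[OF x x1] by (intro mult_left_mono) auto
      finally show ?thesis by (simp add: algebra_simps)
    qed
    have b4: "y * (K * (J y - J x)) \<le> 1 * (K * (J y - J x))"
      using y K0 d by (intro mult_right_mono) auto
    define D where "D = (J x - c)\<^sup>2"
    define w where "w = K * (J y - J x)"
    have "\<Psi> y - \<Psi> x = y * J y - x * J x - integral {x..y} J - integral {x..y} q"
      by (simp add: \<Psi>_def e1 e2)
    also have "\<dots> \<ge> y * J y - x * J x - (y - x) * J y - (y - x) * (y * (D + w))"
      using b1 b2 unfolding D_def w_def by linarith
    also have "y * J y - x * J x - (y - x) * J y - (y - x) * (y * (D + w)) = x * (J y - J x) - (y - x) * (y * (D + w))"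
      by (simp add: algebra_simps)
    also have "\<dots> \<ge> x * ((y - x) * D * (1 - (y - x) * c)) - (y - x) * (y * (D + w))"
      using s unfolding D_def by linarith
    also have "x * ((y - x) * D * (1 - (y - x) * c)) - (y - x) * (y * (D + w))
        = - ((y - x) * (((y - x) * D + x * (y - x) * c * D) + y * w))"
      by (simp add: algebra_simps)
    also have "\<dots> \<ge> - ((y - x) * ((y - x) * (1 + \<bar>c\<bar>) * K\<^sup>2 + 1 * w))"
      using b3 b4 xy unfolding D_def[symmetric] w_def[symmetric]
      by (intro le_imp_neg_le mult_left_mono add_mono) auto
    finally show "\<Psi> x - (y - x) * (m y - m x) \<le> \<Psi> y"
      unfolding m_def w_def by (simp add: algebra_simps)
  qed simp
  then show ?thesis by (simp add: \<Psi>_def q_def[abs_def])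
qed

text \<open>The mean value theorem bounds the difference quotients by \<open>w\<close>, so dominated
  convergence applies along every sequence tending to \<open>r\<close>.\<close>

lemma has_real_derivative_integral:
  fixes U U' :: "real \<Rightarrow> 'a \<Rightarrow> real"
  assumes r: "r \<in> {a<..<b}"
    and d: "\<And>t x. t \<in> {a<..<b} \<Longrightarrow> ((\<lambda>t. U t x) has_real_derivative U' t x) (at t)"
    and bound: "\<And>t x. t \<in> {a<..<b} \<Longrightarrow> \<bar>U' t x\<bar> \<le> w x"
    and w: "integrable M w" and U: "\<And>t. t \<in> {a<..<b} \<Longrightarrow> integrable M (U t)"
    and [measurable]: "U' r \<in> borel_measurable M"
  shows "((\<lambda>t. \<integral>x. U t x \<partial>M) has_real_derivative (\<integral>x. U' r x \<partial>M)) (at r)"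
  unfolding has_field_derivative_iff tendsto_at_iff_sequentially
proof (intro allI impI)
  fix X :: "nat \<Rightarrow> real"
  assume Xr: "\<forall>i. X i \<in> UNIV - {r}" and X: "X \<longlonglongrightarrow> r"
  have "eventually (\<lambda>n. X n \<in> {a<..<b}) sequentially"
    using X r by (intro topological_tendstoD) auto
  then obtain N where N: "X (n + N) \<in> {a<..<b}" for n
    by (auto simp: eventually_sequentially) (metis le_add2)
  let ?Q = "\<lambda>t x. (U t x - U r x) / (t - r)"
  have X': "(\<lambda>n. X (n + N)) \<longlonglongrightarrow> r" using X by (rule LIMSEQ_ignore_initial_segment)
  have "(\<lambda>n. \<integral>x. ?Q (X (n + N)) x \<partial>M) \<longlonglongrightarrow> (\<integral>x. U' r x \<partial>M)"
  proof (rule integral_dominated_convergence)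
    show "(\<lambda>x. ?Q (X (n + N)) x) \<in> borel_measurable M" for n
      using borel_measurable_integrable[OF U[OF N[of n]]] borel_measurable_integrable[OF U[OF r]] by measurable
    show "AE x in M. (\<lambda>n. ?Q (X (n + N)) x) \<longlonglongrightarrow> U' r x"
    proof (rule AE_I2)
      fix x
      have "((\<lambda>t. ?Q t x) \<longlongrightarrow> U' r x) (at r)"
        using d[OF r, of x] by (simp add: has_field_derivative_iff)
      then show "(\<lambda>n. ?Q (X (n + N)) x) \<longlonglongrightarrow> U' r x"
        unfolding tendsto_at_iff_sequentially comp_def using Xr X' by auto
    qed
    show "AE x in M. norm (?Q (X (n + N)) x) \<le> w x" for n
    proof (rule AE_I2)
      fix x
      have "norm (U (X (n + N)) x - U r x) \<le> w x * norm (X (n + N) - r)"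
        by (rule field_differentiable_bound[of "{a<..<b}" _ "\<lambda>t. U' t x"])
          (use N r bound d in \<open>auto intro: has_field_derivative_at_within\<close>)
      then show "norm (?Q (X (n + N)) x) \<le> w x"
        using Xr by (simp add: divide_le_eq)
    qed
  qed (use w in auto)
  moreover have "(\<integral>x. ?Q (X (n + N)) x \<partial>M) = ((\<integral>x. U (X (n + N)) x \<partial>M) - (\<integral>x. U r x \<partial>M)) / (X (n + N) - r)" for n
    using U[OF N[of n]] U[OF r] by simp
  ultimately have "(\<lambda>n. ((\<integral>x. U (X (n + N)) x \<partial>M) - (\<integral>x. U r x \<partial>M)) / (X (n + N) - r)) \<longlonglongrightarrow> (\<integral>x. U' r x \<partial>M)"
    by (simp only:)
  from LIMSEQ_offset[OF this]
  show "((\<lambda>y. ((\<integral>x. U y x \<partial>M) - (\<integral>x. U r x \<partial>M)) / (y - r)) \<circ> X) \<longlonglongrightarrow> (\<integral>x. U' r x \<partial>M)"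
    by (simp add: comp_def)
qed

section \<open>De Bruijn's identity\<close>

text \<open>The lower bound keeps the logarithm of P_t f bounded and smooth in its argument; the
  upper bounds give majorants for every differentiation under the integral.\<close>

locale c1_nice = c1_density f g for f :: "real^'n \<Rightarrow> real" and g +
  fixes \<eta> C :: real
  assumes eta: "0 < \<eta>" and f_ge: "\<And>x. \<eta> \<le> f x" and f_le: "\<And>x. f x \<le> C"
    and g_le: "\<And>x. norm (g x) \<le> C"
begin

definition Fr :: "real \<Rightarrow> real^'n \<Rightarrow> real" where
  "Fr r x = (\<integral>y. f (sqrt r *\<^sub>R x + sqrt (1 - r) *\<^sub>R y) \<partial>gauss)"

definition Gr :: "real \<Rightarrow> real^'n \<Rightarrow> real^'n" where
  "Gr r x = (\<integral>y. g (sqrt r *\<^sub>R x + sqrt (1 - r) *\<^sub>R y) \<partial>gauss)"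

text \<open>The r-derivative of the point sqrt r x + sqrt (1 - r) y. It is proportional to the
  second component of the reflected pair, hence independent of that point under the product
  Gaussian.\<close>

definition vel :: "real \<Rightarrow> real^'n \<Rightarrow> real^'n \<Rightarrow> real^'n" where
  "vel r x y = (1 / (2 * sqrt r)) *\<^sub>R x - (1 / (2 * sqrt (1 - r))) *\<^sub>R y"

definition Dr :: "real \<Rightarrow> real^'n \<Rightarrow> real" where
  "Dr r x = (\<integral>y. g (sqrt r *\<^sub>R x + sqrt (1 - r) *\<^sub>R y) \<bullet> vel r x y \<partial>gauss)"

definition L :: real where "L = \<bar>ln \<eta>\<bar> + \<bar>ln C\<bar> + 1"

lemma C_pos: "0 < C" using eta f_ge[of 0] f_le[of 0] by simp

lemma Fr_meas [measurable]: "Fr r \<in> borel_measurable borel"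
  unfolding Fr_def by measurable

lemma Gr_meas [measurable]: "Gr r \<in> borel_measurable borel"
  unfolding Gr_def by measurable

lemma Dr_meas [measurable]: "Dr r \<in> borel_measurable borel"
  unfolding Dr_def vel_def by measurable

lemma f_comp_int: "h \<in> borel_measurable borel \<Longrightarrow> integrable gauss (\<lambda>y::real^'m. f (h y))"
  by (rule gauss.integrable_const_bound[where B = C]) (use f_nonneg f_le in auto)

lemma g_comp_int: "h \<in> borel_measurable borel \<Longrightarrow> integrable gauss (\<lambda>y::real^'m. g (h y))"
  by (rule gauss.integrable_const_bound[where B = C]) (use g_le in auto)

lemma Fr_bounds: "\<eta> \<le> Fr r x" "Fr r x \<le> C"
proof -
  have i: "integrable gauss (\<lambda>y. f (sqrt r *\<^sub>R x + sqrt (1 - r) *\<^sub>R y))"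
    by (rule f_comp_int) measurable
  show "\<eta> \<le> Fr r x" unfolding Fr_def
    using integral_mono[OF _ i, of "\<lambda>_. \<eta>"] f_ge by simp
  show "Fr r x \<le> C" unfolding Fr_def
    using integral_mono[OF i, of "\<lambda>_. C"] f_le by simp
qed

lemma Fr_pos: "0 < Fr r x"
  using Fr_bounds(1)[of r x] eta by linarith

lemma Gr_le: "norm (Gr r x) \<le> C"
proof -
  have i: "integrable gauss (\<lambda>y. g (sqrt r *\<^sub>R x + sqrt (1 - r) *\<^sub>R y))"
    by (rule g_comp_int) measurable
  have "norm (Gr r x) \<le> (\<integral>y. norm (g (sqrt r *\<^sub>R x + sqrt (1 - r) *\<^sub>R y)) \<partial>gauss)"
    unfolding Gr_def by (rule integral_norm_bound)
  also have "\<dots> \<le> (\<integral>(y::real^'n). C \<partial>gauss)"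
    using i g_le by (intro integral_mono) auto
  finally show ?thesis by simp
qed

lemma ln_le: "\<bar>ln (Fr r x) + 1\<bar> \<le> L" and ln_le': "\<bar>ln (Fr r x)\<bar> \<le> L"
proof -
  have "ln \<eta> \<le> ln (Fr r x)" "ln (Fr r x) \<le> ln C"
    using Fr_bounds[of r x] Fr_pos[of r x] eta C_pos by auto
  then show "\<bar>ln (Fr r x) + 1\<bar> \<le> L" "\<bar>ln (Fr r x)\<bar> \<le> L" unfolding L_def by (smt (verit))+
qed

lemma path_deriv:
  assumes t: "0 < t" "t < 1"
  shows "((\<lambda>t. f (sqrt t *\<^sub>R x + sqrt (1 - t) *\<^sub>R y)) has_real_derivative
     g (sqrt t *\<^sub>R x + sqrt (1 - t) *\<^sub>R y) \<bullet> vel t x y) (at t)"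
proof -
  have a: "(sqrt has_real_derivative 1 / (2 * sqrt t)) (at t)"
    by (rule DERIV_cong[OF DERIV_real_sqrt[OF t(1)]]) (use t in \<open>simp add: field_simps\<close>)
  have b: "((\<lambda>t. sqrt (1 - t)) has_real_derivative - (1 / (2 * sqrt (1 - t)))) (at t)"
  proof -
    have 1: "(sqrt has_real_derivative 1 / (2 * sqrt (1 - t))) (at (1 - t))"
      by (rule DERIV_cong[OF DERIV_real_sqrt]) (use t in \<open>simp_all add: field_simps\<close>)
    have 2: "((\<lambda>t. 1 - t) has_real_derivative -1) (at t)"
      by (auto intro!: derivative_eq_intros)
    show ?thesis using DERIV_chain2[OF 1 2] by (simp only: mult_minus1_right)
  qed
  have "((\<lambda>t. sqrt t *\<^sub>R x + sqrt (1 - t) *\<^sub>R y) has_vector_derivative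
     (sqrt t *\<^sub>R 0 + (1 / (2 * sqrt t)) *\<^sub>R x) + (sqrt (1 - t) *\<^sub>R 0 + (- (1 / (2 * sqrt (1 - t)))) *\<^sub>R y)) (at t)"
    by (rule has_vector_derivative_add[OF has_vector_derivative_scaleR[OF a has_vector_derivative_const]
          has_vector_derivative_scaleR[OF b has_vector_derivative_const]])
  then have 1: "((\<lambda>t. sqrt t *\<^sub>R x + sqrt (1 - t) *\<^sub>R y) has_derivative (\<lambda>h. h *\<^sub>R vel t x y)) (at t)"
    by (simp only: has_vector_derivative_def vel_def scaleR_zero_right add_0_left scaleR_minus_left diff_conv_add_uminus)
  have "(f \<circ> (\<lambda>t. sqrt t *\<^sub>R x + sqrt (1 - t) *\<^sub>R y) has_derivative
     (\<lambda>h. g (sqrt t *\<^sub>R x + sqrt (1 - t) *\<^sub>R y) \<bullet> h) \<circ> (\<lambda>h. h *\<^sub>R vel t x y)) (at t)"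
    by (rule diff_chain_at[OF 1 deriv])
  then show ?thesis
    by (simp only: has_field_derivative_def comp_def inner_scaleR_right mult_commute_abs)
qed

text \<open>The velocity blows up at 0 and 1; restricting to half the distance from \<open>r\<close>
  to each endpoint gives a majorant uniform in \<open>t\<close>.\<close>

lemma vel_bound:
  assumes r: "0 < r" "r < 1" and t: "t \<in> {r / 2<..<(1 + r) / 2}"
  shows "\<bar>g z \<bullet> vel t x y\<bar> \<le> C * ((1 / (2 * sqrt (r / 2))) * norm x + (1 / (2 * sqrt ((1 - r) / 2))) * norm y)"
proof -
  have "norm (vel t x y) \<le> (1 / (2 * sqrt t)) * norm x + (1 / (2 * sqrt (1 - t))) * norm y"
    unfolding vel_def using r t by (intro norm_triangle_le_diff) auto
  also have "\<dots> \<le> (1 / (2 * sqrt (r / 2))) * norm x + (1 / (2 * sqrt ((1 - r) / 2))) * norm y"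
  proof -
    have "sqrt (r / 2) \<le> sqrt t" "sqrt ((1 - r) / 2) \<le> sqrt (1 - t)"
      using r t by (auto simp: field_simps)
    moreover have "0 < sqrt (r / 2)" "0 < sqrt ((1 - r) / 2)" using r by auto
    ultimately have "1 / (2 * sqrt t) \<le> 1 / (2 * sqrt (r / 2))" "1 / (2 * sqrt (1 - t)) \<le> 1 / (2 * sqrt ((1 - r) / 2))"
      by (auto intro!: frac_le)
    then show ?thesis by (intro add_mono mult_right_mono) auto
  qed
  finally have v: "norm (vel t x y) \<le> \<dots>" .
  have "\<bar>g z \<bullet> vel t x y\<bar> \<le> norm (g z) * norm (vel t x y)" by (rule Cauchy_Schwarz_ineq2)
  also have "\<dots> \<le> C * norm (vel t x y)" using g_le by (intro mult_right_mono) auto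
  also have "\<dots> \<le> C * ((1 / (2 * sqrt (r / 2))) * norm x + (1 / (2 * sqrt ((1 - r) / 2))) * norm y)"
    using v C_pos by (intro mult_left_mono) auto
  finally show ?thesis .
qed

lemma Fr_deriv:
  assumes r: "0 < r" "r < 1"
  shows "((\<lambda>r. Fr r x) has_real_derivative Dr r x) (at r)"
  unfolding Fr_def Dr_def
proof (rule has_real_derivative_integral)
  show "r \<in> {r / 2<..<(1 + r) / 2}" using r by auto
  show "((\<lambda>t. f (sqrt t *\<^sub>R x + sqrt (1 - t) *\<^sub>R y)) has_real_derivative
     g (sqrt t *\<^sub>R x + sqrt (1 - t) *\<^sub>R y) \<bullet> vel t x y) (at t)" if "t \<in> {r / 2<..<(1 + r) / 2}" for t y
    using that r by (intro path_deriv) auto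
  show "\<bar>g (sqrt t *\<^sub>R x + sqrt (1 - t) *\<^sub>R y) \<bullet> vel t x y\<bar>
    \<le> C * ((1 / (2 * sqrt (r / 2))) * norm x + (1 / (2 * sqrt ((1 - r) / 2))) * norm y)"
    if "t \<in> {r / 2<..<(1 + r) / 2}" for t y
    by (rule vel_bound[OF r that])
  show "integrable gauss (\<lambda>y::real^'n. C * ((1 / (2 * sqrt (r / 2))) * norm x + (1 / (2 * sqrt ((1 - r) / 2))) * norm y))"
    by (intro integrable_mult_right Bochner_Integration.integrable_add integrable_gauss_norm) simp
  show "integrable gauss (\<lambda>y. f (sqrt t *\<^sub>R x + sqrt (1 - t) *\<^sub>R y))" for t
    by (rule f_comp_int) measurable
qed (unfold vel_def, measurable)

lemma Dr_bound:
  assumes r: "0 < r" "r < 1" and t: "t \<in> {r / 2<..<(1 + r) / 2}"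
  shows "\<bar>Dr t x\<bar> \<le> C * ((1 / (2 * sqrt (r / 2))) * norm x + (1 / (2 * sqrt ((1 - r) / 2))) * (\<integral>(y::real^'n). norm y \<partial>gauss))"
proof -
  let ?w = "\<lambda>y::real^'n. C * ((1 / (2 * sqrt (r / 2))) * norm x + (1 / (2 * sqrt ((1 - r) / 2))) * norm y)"
  have w: "integrable gauss ?w"
    by (intro integrable_mult_right Bochner_Integration.integrable_add integrable_gauss_norm) simp
  have i: "integrable gauss (\<lambda>y. g (sqrt t *\<^sub>R x + sqrt (1 - t) *\<^sub>R y) \<bullet> vel t x y)"
  proof (rule Bochner_Integration.integrable_bound[OF w])
    show "AE y in gauss. norm (g (sqrt t *\<^sub>R x + sqrt (1 - t) *\<^sub>R y) \<bullet> vel t x y) \<le> norm (?w y)"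
    proof (rule AE_I2)
      fix y
      show "norm (g (sqrt t *\<^sub>R x + sqrt (1 - t) *\<^sub>R y) \<bullet> vel t x y) \<le> norm (?w y)"
        unfolding real_norm_def by (rule order_trans[OF vel_bound[OF r t] abs_ge_self])
    qed
  qed (unfold vel_def, measurable)
  have "\<bar>Dr t x\<bar> \<le> (\<integral>y. ?w y \<partial>gauss)"
    unfolding Dr_def real_norm_def[symmetric]
    by (rule order_trans[OF integral_norm_bound integral_mono[OF integrable_norm[OF i] w]])
      (simp only: real_norm_def vel_bound[OF r t])
  then show ?thesis using integrable_gauss_norm[where 'n='n] by simp
qed

definition Hr :: "real \<Rightarrow> real" where
  "Hr r = (\<integral>x. Fr r x * ln (Fr r x) \<partial>gauss)"

lemma Fr_ln_bound: "\<bar>Fr r x * ln (Fr r x)\<bar> \<le> C * L"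
proof -
  have "\<bar>Fr r x\<bar> \<le> C" using Fr_bounds(2)[of r x] Fr_pos[of r x] by simp
  then show ?thesis unfolding abs_mult using ln_le'[of r x] C_pos by (intro mult_mono) auto
qed

lemma Hr_int: "integrable gauss (\<lambda>x. Fr r x * ln (Fr r x))"
proof (rule gauss.integrable_const_bound[where B = "C * L"])
  show "AE x in gauss. norm (Fr r x * ln (Fr r x)) \<le> C * L"
    using Fr_ln_bound by simp
qed measurable

lemma Hr_deriv:
  assumes r: "0 < r" "r < 1"
  shows "(Hr has_real_derivative (\<integral>x. (ln (Fr r x) + 1) * Dr r x \<partial>gauss)) (at r)"
proof -
  let ?w = "\<lambda>x::real^'n. C * ((1 / (2 * sqrt (r / 2))) * norm x + (1 / (2 * sqrt ((1 - r) / 2))) * (\<integral>(y::real^'n). norm y \<partial>gauss))"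
  have "((\<lambda>r. \<integral>x. Fr r x * ln (Fr r x) \<partial>gauss) has_real_derivative (\<integral>x. (ln (Fr r x) + 1) * Dr r x \<partial>gauss)) (at r)"
  proof (rule has_real_derivative_integral)
    show "r \<in> {r / 2<..<(1 + r) / 2}" using r by auto
    show "((\<lambda>t. Fr t x * ln (Fr t x)) has_real_derivative (ln (Fr t x) + 1) * Dr t x) (at t)"
      if "t \<in> {r / 2<..<(1 + r) / 2}" for t x
    proof -
      have t: "0 < t" "t < 1" using that r by auto
      show ?thesis
        using Fr_deriv[OF t, of x] Fr_pos[of t x]
        by (auto intro!: derivative_eq_intros simp: field_simps)
    qed
    show "\<bar>(ln (Fr t x) + 1) * Dr t x\<bar> \<le> L * ?w x" if "t \<in> {r / 2<..<(1 + r) / 2}" for t x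
      unfolding abs_mult using ln_le[of t x] Dr_bound[OF r that, of x] by (intro mult_mono) auto
    show "integrable gauss (\<lambda>x::real^'n. L * ?w x)"
      by (intro integrable_mult_right Bochner_Integration.integrable_add integrable_gauss_norm) simp
    show "integrable gauss (\<lambda>x. Fr t x * ln (Fr t x))" for t by (rule Hr_int)
  qed measurable
  then show ?thesis by (simp add: Hr_def[abs_def])
qed

lemma Fr_line_deriv:
  assumes r: "0 \<le> r"
  shows "((\<lambda>t. Fr r (x + t *\<^sub>R \<alpha>)) has_real_derivative sqrt r * (Gr r x \<bullet> \<alpha>)) (at 0)"
proof -
  let ?U' = "\<lambda>t y. sqrt r * (g (sqrt r *\<^sub>R (x + t *\<^sub>R \<alpha>) + sqrt (1 - r) *\<^sub>R y) \<bullet> \<alpha>)"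
  have i: "integrable gauss (\<lambda>y. g (sqrt r *\<^sub>R x + sqrt (1 - r) *\<^sub>R y))"
    by (rule g_comp_int) measurable
  have "((\<lambda>t. Fr r (x + t *\<^sub>R \<alpha>)) has_real_derivative (\<integral>y. ?U' 0 y \<partial>gauss)) (at 0)"
    unfolding Fr_def
  proof (rule has_real_derivative_integral[where a = "-1" and b = 1 and w = "\<lambda>_. sqrt r * (C * norm \<alpha>)" and U' = ?U'])
    fix t :: real and y
    let ?z = "\<lambda>t. sqrt r *\<^sub>R (x + t *\<^sub>R \<alpha>) + sqrt (1 - r) *\<^sub>R y"
    have 1: "(?z has_derivative (\<lambda>h. h *\<^sub>R (sqrt r *\<^sub>R \<alpha>))) (at t)"
      by (auto intro!: derivative_eq_intros)
    have "(f \<circ> ?z has_derivative (\<lambda>h. g (?z t) \<bullet> h) \<circ> (\<lambda>h. h *\<^sub>R (sqrt r *\<^sub>R \<alpha>))) (at t)"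
      by (rule diff_chain_at[OF 1 deriv])
    then show "((\<lambda>t. f (?z t)) has_real_derivative ?U' t y) (at t)"
      by (simp only: has_field_derivative_def comp_def inner_scaleR_right mult_commute_abs)
    have "\<bar>g (?z t) \<bullet> \<alpha>\<bar> \<le> C * norm \<alpha>"
      by (rule order_trans[OF Cauchy_Schwarz_ineq2 mult_right_mono]) (use g_le in auto)
    then show "\<bar>?U' t y\<bar> \<le> sqrt r * (C * norm \<alpha>)"
      unfolding abs_mult using r by (intro mult_mono) auto
  next
    show "integrable gauss (\<lambda>y. f (sqrt r *\<^sub>R (x + t *\<^sub>R \<alpha>) + sqrt (1 - r) *\<^sub>R y))" for t
      by (rule f_comp_int) measurable
  qed (auto simp: abs_le_iff)
  moreover have "(\<integral>y. ?U' 0 y \<partial>gauss) = sqrt r * (Gr r x \<bullet> \<alpha>)"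
    using i by (simp add: Gr_def)
  ultimately show ?thesis by (simp only:)
qed

text \<open>In reflected variables (a, b) the gradient \<open>g\<close> depends on a alone, the
  velocity is a multiple of b, and x = c a + s b. Integration by parts in b in the fixed direction
  g(a) moves the derivative onto ln \<open>Fr\<close>; reflecting back and averaging g over y turns
  the second gradient into \<open>Gr\<close> too. Only first derivatives occur.\<close>

lemma entropy_production:
  assumes r: "0 < r" "r < 1"
  shows "(\<integral>x. (ln (Fr r x) + 1) * Dr r x \<partial>gauss) = (\<integral>x. (norm (Gr r x))\<^sup>2 / Fr r x \<partial>gauss) / 2"
proof -
  define c s where "c = sqrt r" and "s = sqrt (1 - r)"
  have cs: "0 < c" "0 < s" "c\<^sup>2 + s\<^sup>2 = 1" "0 \<le> c" using r by (auto simp: c_def s_def)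
  let ?\<gamma> = "gauss \<Otimes>\<^sub>M gauss :: ((real^'n) \<times> (real^'n)) measure"
  let ?R = "reflect2 c s :: (real^'n) \<times> (real^'n) \<Rightarrow> _"
  have R: "fst (?R p) = c *\<^sub>R fst p + s *\<^sub>R snd p" "snd (?R p) = s *\<^sub>R fst p - c *\<^sub>R snd p"
    "c *\<^sub>R fst (?R p) + s *\<^sub>R snd (?R p) = fst p" for p
    using reflect2_reflect2[OF cs(3), of p] by (auto simp: reflect2_def prod_eq_iff)
  define u where "u x = ln (Fr r x) + 1" for x
  have [measurable]: "u \<in> borel_measurable borel" unfolding u_def by measurable
  \<comment> \<open>The integrand after reflection; 1 / (2 c s) is the proportionality factor
    between \<open>vel\<close> and the second component.\<close>
  define K where "K q = (1 / (2 * c * s)) * (u (c *\<^sub>R fst q + s *\<^sub>R snd q) * (g (fst q) \<bullet> snd q))" for q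
  define M where "M q = (Gr r (c *\<^sub>R fst q + s *\<^sub>R snd q) \<bullet> g (fst q)) / Fr r (c *\<^sub>R fst q + s *\<^sub>R snd q)" for q
  have [measurable]: "K \<in> borel_measurable (borel \<Otimes>\<^sub>M borel)" unfolding K_def by measurable
  have [measurable]: "M \<in> borel_measurable (borel \<Otimes>\<^sub>M borel)" unfolding M_def by measurable
  have Ki: "integrable ?\<gamma> K"
  proof (rule Bochner_Integration.integrable_bound)
    show "integrable ?\<gamma> (\<lambda>q. ((1 / (2 * c * s)) * (L * C)) * norm (snd q))"
      using integrable_gauss2_prod(1)[of "\<lambda>_::real^'n. (1 / (2 * c * s)) * (L * C)", OF _ integrable_gauss_norm[where 'n='n]]
      by simp
    have "\<bar>u z * (g a \<bullet> b)\<bar> \<le> L * (C * norm b)" for z a b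
      unfolding abs_mult u_def
      by (intro mult_mono ln_le order_trans[OF Cauchy_Schwarz_ineq2 mult_right_mono[OF g_le]]) (auto simp: L_def)
    then have "\<bar>K q\<bar> \<le> (1 / (2 * c * s)) * (L * (C * norm (snd q)))" for q
      unfolding K_def abs_mult[of "1 / (2 * c * s)"] using cs by (intro mult_mono) auto
    then have Kq: "\<bar>K q\<bar> \<le> ((1 / (2 * c * s)) * (L * C)) * norm (snd q)" for q
      by (simp only: mult.assoc)
    then show "AE q in ?\<gamma>. norm (K q) \<le> norm (((1 / (2 * c * s)) * (L * C)) * norm (snd q))"
      unfolding real_norm_def by (intro AE_I2 order_trans[OF Kq abs_ge_self])
  qed measurable
  have KR: "K (?R p) = (ln (Fr r (fst p)) + 1) * (g (sqrt r *\<^sub>R fst p + sqrt (1 - r) *\<^sub>R snd p) \<bullet> vel r (fst p) (snd p))" for p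
  proof -
    have "vel r (fst p) (snd p) = (1 / (2 * c * s)) *\<^sub>R (s *\<^sub>R fst p - c *\<^sub>R snd p)"
      using cs by (simp add: vel_def c_def[symmetric] s_def[symmetric] scaleR_diff_right)
    then show ?thesis
      unfolding K_def R(3) unfolding R(1,2) u_def c_def[symmetric] s_def[symmetric] by simp
  qed
  have Mi: "integrable ?\<gamma> (\<lambda>q. (1 / 2) * M q)"
  proof (intro integrable_mult_right gauss2.integrable_const_bound[where B = "C * C / \<eta>"])
    have "\<bar>M q\<bar> \<le> C * C / \<eta>" for q
      unfolding M_def abs_divide using Fr_bounds(1) Fr_pos eta C_pos
      by (intro frac_le order_trans[OF Cauchy_Schwarz_ineq2 mult_mono] Gr_le g_le) (auto simp: less_imp_le intro: order_trans)
    then show "AE q in ?\<gamma>. norm (M q) \<le> C * C / \<eta>" by simp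
  qed measurable
  have "(\<integral>x. (ln (Fr r x) + 1) * Dr r x \<partial>gauss) = (\<integral>x. (\<integral>y. K (?R (x, y)) \<partial>gauss) \<partial>gauss)"
    unfolding KR Dr_def by simp
  also have "\<dots> = (\<integral>p. K (?R p) \<partial>?\<gamma>)"
    by (rule gauss2.integral_fst'[OF integrable_reflect2[OF cs(3,4) Ki]])
  also have "\<dots> = (\<integral>q. K q \<partial>?\<gamma>)"
    by (rule integral_reflect2[OF cs(3,4)]) measurable
  also have "\<dots> = (\<integral>a. (\<integral>b. K (a, b) \<partial>gauss) \<partial>gauss)"
    by (rule gauss2.integral_fst'[OF Ki, symmetric])
  also have "\<dots> = (\<integral>a. (\<integral>b. (1 / 2) * M (a, b) \<partial>gauss) \<partial>gauss)"
  proof (rule Bochner_Integration.integral_cong[OF refl])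
    fix a :: "real^'n"
    let ?z = "\<lambda>b. c *\<^sub>R a + s *\<^sub>R b"
    have ui: "integrable gauss (\<lambda>b. u (?z b))"
      by (rule gauss.integrable_const_bound[where B = L]) (use ln_le in \<open>auto simp: u_def\<close>)
    have Mi: "integrable gauss (\<lambda>b. M (a, b))"
    proof (rule gauss.integrable_const_bound[where B = "C * C / \<eta>"])
      have "\<bar>M (a, b)\<bar> \<le> C * C / \<eta>" for b
        unfolding M_def abs_divide using Fr_bounds(1) Fr_pos eta C_pos
        by (intro frac_le order_trans[OF Cauchy_Schwarz_ineq2 mult_mono] Gr_le g_le) (auto simp: less_imp_le intro: order_trans)
      then show "AE b in gauss. norm (M (a, b)) \<le> C * C / \<eta>" by simp
    qed measurable
    have uli: "integrable gauss (\<lambda>b. u (?z b) * (g a \<bullet> b))"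
    proof (rule Bochner_Integration.integrable_bound)
      show "integrable gauss (\<lambda>b::real^'n. L * (g a \<bullet> b))" by (intro integrable_mult_right integrable_gauss_inner)
      show "AE b in gauss. norm (u (?z b) * (g a \<bullet> b)) \<le> norm (L * (g a \<bullet> b))"
        using ln_le by (auto simp: abs_mult u_def L_def intro!: mult_right_mono)
    qed measurable
    \<comment> \<open>The chain rule produces s from the position of b and c from
      \<open>Fr_line_deriv\<close>; together they cancel the factor 1 / (c s) in \<open>K\<close>
      and leave 1 / 2.\<close>
    have "(\<integral>b. (s * c) * M (a, b) - u (?z b) * (g a \<bullet> b) \<partial>gauss) = 0"
    proof (rule gauss_ibp[OF ui])
      show "integrable gauss (\<lambda>b. (s * c) * M (a, b) - u (?z b) * (g a \<bullet> b))"
        by (intro Bochner_Integration.integrable_diff integrable_mult_right Mi uli)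
      fix b
      have 1: "((\<lambda>t. Fr r (?z b + t *\<^sub>R g a)) has_real_derivative c * (Gr r (?z b) \<bullet> g a)) (at (s * 0))"
        using Fr_line_deriv[of r "?z b" "g a"] r by (simp add: c_def)
      have 2: "((\<lambda>t. s * t) has_real_derivative s) (at 0)"
        by (auto intro!: derivative_eq_intros)
      have 3: "((\<lambda>t. Fr r (?z b + (s * t) *\<^sub>R g a)) has_real_derivative c * (Gr r (?z b) \<bullet> g a) * s) (at 0)"
        by (rule DERIV_chain2[OF 1 2])
      have 4: "?z (b + t *\<^sub>R g a) = ?z b + (s * t) *\<^sub>R g a" for t by (simp add: scaleR_add_right)
      have "((\<lambda>t. ln (Fr r (?z b + (s * t) *\<^sub>R g a)) + 1) has_real_derivative
         (1 / Fr r (?z b)) * (c * (Gr r (?z b) \<bullet> g a) * s)) (at 0)"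
        using Fr_pos[of r "?z b"] 3 by (auto intro!: derivative_eq_intros)
      then show "((\<lambda>t. u (?z (b + t *\<^sub>R g a))) has_real_derivative (s * c) * M (a, b)) (at 0)"
        unfolding 4 u_def M_def by (simp add: mult_ac)
    qed
    then have "(\<integral>b. u (?z b) * (g a \<bullet> b) \<partial>gauss) = (s * c) * (\<integral>b. M (a, b) \<partial>gauss)"
      using Mi uli by simp
    then show "(\<integral>b. K (a, b) \<partial>gauss) = (\<integral>b. (1 / 2) * M (a, b) \<partial>gauss)"
      using cs by (simp add: K_def)
  qed
  also have "\<dots> = (\<integral>q. (1 / 2) * M q \<partial>?\<gamma>)"
    by (rule gauss2.integral_fst'[OF Mi])
  also have "\<dots> = (\<integral>p. (1 / 2) * M (?R p) \<partial>?\<gamma>)"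
    by (rule integral_reflect2[OF cs(3,4), of "\<lambda>q. (1 / 2) * M q", symmetric]) measurable
  also have "\<dots> = (\<integral>x. (\<integral>y. (1 / 2) * M (?R (x, y)) \<partial>gauss) \<partial>gauss)"
    by (rule gauss2.integral_fst'[OF integrable_reflect2[OF cs(3,4) Mi], symmetric])
  also have "\<dots> = (\<integral>x. (1 / 2) * ((norm (Gr r x))\<^sup>2 / Fr r x) \<partial>gauss)"
  proof (rule Bochner_Integration.integral_cong[OF refl])
    fix x :: "real^'n"
    have i: "integrable gauss (\<lambda>y. g (c *\<^sub>R x + s *\<^sub>R y))"
      by (rule g_comp_int) measurable
    have "(\<integral>y. (1 / 2) * M (?R (x, y)) \<partial>gauss) = (\<integral>y. (1 / 2) * ((Gr r x \<bullet> g (c *\<^sub>R x + s *\<^sub>R y)) / Fr r x) \<partial>gauss)"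
      unfolding M_def R(3) unfolding R(1) by simp
    also have "\<dots> = (1 / 2) * ((Gr r x \<bullet> (\<integral>y. g (c *\<^sub>R x + s *\<^sub>R y) \<partial>gauss)) / Fr r x)"
      using i by simp
    also have "(\<integral>y. g (c *\<^sub>R x + s *\<^sub>R y) \<partial>gauss) = Gr r x"
      by (simp add: Gr_def c_def s_def)
    finally show "(\<integral>y. (1 / 2) * M (?R (x, y)) \<partial>gauss) = (1 / 2) * ((norm (Gr r x))\<^sup>2 / Fr r x)"
      by (simp add: power2_norm_eq_inner)
  qed
  also have "\<dots> = (1 / 2) * (\<integral>x. (norm (Gr r x))\<^sup>2 / Fr r x \<partial>gauss)"
    by (rule integral_mult_right_zero)
  finally show ?thesis by simp
qed

lemma Fr_sequence:
  assumes X: "\<And>n. X n \<in> {0..1}" "X \<longlonglongrightarrow> r"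
  shows "(\<lambda>n. Fr (X n) x) \<longlonglongrightarrow> Fr r x"
  unfolding Fr_def
proof (rule integral_dominated_convergence[where w = "\<lambda>_. C"])
  show "AE y in gauss. (\<lambda>n. f (sqrt (X n) *\<^sub>R x + sqrt (1 - X n) *\<^sub>R y)) \<longlonglongrightarrow> f (sqrt r *\<^sub>R x + sqrt (1 - r) *\<^sub>R y)"
  proof (rule AE_I2)
    fix y
    have "(\<lambda>n. sqrt (X n) *\<^sub>R x + sqrt (1 - X n) *\<^sub>R y) \<longlonglongrightarrow> sqrt r *\<^sub>R x + sqrt (1 - r) *\<^sub>R y"
      by (intro tendsto_intros X)
    moreover have "isCont f z" for z using f_cont by (simp add: continuous_on_eq_continuous_at)
    ultimately show "(\<lambda>n. f (sqrt (X n) *\<^sub>R x + sqrt (1 - X n) *\<^sub>R y)) \<longlonglongrightarrow> f (sqrt r *\<^sub>R x + sqrt (1 - r) *\<^sub>R y)"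
      using isCont_tendsto_compose by blast
  qed
  show "AE y in gauss. norm (f (sqrt (X n) *\<^sub>R x + sqrt (1 - X n) *\<^sub>R y)) \<le> C" for n
    using f_nonneg f_le by simp
qed auto

text \<open>The derivative of \<open>Hr\<close> is available only for 0 < r < 1, so the fundamental
  theorem needs continuity up to both endpoints.\<close>

lemma Hr_cont: "continuous_on {0..1} Hr"
proof (rule continuous_on_sequentiallyI)
  fix X :: "nat \<Rightarrow> real" and r
  assume X: "\<forall>n. X n \<in> {0..1}" "X \<longlonglongrightarrow> r"
  show "(\<lambda>n. Hr (X n)) \<longlonglongrightarrow> Hr r"
    unfolding Hr_def
  proof (rule integral_dominated_convergence[where w = "\<lambda>_. C * L"])
    show "AE x in gauss. (\<lambda>n. Fr (X n) x * ln (Fr (X n) x)) \<longlonglongrightarrow> Fr r x * ln (Fr r x)"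
    proof (rule AE_I2)
      fix x
      show "(\<lambda>n. Fr (X n) x * ln (Fr (X n) x)) \<longlonglongrightarrow> Fr r x * ln (Fr r x)"
        using X Fr_pos[of r x] by (intro tendsto_intros Fr_sequence) auto
    qed
    show "AE x in gauss. norm (Fr (X n) x * ln (Fr (X n) x)) \<le> C * L" for n
      using Fr_ln_bound by simp
  qed auto
qed

text \<open>At r = 0 the evolved density is the constant total mass. The term mass * ln mass is kept
  because the truncated densities are not normalized.\<close>

lemma de_bruijn:
  "((\<lambda>r. info f g (sqrt r) / 2) has_integral
     (\<integral>x. f x * ln (f x) \<partial>gauss) - (\<integral>x. f x \<partial>gauss) * ln (\<integral>x. f x \<partial>gauss)) {0..1}"
proof -
  have "((\<lambda>r. (\<integral>x. (norm (Gr r x))\<^sup>2 / Fr r x \<partial>gauss) / 2) has_integral Hr 1 - Hr 0) {0..1}"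
  proof (rule fundamental_theorem_of_calculus_interior)
    fix r :: real assume "r \<in> {0<..<1}"
    then have r: "0 < r" "r < 1" by auto
    show "(Hr has_vector_derivative (\<integral>x. (norm (Gr r x))\<^sup>2 / Fr r x \<partial>gauss) / 2) (at r)"
      using Hr_deriv[OF r] unfolding entropy_production[OF r] has_real_derivative_iff_has_vector_derivative .
  qed (use Hr_cont in auto)
  moreover have "(\<integral>x. (norm (Gr r x))\<^sup>2 / Fr r x \<partial>gauss) = info f g (sqrt r)" if "r \<in> {0..1}" for r
    using that unfolding info_def mehler_def Fr_def Gr_def by simp
  moreover have "Hr 1 = (\<integral>x. f x * ln (f x) \<partial>gauss)" "Hr 0 = (\<integral>x. f x \<partial>gauss) * ln (\<integral>x. f x \<partial>gauss)"
    by (simp_all add: Hr_def Fr_def)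
  ultimately show ?thesis
    using has_integral_cong[of "{0..1}" "\<lambda>r. (\<integral>x. (norm (Gr r x))\<^sup>2 / Fr r x \<partial>gauss) / 2" "\<lambda>r. info f g (sqrt r) / 2"] by simp
qed

end

text \<open>The square removes the kink of the positive part, so a squared cutoff still has a
  continuous gradient.\<close>

lemma has_real_derivative_max0_sq:
  "((\<lambda>u. (max 0 u)\<^sup>2) has_real_derivative 2 * max 0 u) (at (u :: real))"
proof -
  consider "u < 0" | "u = 0" | "0 < u" by linarith
  then show ?thesis
  proof cases
    case 1
    have "eventually (\<lambda>v. v < 0) (nhds u)" using eventually_nhds_in_open[of "{..<0}" u] 1 by simp
    then have "eventually (\<lambda>v. (max 0 v)\<^sup>2 = 0) (nhds u)" by eventually_elim (simp add: max_def)
    from DERIV_cong_ev[OF refl this refl] 1 show ?thesis by simp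
  next
    case 2
    have "((\<lambda>h. (max 0 h)\<^sup>2 / h) \<longlongrightarrow> 0) (at (0::real))"
    proof (rule Lim_null_comparison[where g = "\<lambda>h. \<bar>h\<bar>"])
      show "eventually (\<lambda>h. norm ((max 0 h)\<^sup>2 / h) \<le> \<bar>h\<bar>) (at (0::real))"
        by (auto simp: max_def power2_eq_square intro!: always_eventually)
      show "((\<lambda>h::real. \<bar>h\<bar>) \<longlongrightarrow> 0) (at 0)"
        by (rule tendsto_rabs_zero) simp
    qed
    then show ?thesis using 2 by (simp add: has_field_derivative_iff)
  next
    case 3
    have "eventually (\<lambda>v. 0 < v) (nhds u)" using eventually_nhds_in_open[of "{0<..}" u] 3 by simp
    then have "eventually (\<lambda>v. (max 0 v)\<^sup>2 = v\<^sup>2) (nhds u)" by eventually_elim (simp add: max_def)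
    moreover have "((\<lambda>v. v\<^sup>2) has_real_derivative 2 * u) (at u)" by (auto intro!: derivative_eq_intros)
    ultimately show ?thesis using 3 DERIV_cong_ev[OF refl _ refl, of "\<lambda>v. (max 0 v)\<^sup>2" "\<lambda>v. v\<^sup>2" u "2 * u"] by simp
  qed
qed

text \<open>A cruder bound than the minimum - exp (- 1), chosen because adding 1 already makes the
  entropy integrand nonnegative, as Fatou's lemma requires.\<close>

lemma mult_ln_ge: "-1 \<le> u * ln (u :: real)" if "0 \<le> u"
proof (cases "u = 0")
  case False
  with that have u: "0 < u" by simp
  have "ln (1 / u) \<le> 1 / u - 1" using u by (intro ln_le_minus_one) simp
  then have "u * (- ln u) \<le> u * (1 / u - 1)" using u by (intro mult_left_mono) (auto simp: ln_div)
  then show ?thesis using u by (simp add: algebra_simps)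
qed simp

section \<open>Truncation and passage to the limit in de Bruijn's identity\<close>

context c1_density
begin

text \<open>Truncations of \<open>f\<close> to which \<open>de_bruijn\<close> applies. Squaring the cutoff \<open>tk\<close> is what keeps
  \<open>\<bar>gk\<bar>\<^sup>2 / fk\<close> below the integrable function \<open>W\<close>, uniformly in \<open>k\<close>.\<close>

definition ka :: "nat \<Rightarrow> real" where "ka k = real (Suc k)"

definition tk :: "nat \<Rightarrow> real^'n \<Rightarrow> real" where "tk k x = max 0 (1 - (norm x)\<^sup>2 / (ka k)\<^sup>2)"

definition fk :: "nat \<Rightarrow> real^'n \<Rightarrow> real" where "fk k x = (tk k x)\<^sup>2 * f x + 1 / ka k"

text \<open>The gradient of \<open>fk k\<close>; the 4 is 2 from squaring the cutoff times 2 from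
  the squared norm.\<close>

definition gk :: "nat \<Rightarrow> real^'n \<Rightarrow> real^'n" where
  "gk k x = (tk k x)\<^sup>2 *\<^sub>R g x - (f x * (4 * tk k x / (ka k)\<^sup>2)) *\<^sub>R x"

lemma ka_pos: "0 < ka k" and ka_ge: "1 \<le> ka k"
  by (auto simp: ka_def)

lemma tk_cont: "continuous_on UNIV (tk k)"
  unfolding tk_def using ka_pos[of k] by (intro continuous_intros) auto

lemma tk_bounds: "0 \<le> tk k x" "tk k x \<le> 1" "(tk k x)\<^sup>2 \<le> 1"
proof -
  show 1: "0 \<le> tk k x" "tk k x \<le> 1" unfolding tk_def by (auto simp: max_def)
  show "(tk k x)\<^sup>2 \<le> 1" using 1 by (simp add: power_le_one)
qed

lemma tk_zero: "ka k \<le> norm x \<Longrightarrow> tk k x = 0"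
  using ka_pos[of k] power_mono[of "ka k" "norm x" 2] by (simp add: tk_def max_def field_simps)

lemma tk_deriv: "((\<lambda>x. (tk k x)\<^sup>2) has_derivative (\<lambda>h. - (4 * tk k x / (ka k)\<^sup>2) * (x \<bullet> h))) (at x)"
proof -
  have 1: "((\<lambda>x. 1 - (norm x)\<^sup>2 / (ka k)\<^sup>2) has_derivative (\<lambda>h. - (2 * (x \<bullet> h)) / (ka k)\<^sup>2)) (at x)"
    unfolding power2_norm_eq_inner divide_inverse
    by (auto intro!: derivative_eq_intros simp: inner_commute)
  have 2: "((\<lambda>u. (max 0 u)\<^sup>2) has_derivative (\<lambda>h. 2 * max 0 (1 - (norm x)\<^sup>2 / (ka k)\<^sup>2) * h)) (at (1 - (norm x)\<^sup>2 / (ka k)\<^sup>2))"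
    using has_real_derivative_max0_sq unfolding has_field_derivative_def by blast
  show ?thesis using diff_chain_at[OF 1 2] by (simp add: comp_def tk_def mult.assoc)
qed

lemma fk_deriv: "(fk k has_derivative (\<lambda>h. gk k x \<bullet> h)) (at x)"
  unfolding fk_def
  by (rule derivative_eq_intros tk_deriv deriv refl)+
    (simp add: gk_def fun_eq_iff inner_diff_left algebra_simps)

lemma gk_cont: "continuous_on UNIV (gk k)"
  unfolding gk_def using ka_pos[of k] by (intro continuous_intros g_cont f_cont tk_cont) auto

lemma fk_cont: "continuous_on UNIV (fk k)"
  unfolding fk_def using ka_pos[of k] by (intro continuous_intros f_cont tk_cont) auto

lemma fk_meas [measurable]: "fk k \<in> borel_measurable borel"
  by (rule borel_measurable_continuous_onI[OF fk_cont])

lemma gk_meas [measurable]: "gk k \<in> borel_measurable borel"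
  by (rule borel_measurable_continuous_onI[OF gk_cont])

lemma fk_ge: "1 / ka k \<le> fk k x"
  unfolding fk_def using f_nonneg by simp

lemma fk_pos: "0 < fk k x"
  using fk_ge[of k x] ka_pos[of k] by (smt (verit) divide_pos_pos)

lemma fk_le: "fk k x \<le> f x + 1"
proof -
  have "(tk k x)\<^sup>2 * f x \<le> 1 * f x" using tk_bounds f_nonneg by (intro mult_right_mono) auto
  moreover have "1 / ka k \<le> 1" using ka_ge[of k] by simp
  ultimately show ?thesis by (simp add: fk_def)
qed

text \<open>Continuity bounds both functions on the ball; outside it the cutoff vanishes,
  \<open>fk k\<close> equals \<open>1 / ka k\<close> and \<open>gk k\<close> is 0.\<close>

lemma c1_nice_approx: obtains C where "c1_nice (fk k) (gk k) (1 / ka k) C"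
proof -
  have "compact (fk k ` cball 0 (ka k))" "compact (gk k ` cball 0 (ka k))"
    by (auto intro!: compact_continuous_image continuous_on_subset[OF fk_cont] continuous_on_subset[OF gk_cont])
  then have "bounded (fk k ` cball 0 (ka k))" "bounded (gk k ` cball 0 (ka k))"
    by (auto intro: compact_imp_bounded)
  then obtain A B where A: "\<And>x. x \<in> cball 0 (ka k) \<Longrightarrow> \<bar>fk k x\<bar> \<le> A" and B: "\<And>x. x \<in> cball 0 (ka k) \<Longrightarrow> norm (gk k x) \<le> B"
    unfolding bounded_iff by (metis imageI real_norm_def)
  define C where "C = max A (max B (1 / ka k))"
  have C: "fk k x \<le> C" "norm (gk k x) \<le> C" for x
  proof -
    have C0: "0 \<le> C" using ka_pos[of k] by (simp add: C_def le_max_iff_disj less_imp_le)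
    have "fk k x \<le> C \<and> norm (gk k x) \<le> C"
    proof (cases "x \<in> cball 0 (ka k)")
      case True
      then show ?thesis using A[OF True] B[OF True] unfolding C_def by linarith
    next
      case False
      then have "tk k x = 0" by (intro tk_zero) auto
      then show ?thesis using C0 by (simp add: fk_def gk_def) (simp add: C_def)
    qed
    then show "fk k x \<le> C" "norm (gk k x) \<le> C" by auto
  qed
  have "c1_nice (fk k) (gk k) (1 / ka k) C"
  proof unfold_locales
    show "integrable gauss (fk k)"
      by (rule gauss.integrable_const_bound[where B = C]) (use C fk_pos[of k] in \<open>auto simp: less_imp_le\<close>)
    have "(norm (gk k x))\<^sup>2 / fk k x \<le> C\<^sup>2 / (1 / ka k)" for x
      using C(2)[of x] fk_ge[of k x] ka_pos[of k] by (intro frac_le power_mono) auto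
    moreover have "0 \<le> (norm (gk k x))\<^sup>2 / fk k x" for x using fk_pos[of k x] by simp
    ultimately show "integrable gauss (\<lambda>x. (norm (gk k x))\<^sup>2 / fk k x)"
      by (intro gauss.integrable_const_bound[where B = "C\<^sup>2 / (1 / ka k)"] AE_I2)
        (simp only: real_norm_def abs_of_nonneg, measurable)
  qed (use fk_deriv gk_cont fk_pos[of k] fk_ge C ka_pos[of k] in \<open>auto simp: less_imp_le\<close>)
  then show thesis by (rule that)
qed

text \<open>With t the cutoff, |gk| \<le> t^2 |g| + 4 f t gives |gk|^2 \<le> 2 t^4 |g|^2 + 32 t^2
  f^2. Dividing by t^2 f and using t \<le> 1 gives \<open>W\<close>.\<close>

definition W :: "real^'n \<Rightarrow> real" where "W x = 2 * ((norm (g x))\<^sup>2 / f x) + 32 * f x"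

lemma W_int: "integrable gauss W"
  unfolding W_def using fisher f_int by (intro Bochner_Integration.integrable_add integrable_mult_right) auto

lemma gk_bound: "norm (gk k x) \<le> (tk k x)\<^sup>2 * norm (g x) + 4 * f x * tk k x"
proof -
  have "tk k x * norm x \<le> tk k x * ka k"
  proof (cases "ka k \<le> norm x")
    case False
    then show ?thesis using tk_bounds by (intro mult_left_mono) auto
  qed (simp add: tk_zero)
  then have "tk k x * norm x / (ka k)\<^sup>2 \<le> tk k x * ka k / (ka k)\<^sup>2"
    by (intro divide_right_mono) auto
  also have "\<dots> = tk k x / ka k" using ka_pos[of k] by (simp add: power2_eq_square)
  also have "\<dots> \<le> tk k x" using ka_ge[of k] tk_bounds[of k x] ka_pos[of k] by (simp add: divide_le_eq mult_left_le mult_le_cancel_left1)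
  finally have "f x * (4 * (tk k x * norm x / (ka k)\<^sup>2)) \<le> f x * (4 * tk k x)"
    using f_nonneg by (intro mult_left_mono) auto
  moreover have "norm (gk k x) \<le> norm ((tk k x)\<^sup>2 *\<^sub>R g x) + norm ((f x * (4 * tk k x / (ka k)\<^sup>2)) *\<^sub>R x)"
    unfolding gk_def by (rule norm_triangle_ineq4)
  ultimately show ?thesis
    using tk_bounds(1)[of k x] f_nonneg[of x] by (simp add: abs_mult mult_ac)
qed

lemma gk_quot_le: "(norm (gk k x))\<^sup>2 / fk k x \<le> W x"
proof -
  let ?t = "tk k x"
  have W0: "0 \<le> W x" using f_nonneg by (simp add: W_def)
  have t: "0 \<le> ?t" "?t\<^sup>2 \<le> 1" using tk_bounds by auto
  have "(norm (gk k x))\<^sup>2 \<le> (?t\<^sup>2 * norm (g x) + 4 * f x * ?t)\<^sup>2"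
    by (intro power_mono gk_bound) auto
  also have "\<dots> \<le> 2 * (?t\<^sup>2 * norm (g x))\<^sup>2 + 2 * (4 * f x * ?t)\<^sup>2"
    using sum_squares_bound[of "?t\<^sup>2 * norm (g x)" "4 * f x * ?t"] unfolding power2_sum by linarith
  also have "\<dots> \<le> W x * (?t\<^sup>2 * f x)"
  proof (cases "f x = 0")
    case False
    have "(?t\<^sup>2 * norm (g x))\<^sup>2 \<le> ?t\<^sup>2 * (norm (g x))\<^sup>2"
    proof -
      have "?t\<^sup>2 * ?t\<^sup>2 \<le> ?t\<^sup>2 * 1" using t by (intro mult_left_mono) auto
      then have "(?t\<^sup>2 * ?t\<^sup>2) * (norm (g x))\<^sup>2 \<le> (?t\<^sup>2 * 1) * (norm (g x))\<^sup>2"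
        by (rule mult_right_mono) simp
      then show ?thesis by (simp only: power_mult_distrib power2_eq_square[of "?t\<^sup>2"] mult_1_right)
    qed
    moreover have "W x * (?t\<^sup>2 * f x) = 2 * (?t\<^sup>2 * (norm (g x))\<^sup>2) + 2 * (4 * f x * ?t)\<^sup>2"
      using False by (simp add: W_def field_simps power2_eq_square)
    ultimately show ?thesis by linarith
  qed (simp add: g_zero)
  also have "\<dots> \<le> W x * fk k x"
    using W0 ka_pos[of k] by (intro mult_left_mono) (auto simp: fk_def)
  finally show ?thesis using fk_pos[of k x] by (simp add: divide_le_eq)
qed

lemma gk_norm_le: "norm (gk k x) \<le> norm (g x) + 4 * f x"
proof -
  have "(tk k x)\<^sup>2 * norm (g x) \<le> 1 * norm (g x)" using tk_bounds by (intro mult_right_mono) auto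
  moreover have "4 * f x * tk k x \<le> 4 * f x * 1" using tk_bounds f_nonneg by (intro mult_left_mono) auto
  ultimately show ?thesis using gk_bound[of k x] by simp
qed

lemma ka_inverse_lim: "(\<lambda>k. 1 / ka k) \<longlonglongrightarrow> 0" "(\<lambda>k. 1 / (ka k)\<^sup>2) \<longlonglongrightarrow> 0"
  unfolding ka_def by real_asymp+

lemma tk_lim: "(\<lambda>k. tk k x) \<longlonglongrightarrow> 1"
proof -
  have "(\<lambda>k. max 0 (1 - (norm x)\<^sup>2 * (1 / (ka k)\<^sup>2))) \<longlonglongrightarrow> max 0 (1 - (norm x)\<^sup>2 * 0)"
    by (intro tendsto_intros ka_inverse_lim)
  then show ?thesis by (simp add: tk_def)
qed

lemma fk_lim: "(\<lambda>k. fk k x) \<longlonglongrightarrow> f x"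
proof -
  have "(\<lambda>k. fk k x) \<longlonglongrightarrow> 1\<^sup>2 * f x + 0"
    unfolding fk_def by (intro tendsto_intros ka_inverse_lim tk_lim)
  then show ?thesis by simp
qed

lemma gk_lim: "(\<lambda>k. gk k x) \<longlonglongrightarrow> g x"
proof -
  have "(\<lambda>k. (tk k x)\<^sup>2 *\<^sub>R g x - (f x * (4 * tk k x * (1 / (ka k)\<^sup>2))) *\<^sub>R x) \<longlonglongrightarrow> 1\<^sup>2 *\<^sub>R g x - (f x * (4 * 1 * 0)) *\<^sub>R x"
    by (intro tendsto_intros ka_inverse_lim tk_lim)
  then show ?thesis by (simp add: gk_def)
qed

text \<open>At a zero of \<open>f\<close> the truncation equals \<open>1 / ka k\<close>, and u ln u
  tends to 0 with u, in agreement with the value 0 * ln 0 = 0.\<close>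

lemma fk_entropy_lim: "(\<lambda>k. fk k x * ln (fk k x)) \<longlonglongrightarrow> f x * ln (f x)"
proof (cases "f x = 0")
  case True
  have "(\<lambda>k. 1 / real (Suc k) * ln (1 / real (Suc k))) \<longlonglongrightarrow> 0" by real_asymp
  with True show ?thesis by (simp add: fk_def ka_def)
next
  case False
  then show ?thesis by (intro tendsto_intros fk_lim)
qed

lemma info_approx_le:
  assumes a: "0 \<le> a" "a \<le> 1"
  shows "info (fk k) (gk k) a \<le> (\<integral>x. W x \<partial>gauss)" "0 \<le> info (fk k) (gk k) a"
proof -
  obtain C where C: "c1_nice (fk k) (gk k) (1 / ka k) C" by (rule c1_nice_approx)
  then interpret N: c1_nice "fk k" "gk k" "1 / ka k" C .
  have "info (fk k) (gk k) a \<le> info (fk k) (gk k) 1" by (rule wpair_mehler(2)[OF N.wpair_g a])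
  also have "\<dots> \<le> (\<integral>x. W x \<partial>gauss)"
    unfolding info_one by (intro integral_mono N.fisher W_int gk_quot_le)
  finally show "info (fk k) (gk k) a \<le> (\<integral>x. W x \<partial>gauss)" .
  show "0 \<le> info (fk k) (gk k) a" by (rule wpair_mehler(3)[OF N.wpair_g a])
qed

lemma info_approx_lim:
  assumes a: "0 \<le> a" "a \<le> 1"
  shows "(\<lambda>k. info (fk k) (gk k) a) \<longlonglongrightarrow> info f g a"
  unfolding info_def
proof (rule integral_dominated_convergence)
  note [measurable] = borel_measurable_integrable[OF W_int, simplified]
  show "integrable gauss (mehler a W)" by (rule integrable_mehler[OF a W_int])
  show "AE x in gauss. (\<lambda>k. (norm (mehler a (gk k) x))\<^sup>2 / mehler a (fk k) x) \<longlonglongrightarrow> (norm (mehler a g x))\<^sup>2 / mehler a f x"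
    using AE_integrable_mehler[OF a f_int] AE_integrable_mehler[OF a g_int]
  proof eventually_elim
    case (elim x)
    have 1: "(\<lambda>k. mehler a (fk k) x) \<longlonglongrightarrow> mehler a f x"
      unfolding mehler_def
    proof (rule integral_dominated_convergence)
      show "integrable gauss (\<lambda>y. f (a *\<^sub>R x + co a *\<^sub>R y) + 1)" using elim by simp
      show "AE y in gauss. norm (fk k (a *\<^sub>R x + co a *\<^sub>R y)) \<le> f (a *\<^sub>R x + co a *\<^sub>R y) + 1" for k
        using fk_le fk_pos by (auto simp: less_imp_le)
    qed (use fk_lim in auto)
    have 2: "(\<lambda>k. mehler a (gk k) x) \<longlonglongrightarrow> mehler a g x"
      unfolding mehler_def
    proof (rule integral_dominated_convergence)
      show "integrable gauss (\<lambda>y. norm (g (a *\<^sub>R x + co a *\<^sub>R y)) + 4 * f (a *\<^sub>R x + co a *\<^sub>R y))" using elim by simp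
      show "AE y in gauss. norm (gk k (a *\<^sub>R x + co a *\<^sub>R y)) \<le> norm (g (a *\<^sub>R x + co a *\<^sub>R y)) + 4 * f (a *\<^sub>R x + co a *\<^sub>R y)" for k
        using gk_norm_le by auto
    qed (use gk_lim in auto)
    show ?case
    \<comment> \<open>Continuity of division fails in this case, but \<open>f\<close> and hence
      \<open>gk k\<close> vanish along the kernel, so all numerators are exactly 0.\<close>
    proof (cases "mehler a f x = 0")
      case True
      have "AE y in gauss. f (a *\<^sub>R x + co a *\<^sub>R y) = 0"
        using True elim(1) f_nonneg unfolding mehler_def
        by (subst (asm) integral_nonneg_eq_0_iff_AE) auto
      then have "AE y in gauss. gk k (a *\<^sub>R x + co a *\<^sub>R y) = 0" for k
        by eventually_elim (simp add: gk_def g_zero)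
      then have "mehler a (gk k) x = 0" for k unfolding mehler_def by (rule integral_eq_zero_AE)
      with True show ?thesis by simp
    next
      case False
      then show ?thesis by (intro tendsto_intros 1 2)
    qed
  qed
  show "AE x in gauss. norm ((norm (mehler a (gk k) x))\<^sup>2 / mehler a (fk k) x) \<le> mehler a W x" for k
  proof -
    obtain C where C: "c1_nice (fk k) (gk k) (1 / ka k) C" by (rule c1_nice_approx)
    then interpret N: c1_nice "fk k" "gk k" "1 / ka k" C .
    show ?thesis
      using wpair_mehler_aux[OF N.wpair_g a] AE_integrable_mehler[OF a N.fisher] AE_integrable_mehler[OF a W_int]
    proof eventually_elim
      case (elim x)
      have "mehler a (\<lambda>x. (norm (gk k x))\<^sup>2 / fk k x) x \<le> mehler a W x"
        unfolding mehler_def using elim by (intro integral_mono gk_quot_le) auto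
      moreover have "0 \<le> mehler a (fk k) x" by (rule mehler_nonneg[OF N.f_nonneg])
      ultimately show ?case using elim by simp
    qed
  qed
qed measurable

text \<open>Integrability in r is inherited from the truncations, where it comes from de Bruijn's
  identity, by dominated convergence with the constant majorant \<integral> W.\<close>

lemma info_integrable_on: "(\<lambda>r. info f g (sqrt r)) integrable_on {0..1}"
  and info_approx_integral_lim: "(\<lambda>k. integral {0..1} (\<lambda>r. info (fk k) (gk k) (sqrt r))) \<longlonglongrightarrow> integral {0..1} (\<lambda>r. info f g (sqrt r))"
proof -
  have 1: "(\<lambda>r. info (fk k) (gk k) (sqrt r)) integrable_on {0..1}" for k
  proof -
    obtain C where C: "c1_nice (fk k) (gk k) (1 / ka k) C" by (rule c1_nice_approx)
    then interpret N: c1_nice "fk k" "gk k" "1 / ka k" C .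
    have "(\<lambda>r. 2 * (info (fk k) (gk k) (sqrt r) / 2)) integrable_on {0..1}"
      using N.de_bruijn by (intro integrable_on_mult_right) (auto intro: has_integral_integrable)
    then show ?thesis by simp
  qed
  have 2: "(\<lambda>_::real. \<integral>x. W x \<partial>gauss) integrable_on {0..1}" by (rule integrable_const_ivl)
  have 3: "norm (info (fk k) (gk k) (sqrt r)) \<le> (\<integral>x. W x \<partial>gauss)" if "r \<in> {0..1}" for k r
    using info_approx_le[of "sqrt r" k] that by simp
  have 4: "(\<lambda>k. info (fk k) (gk k) (sqrt r)) \<longlonglongrightarrow> info f g (sqrt r)" if "r \<in> {0..1}" for r
    using info_approx_lim[of "sqrt r"] that by simp
  show "(\<lambda>r. info f g (sqrt r)) integrable_on {0..1}"
    by (rule dominated_convergence(1)[OF 1 2 3 4])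
  show "(\<lambda>k. integral {0..1} (\<lambda>r. info (fk k) (gk k) (sqrt r))) \<longlonglongrightarrow> integral {0..1} (\<lambda>r. info f g (sqrt r))"
    by (rule dominated_convergence(2)[OF 1 2 3 4])
qed

text \<open>The informations converge by domination, the entropies only through Fatou applied to u
  ln u + 1. This gives the upper bound on the entropy and also shows that finite Fisher information
  makes it finite.\<close>

lemma entropy_le_integral_info:
  assumes mass: "(\<integral>x. f x \<partial>gauss) = 1"
  shows "integrable gauss (\<lambda>x. f x * ln (f x))"
    and "(\<integral>x. f x * ln (f x) \<partial>gauss) \<le> integral {0..1} (\<lambda>r. info f g (sqrt r)) / 2"
proof -
  let ?h = "\<lambda>u::real. u * ln u"
  let ?J = "\<lambda>k. integral {0..1} (\<lambda>r. info (fk k) (gk k) (sqrt r))"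
  let ?Jf = "integral {0..1} (\<lambda>r. info f g (sqrt r))"
  define mk where "mk k = (\<integral>x. fk k x \<partial>gauss)" for k
  have e: "integrable gauss (\<lambda>x. ?h (fk k x))" "(\<integral>x. ?h (fk k x) \<partial>gauss) = ?h (mk k) + ?J k / 2" for k
  proof -
    obtain C where C: "c1_nice (fk k) (gk k) (1 / ka k) C" by (rule c1_nice_approx)
    then interpret N: c1_nice "fk k" "gk k" "1 / ka k" C .
    show "integrable gauss (\<lambda>x. ?h (fk k x))"
      using N.Hr_int[of 1] by (simp add: N.Fr_def)
    have "integral {0..1} (\<lambda>r. info (fk k) (gk k) (sqrt r) / 2) = (\<integral>x. ?h (fk k x) \<partial>gauss) - ?h (mk k)"
      using N.de_bruijn unfolding mk_def by (rule integral_unique)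
    then show "(\<integral>x. ?h (fk k x) \<partial>gauss) = ?h (mk k) + ?J k / 2" by (simp add: field_simps)
  qed
  have "mk \<longlonglongrightarrow> (\<integral>x. f x \<partial>gauss)"
    unfolding mk_def
  proof (rule integral_dominated_convergence)
    show "integrable gauss (\<lambda>x. f x + 1)" using f_int by simp
    show "AE x in gauss. norm (fk k x) \<le> f x + 1" for k
      using fk_le fk_pos by (auto simp: less_imp_le)
  qed (use fk_lim in auto)
  \<comment> \<open>The masses of the truncations tend to 1, so their correction terms disappear in
    the limit.\<close>
  then have l1: "(\<lambda>k. ?h (mk k)) \<longlonglongrightarrow> 1 * ln 1" unfolding mass by (intro tendsto_intros) auto
  have l2: "(\<lambda>k. ?J k / 2) \<longlonglongrightarrow> ?Jf / 2"
    by (intro tendsto_divide info_approx_integral_lim tendsto_const) simp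
  have lim: "(\<lambda>k. ?h (mk k) + ?J k / 2 + 1) \<longlonglongrightarrow> ?Jf / 2 + 1"
    using tendsto_add[OF tendsto_add[OF l1 l2] tendsto_const[of 1]] by simp
  have nn: "0 \<le> ?h (fk k x) + 1" "0 \<le> ?h (f x) + 1" for k x
    using mult_ln_ge[of "fk k x"] mult_ln_ge[of "f x"] fk_pos[of k x] f_nonneg[of x] by auto
  have "(\<integral>\<^sup>+x. ennreal (?h (f x) + 1) \<partial>gauss) = (\<integral>\<^sup>+x. liminf (\<lambda>k. ennreal (?h (fk k x) + 1)) \<partial>gauss)"
  proof (rule nn_integral_cong)
    fix x
    have "(\<lambda>k. ennreal (?h (fk k x) + 1)) \<longlonglongrightarrow> ennreal (?h (f x) + 1)"
      by (intro tendsto_ennrealI tendsto_intros fk_entropy_lim)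
    then show "ennreal (?h (f x) + 1) = liminf (\<lambda>k. ennreal (?h (fk k x) + 1))"
      by (intro lim_imp_Liminf[symmetric]) auto
  qed
  also have "\<dots> \<le> liminf (\<lambda>k. \<integral>\<^sup>+x. ennreal (?h (fk k x) + 1) \<partial>gauss)"
    by (rule nn_integral_liminf) measurable
  also have "(\<lambda>k. \<integral>\<^sup>+x. ennreal (?h (fk k x) + 1) \<partial>gauss) = (\<lambda>k. ennreal (?h (mk k) + ?J k / 2 + 1))"
  proof
    fix k
    have "(\<integral>\<^sup>+x. ennreal (?h (fk k x) + 1) \<partial>gauss) = ennreal (\<integral>x. ?h (fk k x) + 1 \<partial>gauss)"
      using e(1)[of k] nn by (intro nn_integral_eq_integral) auto
    then show "(\<integral>\<^sup>+x. ennreal (?h (fk k x) + 1) \<partial>gauss) = ennreal (?h (mk k) + ?J k / 2 + 1)"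
      using e[of k] by simp
  qed
  also have "liminf (\<lambda>k. ennreal (?h (mk k) + ?J k / 2 + 1)) = ennreal (?Jf / 2 + 1)"
    using lim by (intro lim_imp_Liminf tendsto_ennrealI) auto
  finally have fin: "(\<integral>\<^sup>+x. ennreal (?h (f x) + 1) \<partial>gauss) \<le> ennreal (?Jf / 2 + 1)" .
  then have i: "integrable gauss (\<lambda>x. ?h (f x) + 1)"
    using nn by (intro integrableI_nonneg) (auto simp: top.not_eq_extremum[symmetric] top_unique)
  from Bochner_Integration.integrable_diff[OF this, of "\<lambda>_. 1"]
  show i': "integrable gauss (\<lambda>x. ?h (f x))" by simp
  have J0: "0 \<le> ?Jf"
  proof (rule integral_nonneg[OF info_integrable_on])
    fix r :: real assume "r \<in> {0..1}"
    then show "0 \<le> info f g (sqrt r)" by (intro wpair_mehler(3)[OF wpair_g]) auto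
  qed
  have "ennreal (\<integral>x. ?h (f x) + 1 \<partial>gauss) \<le> ennreal (?Jf / 2 + 1)"
    using fin nn_integral_eq_integral[OF i] nn by simp
  then have "(\<integral>x. ?h (f x) + 1 \<partial>gauss) \<le> ?Jf / 2 + 1"
    using J0 by (subst (asm) ennreal_le_iff) auto
  then show "(\<integral>x. ?h (f x) \<partial>gauss) \<le> ?Jf / 2" using i' by simp
qed

end

section \<open>The deficit bound and the pairing with test functions\<close>

context c1_prob_dir
begin

text \<open>Mehler operators commute with the orthogonal projection onto \<alpha>, so Pythagoras
  applies pointwise to the evolved gradient.\<close>

lemma info_split:
  assumes a: "0 \<le> a" "a \<le> 1"
  shows "info f g a = info f ga a + info f (\<lambda>x. g x - (g x \<bullet> \<alpha>) *\<^sub>R \<alpha>) a"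
proof -
  let ?gp = "\<lambda>x. g x - (g x \<bullet> \<alpha>) *\<^sub>R \<alpha>"
  have w: "wpair f ?gp"
    by (rule wpair_bounded_linear)
      (intro bounded_linear_sub bounded_linear_ident bounded_linear_scaleR_const bounded_linear_inner_left)
  note wa = wpair_mehler(1)[OF wpair_ga a] and wp = wpair_mehler(1)[OF w a] and wg = wpair_mehler(1)[OF wpair_g a]
  have ae: "AE x in gauss. (norm (mehler a g x))\<^sup>2 / mehler a f x
      = (norm (mehler a ga x))\<^sup>2 / mehler a f x + (norm (mehler a ?gp x))\<^sup>2 / mehler a f x"
    using AE_integrable_mehler[OF a g_int]
  proof eventually_elim
    case (elim x)
    have 1: "mehler a ga x = mehler a g x \<bullet> \<alpha>"
      using elim by (simp add: mehler_def ga_def)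
    have 2: "mehler a ?gp x = mehler a g x - (mehler a g x \<bullet> \<alpha>) *\<^sub>R \<alpha>"
      using elim by (simp add: mehler_def)
    have "\<alpha> \<bullet> \<alpha> = 1" using unit by (simp flip: power2_norm_eq_inner)
    then have "(norm v)\<^sup>2 = (norm (v \<bullet> \<alpha>))\<^sup>2 + (norm (v - (v \<bullet> \<alpha>) *\<^sub>R \<alpha>))\<^sup>2" for v
      unfolding power2_norm_eq_inner
      by (simp add: inner_diff_left inner_diff_right inner_commute power2_eq_square)
    from this[of "mehler a g x"] show ?case
      by (simp only: 1 2 add_divide_distrib)
  qed
  note [measurable] = wpairD(3,4)[OF wa] wpairD(4)[OF wp] wpairD(4)[OF wg]
  have "info f g a = (\<integral>x. (norm (mehler a ga x))\<^sup>2 / mehler a f x + (norm (mehler a ?gp x))\<^sup>2 / mehler a f x \<partial>gauss)"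
    unfolding info_def by (rule integral_cong_AE[OF _ _ ae]) measurable
  also have "\<dots> = info f ga a + info f ?gp a"
    unfolding info_def by (rule Bochner_Integration.integral_add[OF wpairD(6)[OF wa] wpairD(6)[OF wp]])
  finally show ?thesis .
qed

text \<open>The part orthogonal to \<alpha> also decreases along the flow, so discarding its drop
  preserves the inequality.\<close>

lemma info_drop_ge:
  assumes a: "0 \<le> a" "a \<le> 1"
  shows "info f ga 1 - info f ga a \<le> info f g 1 - info f g a"
proof -
  have "wpair f (\<lambda>x. g x - (g x \<bullet> \<alpha>) *\<^sub>R \<alpha>)"
    by (rule wpair_bounded_linear)
      (intro bounded_linear_sub bounded_linear_ident bounded_linear_scaleR_const bounded_linear_inner_left)
  from wpair_mehler(2)[OF this a] show ?thesis
    by (simp add: info_split[OF a] info_split[of 1])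
qed

text \<open>The variable \<open>\<rho>\<close> is \<open>exp (- 2 t)\<close>; clamping makes \<open>J\<close> monotone on the whole line.\<close>

definition J :: "real \<Rightarrow> real" where
  "J \<rho> = info f ga (sqrt (max 0 (min 1 \<rho>)))"

lemma J_eq: "0 \<le> \<rho> \<Longrightarrow> \<rho> \<le> 1 \<Longrightarrow> J \<rho> = info f ga (sqrt \<rho>)"
  by (simp add: J_def)

lemma J_mono: "mono J"
proof (rule monoI)
  fix x y :: real assume "x \<le> y"
  then show "J x \<le> J y" unfolding J_def
    by (intro info_mono[OF wpair_ga]) auto
qed

lemma J_meas [measurable]: "J \<in> borel_measurable borel"
  by (rule borel_measurable_mono[OF J_mono])

lemma J_nonneg: "0 \<le> J \<rho>"
  unfolding J_def by (rule wpair_mehler(3)[OF wpair_ga]) auto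

lemma J_le: "J \<rho> \<le> J 1"
proof -
  have "J \<rho> = J (max 0 (min 1 \<rho>))" by (simp add: J_def)
  also have "\<dots> \<le> J 1" by (rule monoD[OF J_mono]) simp
  finally show ?thesis .
qed

lemma J_step:
  assumes "0 \<le> x" "x \<le> y" "y \<le> 1"
  shows "J x + (y - x) * (cc - J x)\<^sup>2 * (1 - (y - x) * cc) \<le> J y"
proof (cases "y = 0")
  case False
  then have y: "0 < y" using assms by simp
  \<comment> \<open>Since \<rho> is the square of the Mehler parameter, \<open>?r * ?a\<close> is
    the square root of x and (1 - r^2) a^2 = y - x.\<close>
  let ?a = "sqrt y" and ?r = "sqrt (x / y)"
  have ar: "0 \<le> ?a" "?a \<le> 1" "0 \<le> ?r" "?r \<le> 1" using assms y by auto
  have ra: "?r * ?a = sqrt x" using assms y by (simp flip: real_sqrt_mult)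
  have r2: "(1 - ?r\<^sup>2) * ?a\<^sup>2 = y - x" using assms y by (simp add: field_simps)
  show ?thesis
    using info_step[OF ar] assms unfolding ra r2 by (simp add: J_eq)
qed (use assms in simp)

text \<open>By the entropy bound the right-hand side is at least \<integral> (I(1) - I(r)) dr, hence
  at least \<integral> (J(1) - J(r)) dr, to which \<open>riccati_integral\<close> applies.\<close>

lemma deficit_ge:
  "integral {0..1} (\<lambda>\<rho>. \<rho> * (J \<rho> - cc)\<^sup>2) \<le> info f g 1 - 2 * (\<integral>x. f x * ln (f x) \<partial>gauss)"
proof -
  have iJ: "J integrable_on {0..1}"
    by (rule bounded_measurable_integrable_on(2)[where K = "J 1"]) (use J_nonneg J_le in auto)
  have "integral {0..1} (\<lambda>r. info f g (sqrt r)) \<le> integral {0..1} (\<lambda>r. info f g 1 - J 1 + J r)"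
  proof (rule integral_le[OF info_integrable_on])
    show "(\<lambda>r. info f g 1 - J 1 + J r) integrable_on {0..1}"
      by (intro integrable_add iJ integrable_const_ivl)
    fix r :: real assume "r \<in> {0..1}"
    then show "info f g (sqrt r) \<le> info f g 1 - J 1 + J r"
      using info_drop_ge[of "sqrt r"] by (simp add: J_eq)
  qed
  also have "\<dots> = info f g 1 - J 1 + integral {0..1} J"
    using iJ by (subst integral_add) auto
  finally show ?thesis
    using riccati_integral[OF J_mono J_step] entropy_le_integral_info(2)[OF mass] by simp
qed

end

section \<open>Pairing with admissible test functions\<close>

interpretation lborel_gauss: pair_sigma_finite "lborel :: real measure" "gauss :: (real^'n) measure" ..

lemma exp_co: "0 \<le> t \<Longrightarrow> co (exp (- t)) = sqrt (1 - exp (- 2 * t))"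
  by (simp flip: exp_double)

lemma OU_eq_mehler: "OU t g x = mehler (exp (- t)) g x"
  by (simp add: OU_def mehler_def flip: exp_double)

locale test_function = c1_prob_dir f g \<alpha> for f :: "real^'n \<Rightarrow> real" and g \<alpha> +
  fixes \<psi> :: "real^'n \<Rightarrow> real" and \<epsilon> :: real
  assumes \<psi>_cont: "continuous_on UNIV \<psi>"
    and admissible: "\<And>t. 0 \<le> t \<Longrightarrow> (\<integral>\<^sup>+x. ennreal ((\<psi> x)\<^sup>2) * OU_nn t f x \<partial>gauss) \<le> 1"
    and eps: "0 < \<epsilon>" "\<epsilon> \<le> 1"
begin

lemma \<psi>_meas [measurable]: "\<psi> \<in> borel_measurable borel"
  by (rule borel_measurable_continuous_onI[OF \<psi>_cont])

text \<open>Integrating out the second variable gives psi^2 P_t f, so admissibility bounds the total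
  mass by 1. On the product space, Cauchy--Schwarz can be applied before any averaging.\<close>

definition q :: "real \<Rightarrow> (real^'n) \<times> (real^'n) \<Rightarrow> real" where
  "q t p = (\<psi> (fst p))\<^sup>2 * f (exp (- t) *\<^sub>R fst p + co (exp (- t)) *\<^sub>R snd p)"

lemma q_int:
  assumes t: "0 \<le> t"
  shows "integrable (gauss \<Otimes>\<^sub>M gauss) (q t)" and "(\<integral>p. q t p \<partial>(gauss \<Otimes>\<^sub>M gauss)) \<le> 1"
proof -
  have [measurable]: "q t \<in> borel_measurable (borel \<Otimes>\<^sub>M borel)"
    unfolding q_def[abs_def] by measurable
  have nn: "0 \<le> q t p" for p using f_nonneg by (simp add: q_def)
  have "(\<integral>\<^sup>+p. ennreal (q t p) \<partial>(gauss \<Otimes>\<^sub>M gauss)) = (\<integral>\<^sup>+x. (\<integral>\<^sup>+y. ennreal (q t (x, y)) \<partial>gauss) \<partial>gauss)"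
    by (rule gauss.nn_integral_fst[symmetric]) measurable
  also have "\<dots> = (\<integral>\<^sup>+x. ennreal ((\<psi> x)\<^sup>2) * OU_nn t f x \<partial>gauss)"
  proof (rule nn_integral_cong)
    fix x
    have "(\<integral>\<^sup>+y. ennreal (q t (x, y)) \<partial>gauss)
       = (\<integral>\<^sup>+y. ennreal ((\<psi> x)\<^sup>2) * ennreal (f (exp (- t) *\<^sub>R x + co (exp (- t)) *\<^sub>R y)) \<partial>gauss)"
      using f_nonneg by (simp add: q_def ennreal_mult)
    also have "\<dots> = ennreal ((\<psi> x)\<^sup>2) * OU_nn t f x"
      unfolding OU_nn_def exp_co[OF t] by (rule nn_integral_cmult) measurable
    finally show "(\<integral>\<^sup>+y. ennreal (q t (x, y)) \<partial>gauss) = ennreal ((\<psi> x)\<^sup>2) * OU_nn t f x" .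
  qed
  finally have le: "(\<integral>\<^sup>+p. ennreal (q t p) \<partial>(gauss \<Otimes>\<^sub>M gauss)) \<le> 1" using admissible[OF t] by simp
  then show i: "integrable (gauss \<Otimes>\<^sub>M gauss) (q t)"
    using nn by (intro integrableI_nonneg) (auto simp: less_top[symmetric] top_unique)
  have "ennreal (\<integral>p. q t p \<partial>(gauss \<Otimes>\<^sub>M gauss)) \<le> ennreal 1"
    using le nn_integral_eq_integral[OF i] nn by simp
  then show "(\<integral>p. q t p \<partial>(gauss \<Otimes>\<^sub>M gauss)) \<le> 1" by (simp add: ennreal_le_iff2)
qed

context
  fixes t :: real
  assumes t: "0 \<le> t"
begin

lemma a_bounds: "0 \<le> exp (- t)" "exp (- t) \<le> 1"
  using t by auto

abbreviation "mix p \<equiv> exp (- t) *\<^sub>R fst p + co (exp (- t)) *\<^sub>R snd p"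

lemma f_mix: "integrable (gauss \<Otimes>\<^sub>M gauss) (\<lambda>p. f (mix p))" "(\<integral>p. f (mix p) \<partial>(gauss \<Otimes>\<^sub>M gauss)) = 1"
  using integrable_rotate_fst[OF co_sq[OF a_bounds] a_bounds(1) f_int]
    integral_rotate_fst[OF co_sq[OF a_bounds] a_bounds(1) f_meas] mass
  by auto

lemma ga_mix:
  "integrable (gauss \<Otimes>\<^sub>M gauss) (\<lambda>p. (ga (mix p))\<^sup>2 / f (mix p))"
  "(\<integral>p. (ga (mix p))\<^sup>2 / f (mix p) \<partial>(gauss \<Otimes>\<^sub>M gauss)) = info f ga 1"
proof -
  have i: "integrable gauss (\<lambda>x. (ga x)\<^sup>2 / f x)" using wpairD(6)[OF wpair_ga] by simp
  show "integrable (gauss \<Otimes>\<^sub>M gauss) (\<lambda>p. (ga (mix p))\<^sup>2 / f (mix p))"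
    using integrable_rotate_fst[OF co_sq[OF a_bounds] a_bounds(1) i] .
  show "(\<integral>p. (ga (mix p))\<^sup>2 / f (mix p) \<partial>(gauss \<Otimes>\<^sub>M gauss)) = info f ga 1"
    using integral_rotate_fst[OF co_sq[OF a_bounds] a_bounds(1), of "\<lambda>x. (ga x)\<^sup>2 / f x"] by (simp add: info_def)
qed

lemma ga_pair_int: "integrable (gauss \<Otimes>\<^sub>M gauss) (\<lambda>p. ga (mix p) * \<psi> (fst p))"
proof (rule integrable_mult_by_quotient[where v = "\<lambda>p. f (mix p)"])
  show "integrable (gauss \<Otimes>\<^sub>M gauss) (\<lambda>p. f (mix p) * (\<psi> (fst p))\<^sup>2)"
    using q_int(1)[OF t] by (simp add: q_def[abs_def] mult.commute)
  show "AE p in gauss \<Otimes>\<^sub>M gauss. 0 \<le> f (mix p) \<and> (f (mix p) = 0 \<longrightarrow> ga (mix p) = 0)"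
    using f_nonneg by (simp add: ga_def g_zero)
qed (use ga_mix in simp_all)

lemma ga_pair_abs: "(\<integral>p. \<bar>ga (mix p) * \<psi> (fst p)\<bar> \<partial>(gauss \<Otimes>\<^sub>M gauss)) \<le> info f ga 1 + 1"
proof -
  have "(\<integral>p. \<bar>ga (mix p) * \<psi> (fst p)\<bar> \<partial>(gauss \<Otimes>\<^sub>M gauss))
      \<le> (\<integral>p. (ga (mix p))\<^sup>2 / f (mix p) + q t p \<partial>(gauss \<Otimes>\<^sub>M gauss))"
  proof (rule integral_mono)
    fix p :: "(real^'n) \<times> (real^'n)"
    show "\<bar>ga (mix p) * \<psi> (fst p)\<bar> \<le> (ga (mix p))\<^sup>2 / f (mix p) + q t p"
      using abs_mult_le_quotient_add[of "f (mix p)" "ga (mix p)" "\<psi> (fst p)"] f_nonneg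
      by (simp add: q_def ga_def g_zero mult.commute)
  qed (use ga_pair_int ga_mix q_int[OF t] in \<open>auto intro: integrable_abs\<close>)
  also have "\<dots> \<le> info f ga 1 + 1" using ga_mix q_int[OF t] by simp
  finally show ?thesis .
qed

lemma f_pair_int: "integrable (gauss \<Otimes>\<^sub>M gauss) (\<lambda>p. f (mix p) * \<psi> (fst p))"
proof (rule integrable_mult_between)
  show "integrable (gauss \<Otimes>\<^sub>M gauss) (\<lambda>p. f (mix p) * (\<psi> (fst p))\<^sup>2)"
    using q_int(1)[OF t] by (simp add: q_def[abs_def] mult.commute)
qed (use f_mix in simp_all)

lemma f_pair_abs: "(\<integral>p. \<bar>f (mix p) * \<psi> (fst p)\<bar> \<partial>(gauss \<Otimes>\<^sub>M gauss)) \<le> 2"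
proof -
  have "(\<integral>p. \<bar>f (mix p) * \<psi> (fst p)\<bar> \<partial>(gauss \<Otimes>\<^sub>M gauss)) \<le> (\<integral>p. f (mix p) + q t p \<partial>(gauss \<Otimes>\<^sub>M gauss))"
  proof (rule integral_mono)
    fix p :: "(real^'n) \<times> (real^'n)"
    have "\<bar>\<psi> (fst p)\<bar> \<le> 1 + (\<psi> (fst p))\<^sup>2"
      using sum_squares_bound[of "\<bar>\<psi> (fst p)\<bar>" 1] by simp
    then have "f (mix p) * \<bar>\<psi> (fst p)\<bar> \<le> f (mix p) * (1 + (\<psi> (fst p))\<^sup>2)"
      by (intro mult_left_mono f_nonneg)
    then show "\<bar>f (mix p) * \<psi> (fst p)\<bar> \<le> f (mix p) + q t p"
      using f_nonneg by (simp add: q_def abs_mult algebra_simps)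
  qed (use f_pair_int f_mix q_int[OF t] in \<open>auto intro: integrable_abs\<close>)
  also have "\<dots> \<le> 2" using f_mix q_int[OF t] by simp
  finally show ?thesis .
qed

text \<open>Reversibility: the reflection exchanges \<open>fst p\<close> and \<open>mix p\<close>.\<close>

lemma OU_pairing:
  fixes h :: "real^'n \<Rightarrow> real"
  assumes h[measurable]: "h \<in> borel_measurable borel" and i: "integrable (gauss \<Otimes>\<^sub>M gauss) (\<lambda>p. h (mix p) * \<psi> (fst p))"
    and ab: "(\<integral>p. \<bar>h (mix p) * \<psi> (fst p)\<bar> \<partial>(gauss \<Otimes>\<^sub>M gauss)) \<le> K"
  shows "integrable gauss (\<lambda>x. OU t \<psi> x * h x)"
    and "(\<integral>x. \<bar>OU t \<psi> x * h x\<bar> \<partial>gauss) \<le> K"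
    and "(\<integral>x. OU t \<psi> x * h x \<partial>gauss) = (\<integral>p. h (mix p) * \<psi> (fst p) \<partial>(gauss \<Otimes>\<^sub>M gauss))"
proof -
  let ?\<gamma> = "gauss \<Otimes>\<^sub>M gauss :: ((real^'n) \<times> (real^'n)) measure"
  let ?R = "reflect2 (exp (- t)) (co (exp (- t))) :: (real^'n) \<times> (real^'n) \<Rightarrow> _"
  have R: "mix (?R p) = fst p" "fst (?R p) = mix p" for p
    using reflect2_reflect2[OF co_sq[OF a_bounds], of p] by (auto simp: reflect2_def prod_eq_iff)
  let ?k = "\<lambda>p. h (fst p) * \<psi> (mix p)"
  have k: "integrable ?\<gamma> ?k"
    using integrable_reflect2[OF co_sq[OF a_bounds] a_bounds(1) i] unfolding R(1) unfolding R(2) .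
  have kint: "(\<integral>p. ?k p \<partial>?\<gamma>) = (\<integral>p. h (mix p) * \<psi> (fst p) \<partial>?\<gamma>)"
    using integral_reflect2[OF co_sq[OF a_bounds] a_bounds(1), of "\<lambda>p. h (mix p) * \<psi> (fst p)"]
    unfolding R(1) unfolding R(2) by simp
  have kabs: "(\<integral>p. \<bar>?k p\<bar> \<partial>?\<gamma>) = (\<integral>p. \<bar>h (mix p) * \<psi> (fst p)\<bar> \<partial>?\<gamma>)"
    using integral_reflect2[OF co_sq[OF a_bounds] a_bounds(1), of "\<lambda>p. \<bar>h (mix p) * \<psi> (fst p)\<bar>"]
    unfolding R(1) unfolding R(2) by simp
  have inner: "(\<integral>y. ?k (x, y) \<partial>gauss) = OU t \<psi> x * h x" for x
    by (simp add: OU_eq_mehler mehler_def)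
  show 1: "integrable gauss (\<lambda>x. OU t \<psi> x * h x)"
    using gauss2.integrable_fst'[OF k] unfolding inner .
  show "(\<integral>x. OU t \<psi> x * h x \<partial>gauss) = (\<integral>p. h (mix p) * \<psi> (fst p) \<partial>?\<gamma>)"
    using gauss2.integral_fst'[OF k] unfolding inner kint .
  have k': "integrable ?\<gamma> (\<lambda>p. \<bar>?k p\<bar>)" using k by (rule integrable_abs)
  have "(\<integral>x. \<bar>OU t \<psi> x * h x\<bar> \<partial>gauss) \<le> (\<integral>x. (\<integral>y. \<bar>?k (x, y)\<bar> \<partial>gauss) \<partial>gauss)"
  proof (rule integral_mono)
    show "integrable gauss (\<lambda>x. \<bar>OU t \<psi> x * h x\<bar>)" using 1 by (rule integrable_abs)
    show "integrable gauss (\<lambda>x. \<integral>y. \<bar>?k (x, y)\<bar> \<partial>gauss)" by (rule gauss2.integrable_fst'[OF k'])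
    show "\<bar>OU t \<psi> x * h x\<bar> \<le> (\<integral>y. \<bar>?k (x, y)\<bar> \<partial>gauss)" for x
      unfolding inner[symmetric] by (rule integral_abs_bound)
  qed
  also have "\<dots> = (\<integral>p. \<bar>?k p\<bar> \<partial>?\<gamma>)" by (rule gauss2.integral_fst'[OF k'])
  finally show "(\<integral>x. \<bar>OU t \<psi> x * h x\<bar> \<partial>gauss) \<le> K" using ab unfolding kabs by simp
qed

text \<open>Cauchy--Schwarz bounds the pairing by the square root of J, and Young's inequality with
  exponents 4/3 and 4 bounds this by the right-hand side, with equality at \<kappa>^2 = J. The
  parameter is free so that one value, independent of \<open>t\<close>, can be chosen after
  integrating; this plays the part of Hoelder's inequality.\<close>

lemma pairing_le:
  assumes \<kappa>: "0 < \<kappa>"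
  shows "(\<integral>x. OU t \<psi> x * ga x \<partial>gauss) \<le> 3 * \<kappa> / 4 + (J (exp (- 2 * t)))\<^sup>2 / (4 * \<kappa> ^ 3)"
proof -
  let ?a = "exp (- t)"
  let ?J = "J (exp (- 2 * t))"
  have J: "info f ga ?a = ?J"
  proof -
    have "exp (- 2 * t) = ?a\<^sup>2" using exp_double[of "- t"] by simp
    then have "sqrt (exp (- 2 * t)) = ?a" by simp
    then show ?thesis using t by (simp add: J_eq)
  qed
  have i1: "integrable gauss (\<lambda>x. mehler ?a ga x * \<psi> x)"
    using gauss2.integrable_fst'[OF ga_pair_int] by (simp add: mehler_def)
  have i2: "integrable gauss (\<lambda>x. (\<psi> x)\<^sup>2 * mehler ?a f x)"
    using gauss2.integrable_fst'[OF q_int(1)[OF t]] by (simp add: mehler_def q_def)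
  have e2: "(\<integral>x. (\<psi> x)\<^sup>2 * mehler ?a f x \<partial>gauss) \<le> 1"
  proof -
    have "(\<integral>x. (\<psi> x)\<^sup>2 * mehler ?a f x \<partial>gauss) = (\<integral>p. q t p \<partial>(gauss \<Otimes>\<^sub>M gauss))"
      using gauss2.integral_fst'[OF q_int(1)[OF t]] by (simp add: mehler_def q_def[abs_def])
    then show ?thesis using q_int(2)[OF t] by simp
  qed
  note w = wpair_mehler(1)[OF wpair_ga a_bounds]
  have i3: "integrable gauss (\<lambda>x. (mehler ?a ga x)\<^sup>2 / mehler ?a f x)" using wpairD(6)[OF w] by simp
  have e3: "(\<integral>x. (mehler ?a ga x)\<^sup>2 / mehler ?a f x \<partial>gauss) = ?J" using J by (simp add: info_def)
  have "(\<integral>x. mehler ?a ga x * \<psi> x \<partial>gauss)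
      \<le> (\<integral>x. (\<kappa> / 2) * ((\<psi> x)\<^sup>2 * mehler ?a f x) + (1 / (2 * \<kappa>)) * ((mehler ?a ga x)\<^sup>2 / mehler ?a f x) \<partial>gauss)"
  proof (rule integral_mono_AE[OF i1])
    show "integrable gauss (\<lambda>x. (\<kappa> / 2) * ((\<psi> x)\<^sup>2 * mehler ?a f x) + (1 / (2 * \<kappa>)) * ((mehler ?a ga x)\<^sup>2 / mehler ?a f x))"
      by (intro Bochner_Integration.integrable_add integrable_mult_right i2 i3)
    show "AE x in gauss. mehler ?a ga x * \<psi> x
        \<le> (\<kappa> / 2) * ((\<psi> x)\<^sup>2 * mehler ?a f x) + (1 / (2 * \<kappa>)) * ((mehler ?a ga x)\<^sup>2 / mehler ?a f x)"
      using wpairD(5)[OF w]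
    proof eventually_elim
      case (elim x)
      have "2 * mehler ?a ga x * (\<kappa> * \<psi> x) - mehler ?a f x * (\<kappa> * \<psi> x)\<^sup>2 \<le> (mehler ?a ga x)\<^sup>2 / mehler ?a f x"
        by (rule mult_le_quotient_add) (use elim wpairD(1)[OF w] in auto)
      then have "(1 / (2 * \<kappa>)) * (2 * mehler ?a ga x * (\<kappa> * \<psi> x) - mehler ?a f x * (\<kappa> * \<psi> x)\<^sup>2)
         \<le> (1 / (2 * \<kappa>)) * ((mehler ?a ga x)\<^sup>2 / mehler ?a f x)"
        using \<kappa> by (intro mult_left_mono) auto
      moreover have "(1 / (2 * \<kappa>)) * (2 * mehler ?a ga x * (\<kappa> * \<psi> x) - mehler ?a f x * (\<kappa> * \<psi> x)\<^sup>2)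
         = mehler ?a ga x * \<psi> x - (\<kappa> / 2) * ((\<psi> x)\<^sup>2 * mehler ?a f x)"
        using \<kappa> by (simp add: field_simps power2_eq_square)
      ultimately show ?case by linarith
    qed
  qed
  also have "\<dots> = (\<kappa> / 2) * (\<integral>x. (\<psi> x)\<^sup>2 * mehler ?a f x \<partial>gauss) + (1 / (2 * \<kappa>)) * ?J"
    unfolding e3[symmetric] using i2 i3
    by (subst Bochner_Integration.integral_add) (auto simp del: times_divide_eq_left times_divide_eq_right)
  also have "\<dots> \<le> (\<kappa> / 2) * 1 + (1 / (2 * \<kappa>)) * ?J"
    using e2 \<kappa> by (intro add_right_mono mult_left_mono) auto
  also have "\<dots> \<le> 3 * \<kappa> / 4 + ?J\<^sup>2 / (4 * \<kappa> ^ 3)"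
  proof -
    have "0 \<le> (\<kappa>\<^sup>2 - ?J)\<^sup>2 / (4 * \<kappa> ^ 3)" using \<kappa> by simp
    also have "\<dots> = 3 * \<kappa> / 4 + ?J\<^sup>2 / (4 * \<kappa> ^ 3) - ((\<kappa> / 2) * 1 + (1 / (2 * \<kappa>)) * ?J)"
      using \<kappa> by (simp add: field_simps power2_eq_square power3_eq_cube)
    finally show ?thesis by simp
  qed
  finally have "(\<integral>x. mehler ?a ga x * \<psi> x \<partial>gauss) \<le> 3 * \<kappa> / 4 + ?J\<^sup>2 / (4 * \<kappa> ^ 3)" .
  moreover have "(\<integral>x. OU t \<psi> x * ga x \<partial>gauss) = (\<integral>p. ga (mix p) * \<psi> (fst p) \<partial>(gauss \<Otimes>\<^sub>M gauss))"
    by (rule OU_pairing(3)[OF ga_meas ga_pair_int ga_pair_abs])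
  moreover have "(\<integral>p. ga (mix p) * \<psi> (fst p) \<partial>(gauss \<Otimes>\<^sub>M gauss)) = (\<integral>x. mehler ?a ga x * \<psi> x \<partial>gauss)"
    using gauss2.integral_fst'[OF ga_pair_int] by (simp add: mehler_def)
  ultimately show ?thesis by simp
qed

end

end

lemma exp_tail_integral:
  fixes s :: real
  shows "integrable lborel (\<lambda>t. indicator {s..} t * exp (- 4 * t))"
    and "(\<integral>t. indicator {s..} t * exp (- 4 * t) \<partial>lborel) = exp (- 4 * s) / 4"
proof -
  have "(\<integral>\<^sup>+t. ennreal (exp (- 4 * t)) * indicator {s..} t \<partial>lborel) = ennreal (0 - (- exp (- 4 * s) / 4))"
  proof (rule nn_integral_FTC_atLeast)
    show "((\<lambda>t. - exp (- 4 * t) / 4) has_real_derivative exp (- 4 * t)) (at t)" for t :: real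
      by (auto intro!: derivative_eq_intros)
    show "((\<lambda>t::real. - exp (- 4 * t) / 4) \<longlongrightarrow> 0) at_top" by real_asymp
  qed auto
  then have "(\<integral>\<^sup>+t. ennreal (indicator {s..} t * exp (- 4 * t)) \<partial>lborel) = ennreal (exp (- 4 * s) / 4)"
    by (simp add: mult.commute flip: ennreal_indicator ennreal_mult')
  then have "has_bochner_integral lborel (\<lambda>t. indicator {s..} t * exp (- 4 * t)) (exp (- 4 * s) / 4)"
    by (intro has_bochner_integral_nn_integral) auto
  then show "integrable lborel (\<lambda>t. indicator {s..} t * exp (- 4 * t))"
    and "(\<integral>t. indicator {s..} t * exp (- 4 * t) \<partial>lborel) = exp (- 4 * s) / 4"
    by (auto simp: has_bochner_integral_iff)
qed

lemma grad_has_derivative: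
  fixes F :: "real^'n \<Rightarrow> real"
  assumes "F differentiable (at x)"
  shows "(F has_derivative (\<lambda>h. grad F x \<bullet> h)) (at x)"
proof -
  let ?D = "frechet_derivative F (at x)"
  have D: "(F has_derivative ?D) (at x)" using assms by (simp add: frechet_derivative_works)
  then have lin: "linear ?D" by (rule has_derivative_linear)
  have "?D h = grad F x \<bullet> h" for h
  proof -
    have "?D h = ?D (\<Sum>i\<in>UNIV. h $ i *\<^sub>R axis i 1)"
      using basis_expansion[of h] by (simp add: scalar_mult_eq_scaleR)
    also have "\<dots> = (\<Sum>i\<in>UNIV. h $ i * ?D (axis i 1))"
      using lin by (simp add: linear_sum linear_cmul)
    also have "\<dots> = grad F x \<bullet> h"
      by (simp add: inner_vec_def grad_def partial_def mult.commute)
    finally show ?thesis .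
  qed
  then have "?D = (\<lambda>h. grad F x \<bullet> h)" by (rule ext)
  then show ?thesis using D by simp
qed

context test_function
begin

abbreviation s where "s \<equiv> s_of \<epsilon>"

definition wt :: "real \<Rightarrow> real" where "wt t = indicator {s..} t * exp (- 4 * t)"

text \<open>The 4 belongs to the measure 4 \<open>wt\<close>, which has total mass \<epsilon>.
  Against it, Hoelder predicts that the fourth power of the pairing is at most \<epsilon>^3
  \<open>Q\<close>.\<close>

definition Q :: real where "Q = (\<integral>t. wt t * (4 * (J (exp (- 2 * t)))\<^sup>2) \<partial>lborel)"

lemma s_nonneg: "0 \<le> s" and exp_s: "exp (- 4 * s) = \<epsilon>"
  using eps by (auto simp: s_of_def)

lemma wt_nonneg: "0 \<le> wt t"
  by (simp add: wt_def)

lemma wt_pos_imp: "wt t \<noteq> 0 \<Longrightarrow> 0 \<le> t"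
  using s_nonneg by (auto simp: wt_def indicator_def split: if_splits)

lemma wt_int: "integrable lborel wt" and wt_integral: "(\<integral>t. wt t \<partial>lborel) = \<epsilon> / 4"
  using exp_tail_integral[of s] exp_s by (simp_all add: wt_def[abs_def])

lemma wt_meas [measurable]: "wt \<in> borel_measurable borel"
  unfolding wt_def[abs_def] by measurable

lemma OU_meas: "(\<lambda>p. OU (fst p) \<psi> (snd p)) \<in> borel_measurable (lborel \<Otimes>\<^sub>M gauss)"
  unfolding OU_def by measurable

text \<open>The L^1 bound \<open>K\<close> is uniform in \<open>t\<close> and \<open>wt\<close> is
  integrable, which justifies Fubini in time and space.\<close>

lemma phi_pairing:
  fixes h :: "real^'n \<Rightarrow> real"
  assumes h[measurable]: "h \<in> borel_measurable borel"
    and i: "\<And>t. 0 \<le> t \<Longrightarrow> integrable gauss (\<lambda>x. OU t \<psi> x * h x)"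
    and K: "\<And>t. 0 \<le> t \<Longrightarrow> (\<integral>x. \<bar>OU t \<psi> x * h x\<bar> \<partial>gauss) \<le> K"
  shows "integrable gauss (\<lambda>x. phi_of \<epsilon> \<psi> x * h x)"
    and "(\<integral>x. phi_of \<epsilon> \<psi> x * h x \<partial>gauss) = 4 * (\<integral>t. wt t * (\<integral>x. OU t \<psi> x * h x \<partial>gauss) \<partial>lborel)"
    and "integrable lborel (\<lambda>t. wt t * (\<integral>x. OU t \<psi> x * h x \<partial>gauss))"
proof -
  note [measurable] = OU_meas
  let ?q = "\<lambda>p. wt (fst p) * (OU (fst p) \<psi> (snd p) * h (snd p))"
  have q: "integrable (lborel \<Otimes>\<^sub>M gauss) ?q"
  proof (rule lborel_gauss.Fubini_integrable)
    show m: "?q \<in> borel_measurable (lborel \<Otimes>\<^sub>M gauss)" by measurable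
    have m': "(\<lambda>p. norm (?q p)) \<in> borel_measurable (lborel \<Otimes>\<^sub>M gauss)" using m by measurable
    show "integrable lborel (\<lambda>t. \<integral>x. norm (?q (t, x)) \<partial>gauss)"
    proof (rule Bochner_Integration.integrable_bound)
      show "integrable lborel (\<lambda>t. wt t * K)" by (intro integrable_mult_left wt_int)
      show "(\<lambda>t. \<integral>x. norm (?q (t, x)) \<partial>gauss) \<in> borel_measurable lborel"
        using m' by (intro gauss.borel_measurable_lebesgue_integral) simp
      have "norm (\<integral>x. norm (?q (t, x)) \<partial>gauss) \<le> norm (wt t * K)" for t
      proof (cases "wt t = 0")
        case False
        then have t: "0 \<le> t" by (rule wt_pos_imp)
        have "(\<integral>x. norm (?q (t, x)) \<partial>gauss) = wt t * (\<integral>x. \<bar>OU t \<psi> x * h x\<bar> \<partial>gauss)"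
          using wt_nonneg[of t] by (simp add: abs_mult[of "wt t"])
        moreover have "wt t * (\<integral>x. \<bar>OU t \<psi> x * h x\<bar> \<partial>gauss) \<le> wt t * K"
          by (intro mult_left_mono K[OF t] wt_nonneg)
        moreover have "0 \<le> wt t * (\<integral>x. \<bar>OU t \<psi> x * h x\<bar> \<partial>gauss)"
          using wt_nonneg[of t] by simp
        ultimately show ?thesis by simp
      qed simp
      then show "AE t in lborel. norm (\<integral>x. norm (?q (t, x)) \<partial>gauss) \<le> norm (wt t * K)" by simp
    qed
    show "AE t in lborel. integrable gauss (\<lambda>x. ?q (t, x))"
    proof (rule AE_I2)
      fix t
      show "integrable gauss (\<lambda>x. ?q (t, x))"
        using i wt_pos_imp[of t] by (cases "wt t = 0") auto
    qed
  qed
  have q': "integrable (lborel \<Otimes>\<^sub>M gauss) (\<lambda>(t, x). ?q (t, x))" using q by (simp add: case_prod_unfold)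
  have phi: "phi_of \<epsilon> \<psi> x * h x = 4 * (\<integral>t. ?q (t, x) \<partial>lborel)" for x
  proof -
    have "(\<integral>t. ?q (t, x) \<partial>lborel) = (\<integral>t. wt t * OU t \<psi> x \<partial>lborel) * h x"
      by (simp flip: mult.assoc)
    then show ?thesis by (simp add: phi_of_def set_lebesgue_integral_def wt_def mult.assoc)
  qed
  show "integrable gauss (\<lambda>x. phi_of \<epsilon> \<psi> x * h x)"
    unfolding phi by (intro integrable_mult_right lborel_gauss.integrable_snd[OF q'])
  have inner: "(\<integral>x. ?q (t, x) \<partial>gauss) = wt t * (\<integral>x. OU t \<psi> x * h x \<partial>gauss)" for t by simp
  have "(\<integral>x. phi_of \<epsilon> \<psi> x * h x \<partial>gauss) = 4 * (\<integral>x. (\<integral>t. ?q (t, x) \<partial>lborel) \<partial>gauss)"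
    unfolding phi by simp
  also have "(\<integral>x. (\<integral>t. ?q (t, x) \<partial>lborel) \<partial>gauss) = (\<integral>t. (\<integral>x. ?q (t, x) \<partial>gauss) \<partial>lborel)"
    by (rule lborel_gauss.Fubini_integral[OF q'])
  finally show "(\<integral>x. phi_of \<epsilon> \<psi> x * h x \<partial>gauss) = 4 * (\<integral>t. wt t * (\<integral>x. OU t \<psi> x * h x \<partial>gauss) \<partial>lborel)"
    unfolding inner .
  show "integrable lborel (\<lambda>t. wt t * (\<integral>x. OU t \<psi> x * h x \<partial>gauss))"
    using lborel_gauss.integrable_fst'[OF q] unfolding inner .
qed

lemma phi_f_int: "integrable gauss (\<lambda>x. phi_of \<epsilon> \<psi> x * f x)"
  by (rule phi_pairing(1)[OF f_meas, where K = 2])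
    (use OU_pairing(1,2)[OF _ f_meas f_pair_int f_pair_abs] in auto)

lemma phi_ga:
  shows "integrable gauss (\<lambda>x. phi_of \<epsilon> \<psi> x * ga x)"
    and "(\<integral>x. phi_of \<epsilon> \<psi> x * ga x \<partial>gauss) = 4 * (\<integral>t. wt t * (\<integral>x. OU t \<psi> x * ga x \<partial>gauss) \<partial>lborel)"
    and "integrable lborel (\<lambda>t. wt t * (\<integral>x. OU t \<psi> x * ga x \<partial>gauss))"
proof -
  have i: "integrable gauss (\<lambda>x. OU t \<psi> x * ga x)"
    and K: "(\<integral>x. \<bar>OU t \<psi> x * ga x\<bar> \<partial>gauss) \<le> info f ga 1 + 1" if "0 \<le> t" for t
    using OU_pairing(1,2)[OF that ga_meas ga_pair_int[OF that] ga_pair_abs[OF that]] by auto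
  note phi = phi_pairing[OF ga_meas i K]
  show "integrable gauss (\<lambda>x. phi_of \<epsilon> \<psi> x * ga x)" by (rule phi(1))
  show "(\<integral>x. phi_of \<epsilon> \<psi> x * ga x \<partial>gauss) = 4 * (\<integral>t. wt t * (\<integral>x. OU t \<psi> x * ga x \<partial>gauss) \<partial>lborel)"
    by (rule phi(2))
  show "integrable lborel (\<lambda>t. wt t * (\<integral>x. OU t \<psi> x * ga x \<partial>gauss))" by (rule phi(3))
qed

lemma J_sq_le: "(J \<rho>)\<^sup>2 \<le> (J 1)\<^sup>2"
  by (intro power_mono J_le J_nonneg)

lemma Q_int: "integrable lborel (\<lambda>t. wt t * (4 * (J (exp (- 2 * t)))\<^sup>2))"
proof (rule Bochner_Integration.integrable_bound)
  show "integrable lborel (\<lambda>t. wt t * (4 * (J 1)\<^sup>2))" by (intro integrable_mult_left wt_int)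
  show "AE t in lborel. norm (wt t * (4 * (J (exp (- 2 * t)))\<^sup>2)) \<le> norm (wt t * (4 * (J 1)\<^sup>2))"
    using J_sq_le wt_nonneg by (auto simp: abs_mult intro!: mult_left_mono)
qed measurable

lemma phi_ga_le:
  assumes \<kappa>: "0 < \<kappa>"
  shows "(\<integral>x. phi_of \<epsilon> \<psi> x * ga x \<partial>gauss) \<le> 3 * \<kappa> * \<epsilon> / 4 + Q / (4 * \<kappa> ^ 3)"
proof -
  have "(\<integral>t. wt t * (\<integral>x. OU t \<psi> x * ga x \<partial>gauss) \<partial>lborel)
     \<le> (\<integral>t. (3 * \<kappa> / 4) * wt t + (1 / (16 * \<kappa> ^ 3)) * (wt t * (4 * (J (exp (- 2 * t)))\<^sup>2)) \<partial>lborel)"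
  proof (rule integral_mono[OF phi_ga(3)])
    show "integrable lborel (\<lambda>t. (3 * \<kappa> / 4) * wt t + (1 / (16 * \<kappa> ^ 3)) * (wt t * (4 * (J (exp (- 2 * t)))\<^sup>2)))"
      by (intro Bochner_Integration.integrable_add integrable_mult_right wt_int Q_int)
    fix t
    show "wt t * (\<integral>x. OU t \<psi> x * ga x \<partial>gauss)
       \<le> (3 * \<kappa> / 4) * wt t + (1 / (16 * \<kappa> ^ 3)) * (wt t * (4 * (J (exp (- 2 * t)))\<^sup>2))"
    proof (cases "wt t = 0")
      case False
      have "wt t * (\<integral>x. OU t \<psi> x * ga x \<partial>gauss) \<le> wt t * (3 * \<kappa> / 4 + (J (exp (- 2 * t)))\<^sup>2 / (4 * \<kappa> ^ 3))"
        by (intro mult_left_mono pairing_le wt_pos_imp False \<kappa> wt_nonneg)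
      then show ?thesis by (simp add: algebra_simps)
    qed simp
  qed
  also have "\<dots> = (3 * \<kappa> / 4) * (\<integral>t. wt t \<partial>lborel) + (1 / (16 * \<kappa> ^ 3)) * Q"
    unfolding Q_def
    by (subst Bochner_Integration.integral_add[OF integrable_mult_right[OF wt_int] integrable_mult_right[OF Q_int]])
      (simp only: integral_mult_right_zero)
  finally show ?thesis
    unfolding phi_ga(2) wt_integral by (simp add: field_simps)
qed

text \<open>With \<rho> = exp (- 2 t) the measure 4 exp (- 4 t) dt becomes 2 \<rho> d\<rho>, and t
  \<ge> s becomes \<rho> \<le> sqrt \<epsilon> because exp (- 4 s) = \<epsilon>.\<close>

lemma Q_le: "Q \<le> 2 * integral {0..sqrt \<epsilon>} (\<lambda>\<rho>. \<rho> * (J \<rho>)\<^sup>2)"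
proof -
  let ?G = "\<lambda>t. 4 * exp (- 4 * t) * (J (exp (- 2 * t)))\<^sup>2"
  let ?k = "\<lambda>\<rho>. 2 * (\<rho> * (J \<rho>)\<^sup>2)"
  have G0: "0 \<le> ?G t" for t by simp
  have es: "exp (- 2 * s) = sqrt \<epsilon>"
  proof -
    have "(exp (- 2 * s))\<^sup>2 = \<epsilon>" using exp_s by (simp flip: exp_double)
    then show ?thesis by (metis exp_ge_zero real_sqrt_unique)
  qed
  have k_int: "set_integrable lborel {0..sqrt \<epsilon>} ?k" "?k integrable_on {0..sqrt \<epsilon>}"
  proof -
    have "\<bar>?k \<rho>\<bar> \<le> 2 * (1 * (J 1)\<^sup>2)" if "\<rho> \<in> {0..sqrt \<epsilon>}" for \<rho>
    proof -
      have "\<rho> \<le> 1" using that eps by (metis atLeastAtMost_iff order_trans real_sqrt_le_1_iff)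
      then have "\<rho> * (J \<rho>)\<^sup>2 \<le> 1 * (J 1)\<^sup>2" using that by (intro mult_mono J_sq_le) auto
      then show ?thesis using that by simp
    qed
    from bounded_measurable_integrable_on[OF _ this]
    show "set_integrable lborel {0..sqrt \<epsilon>} ?k" "?k integrable_on {0..sqrt \<epsilon>}"
      by measurable
  qed
  have fin: "(\<integral>\<^sup>+t. ennreal (?G t) * indicator {s..T} t \<partial>lborel) \<le> ennreal (integral {0..sqrt \<epsilon>} ?k)" if T: "s \<le> T" for T
  proof -
    \<comment> \<open>The substitution rule wants an increasing map on a compact interval: hence the
      sign, undone afterwards by \<open>nn_integral_lborel_uminus\<close>, and the endpoint
      \<open>T\<close>, removed by Fatou.\<close>
    let ?g = "\<lambda>t. - exp (- 2 * t)" and ?g' = "\<lambda>t. 2 * exp (- 2 * t)"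
    have gs: "?g s = - sqrt \<epsilon>" using es by simp
    have "(\<integral>\<^sup>+t. ennreal (?G t) * indicator {s..T} t \<partial>lborel)
      = (\<integral>\<^sup>+t. ennreal (?k (- ?g t) * ?g' t * indicator {s..T} t) \<partial>lborel)"
    proof (rule nn_integral_cong)
      fix t :: real
      have "exp (- 4 * t) = exp (- 2 * t) * exp (- 2 * t)" by (simp flip: exp_add)
      then have "?G t = ?k (- ?g t) * ?g' t" by simp
      then show "ennreal (?G t) * indicator {s..T} t = ennreal (?k (- ?g t) * ?g' t * indicator {s..T} t)"
        by (cases "t \<in> {s..T}") (simp_all only: indicator_simps mult_1_right, simp)
    qed
    also have "\<dots> = (\<integral>\<^sup>+u. ennreal (?k (- u) * indicator {?g s..?g T} u) \<partial>lborel)"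
    proof (rule nn_integral_substitution[symmetric, where f = "\<lambda>u. ?k (- u)" and g = ?g and g' = ?g' and a = s and b = T])
      show "set_borel_measurable borel {?g s..?g T} (\<lambda>u. ?k (- u))"
        unfolding set_borel_measurable_def by measurable
      show "(?g has_real_derivative ?g' t) (at t)" for t
        by (auto intro!: derivative_eq_intros)
      show "continuous_on {s..T} ?g'" by (intro continuous_intros)
    qed (use T in auto)
    also have "\<dots> = (\<integral>\<^sup>+u. ennreal (?k (- (- u)) * indicator {?g s..?g T} (- u)) \<partial>lborel)"
      by (rule nn_integral_lborel_uminus[symmetric, of "\<lambda>u. ennreal (?k (- u) * indicator {?g s..?g T} u)"]) measurable
    also have "\<dots> \<le> (\<integral>\<^sup>+u. ennreal (indicator {0..sqrt \<epsilon>} u *\<^sub>R ?k u) \<partial>lborel)"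
    proof (rule nn_integral_mono)
      fix u :: real
      have "u \<in> {0..sqrt \<epsilon>}" if "- u \<in> {?g s..?g T}"
        using that unfolding gs by (auto intro: order_trans[OF less_imp_le[OF exp_gt_zero]])
      then show "ennreal (?k (- (- u)) * indicator {?g s..?g T} (- u)) \<le> ennreal (indicator {0..sqrt \<epsilon>} u *\<^sub>R ?k u)"
        by (auto simp: indicator_def)
    qed
    also have "\<dots> = ennreal (\<integral>u. indicator {0..sqrt \<epsilon>} u *\<^sub>R ?k u \<partial>lborel)"
      using k_int(1) by (intro nn_integral_eq_integral) (auto simp: set_integrable_def indicator_def)
    also have "\<dots> = ennreal (integral {0..sqrt \<epsilon>} ?k)"
      using set_borel_integral_eq_integral(2)[OF k_int(1)] by (simp only: set_lebesgue_integral_def)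
    finally show ?thesis .
  qed
  have "(\<integral>\<^sup>+t. ennreal (?G t) * indicator {s..} t \<partial>lborel)
      = (\<integral>\<^sup>+t. liminf (\<lambda>n. ennreal (?G t) * indicator {s..s + real n} t) \<partial>lborel)"
  proof (rule nn_integral_cong)
    fix t :: real
    have "eventually (\<lambda>n. ennreal (?G t) * indicator {s..s + real n} t = ennreal (?G t) * indicator {s..} t) sequentially"
      using eventually_ge_at_top[of "nat \<lceil>t - s\<rceil>"]
      by eventually_elim (auto simp: indicator_def)
    then have "(\<lambda>n. ennreal (?G t) * indicator {s..s + real n} t) \<longlonglongrightarrow> ennreal (?G t) * indicator {s..} t"
      by (rule tendsto_eventually)
    then show "ennreal (?G t) * indicator {s..} t = liminf (\<lambda>n. ennreal (?G t) * indicator {s..s + real n} t)"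
      by (intro lim_imp_Liminf[symmetric]) auto
  qed
  also have "\<dots> \<le> liminf (\<lambda>n. \<integral>\<^sup>+t. ennreal (?G t) * indicator {s..s + real n} t \<partial>lborel)"
    by (rule nn_integral_liminf) measurable
  also have "\<dots> \<le> ennreal (integral {0..sqrt \<epsilon>} ?k)"
    using fin by (intro Liminf_le) auto
  finally have le: "(\<integral>\<^sup>+t. ennreal (?G t) * indicator {s..} t \<partial>lborel) \<le> ennreal (integral {0..sqrt \<epsilon>} ?k)" .
  have "ennreal Q = (\<integral>\<^sup>+t. ennreal (wt t * (4 * (J (exp (- 2 * t)))\<^sup>2)) \<partial>lborel)"
    unfolding Q_def using wt_nonneg by (intro nn_integral_eq_integral[symmetric] Q_int) auto
  also have "\<dots> = (\<integral>\<^sup>+t. ennreal (?G t) * indicator {s..} t \<partial>lborel)"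
    by (intro nn_integral_cong) (auto simp: wt_def indicator_def mult_ac)
  finally have "ennreal Q \<le> ennreal (integral {0..sqrt \<epsilon>} ?k)" using le by simp
  moreover have "0 \<le> integral {0..sqrt \<epsilon>} ?k"
    using k_int(2) by (rule Henstock_Kurzweil_Integration.integral_nonneg) auto
  ultimately have "Q \<le> integral {0..sqrt \<epsilon>} ?k" by (simp add: ennreal_le_iff)
  then show ?thesis by simp
qed

lemma phi_ga_pow4:
  assumes M: "M = (\<integral>x. phi_of \<epsilon> \<psi> x * ga x \<partial>gauss)" "0 < M"
  shows "M ^ 4 / (4 * \<epsilon> ^ 3) \<le> info f g 1 - 2 * (\<integral>x. f x * ln (f x) \<partial>gauss) + \<epsilon> * (max 0 cc)\<^sup>2"
proof -
  have M4: "M ^ 4 \<le> \<epsilon> ^ 3 * Q"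
  proof -
    \<comment> \<open>At equality in \<epsilon>^3 Q = M^4 the optimal \<kappa> is M / \<epsilon>.
      Using this value instead of the fourth root of Q / \<epsilon> covers Q = 0 as well.\<close>
    have "M \<le> 3 * (M / \<epsilon>) * \<epsilon> / 4 + Q / (4 * (M / \<epsilon>) ^ 3)"
      using phi_ga_le[of "M / \<epsilon>"] M eps by simp
    also have "\<dots> = 3 * M / 4 + Q * \<epsilon> ^ 3 / (4 * M ^ 3)"
      using M eps by (simp add: power_divide)
    finally have "M / 4 \<le> Q * \<epsilon> ^ 3 / (4 * M ^ 3)" by simp
    then have "M / 4 * (4 * M ^ 3) \<le> Q * \<epsilon> ^ 3"
      using M by (subst (asm) pos_le_divide_eq) auto
    then show ?thesis by (simp add: power_numeral_reduce mult_ac)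
  qed
  define d where "d = max 0 cc"
  have se: "0 \<le> sqrt \<epsilon>" "sqrt \<epsilon> \<le> 1" using eps by auto
  have b: "\<bar>\<rho> * (J \<rho> - cc)\<^sup>2\<bar> \<le> 2 * (J 1)\<^sup>2 + 2 * cc\<^sup>2" if "\<rho> \<in> {0..1}" for \<rho>
  proof -
    have "(J \<rho> - cc)\<^sup>2 \<le> 2 * (J \<rho>)\<^sup>2 + 2 * cc\<^sup>2"
      using zero_le_power2[of "J \<rho> + cc"] by (simp add: power2_eq_square algebra_simps)
    also have "\<dots> \<le> 2 * (J 1)\<^sup>2 + 2 * cc\<^sup>2" using J_sq_le[of \<rho>] by simp
    finally have "1 * (J \<rho> - cc)\<^sup>2 \<le> 2 * (J 1)\<^sup>2 + 2 * cc\<^sup>2" by simp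
    moreover have "\<rho> * (J \<rho> - cc)\<^sup>2 \<le> 1 * (J \<rho> - cc)\<^sup>2" using that by (intro mult_right_mono) auto
    ultimately show ?thesis using that by (simp add: abs_mult)
  qed
  have i1: "(\<lambda>\<rho>. \<rho> * (J \<rho> - cc)\<^sup>2) integrable_on {0..1}"
    by (rule bounded_measurable_integrable_on(2)[OF _ b]) measurable
  have i2: "(\<lambda>\<rho>. \<rho> * (J \<rho> - cc)\<^sup>2) integrable_on {0..sqrt \<epsilon>}"
    by (rule integrable_on_subinterval[OF i1]) (use se in auto)
  have i3: "(\<lambda>\<rho>. \<rho> * (J \<rho>)\<^sup>2) integrable_on {0..sqrt \<epsilon>}"
  proof (rule bounded_measurable_integrable_on(2))
    fix \<rho> assume r: "\<rho> \<in> {0..sqrt \<epsilon>}"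
    then have "\<rho> \<le> 1" using se by (meson atLeastAtMost_iff order_trans)
    then have "\<rho> * (J \<rho>)\<^sup>2 \<le> 1 * (J 1)\<^sup>2" using r by (intro mult_mono J_sq_le) auto
    then show "\<bar>\<rho> * (J \<rho>)\<^sup>2\<bar> \<le> (J 1)\<^sup>2" using r by (simp add: abs_mult)
  qed measurable
  \<comment> \<open>Replacing \<rho> by sqrt \<epsilon> in the last term, then integrating over an
    interval of length sqrt \<epsilon>, produces the factor \<epsilon> in front of the covariance
    term.\<close>
  have pt: "\<rho> * (J \<rho>)\<^sup>2 \<le> 2 * (\<rho> * (J \<rho> - cc)\<^sup>2) + 2 * (sqrt \<epsilon> * d\<^sup>2)" if r: "\<rho> \<in> {0..sqrt \<epsilon>}" for \<rho>
  proof -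
    have "(J \<rho>)\<^sup>2 \<le> 2 * (J \<rho> - cc)\<^sup>2 + 2 * d\<^sup>2"
    \<comment> \<open>A negative \<open>cc\<close> is absorbed by J \<ge> 0. Only the positive part
      may survive, since \<open>qnorm\<close> is a one-sided supremum and bounds \<open>cc\<close>
      from above only.\<close>
    proof (cases "cc \<le> 0")
      case True
      then have "(J \<rho>)\<^sup>2 \<le> (J \<rho> - cc)\<^sup>2" using J_nonneg[of \<rho>] by (intro power_mono) auto
      moreover have "0 \<le> (J \<rho> - cc)\<^sup>2" "0 \<le> d\<^sup>2" by auto
      ultimately show ?thesis by linarith
    next
      case False
      have "0 \<le> (J \<rho> - cc - cc)\<^sup>2" by simp
      then show ?thesis using False by (simp add: d_def power2_eq_square algebra_simps)
    qed
    then have "\<rho> * (J \<rho>)\<^sup>2 \<le> \<rho> * (2 * (J \<rho> - cc)\<^sup>2 + 2 * d\<^sup>2)" using r by (intro mult_left_mono) auto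
    moreover have "\<rho> * d\<^sup>2 \<le> sqrt \<epsilon> * d\<^sup>2" using r by (intro mult_right_mono) auto
    ultimately show ?thesis by (simp add: algebra_simps)
  qed
  have "integral {0..sqrt \<epsilon>} (\<lambda>\<rho>. \<rho> * (J \<rho>)\<^sup>2)
      \<le> integral {0..sqrt \<epsilon>} (\<lambda>\<rho>. 2 * (\<rho> * (J \<rho> - cc)\<^sup>2) + 2 * (sqrt \<epsilon> * d\<^sup>2))"
    by (intro integral_le i3 integrable_add integrable_on_mult_right i2 integrable_const_ivl pt)
  also have "\<dots> = 2 * integral {0..sqrt \<epsilon>} (\<lambda>\<rho>. \<rho> * (J \<rho> - cc)\<^sup>2) + sqrt \<epsilon> * (2 * (sqrt \<epsilon> * d\<^sup>2))"
    using se by (subst integral_add) (auto intro: integrable_on_mult_right i2)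
  also have "\<dots> = 2 * integral {0..sqrt \<epsilon>} (\<lambda>\<rho>. \<rho> * (J \<rho> - cc)\<^sup>2) + 2 * (\<epsilon> * d\<^sup>2)"
    using eps by simp
  finally have h1: "integral {0..sqrt \<epsilon>} (\<lambda>\<rho>. \<rho> * (J \<rho>)\<^sup>2) \<le> 2 * integral {0..sqrt \<epsilon>} (\<lambda>\<rho>. \<rho> * (J \<rho> - cc)\<^sup>2) + 2 * (\<epsilon> * d\<^sup>2)" .
  have h2: "integral {0..sqrt \<epsilon>} (\<lambda>\<rho>. \<rho> * (J \<rho> - cc)\<^sup>2) \<le> integral {0..1} (\<lambda>\<rho>. \<rho> * (J \<rho> - cc)\<^sup>2)"
    by (rule integral_subset_le[OF _ i2 i1]) (use se in auto)
  have "M ^ 4 / (4 * \<epsilon> ^ 3) \<le> (\<epsilon> ^ 3 * Q) / (4 * \<epsilon> ^ 3)"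
    using M4 eps by (intro divide_right_mono) auto
  also have "\<dots> = Q / 4" using eps by simp
  also have "\<dots> \<le> info f g 1 - 2 * (\<integral>x. f x * ln (f x) \<partial>gauss) + \<epsilon> * d\<^sup>2"
    using Q_le h1 h2 deficit_ge by linarith
  finally show ?thesis unfolding d_def .
qed

text \<open>Integration by parts for phi f along \<alpha>. Admissibility provides integrability of x
  phi - grad phi as a whole, which is why \<open>gauss_ibp\<close> is stated for the combined
  integrand.\<close>

lemma phi_ibp:
  assumes diff: "\<And>x. phi_of \<epsilon> \<psi> differentiable (at x)"
    and vint: "integrable (density gauss (\<lambda>x. ennreal (f x))) (\<lambda>x. phi_of \<epsilon> \<psi> x *\<^sub>R x - grad (phi_of \<epsilon> \<psi>) x)"
  shows "(\<integral>x. phi_of \<epsilon> \<psi> x *\<^sub>R x - grad (phi_of \<epsilon> \<psi>) x \<partial>density gauss (\<lambda>x. ennreal (f x))) \<bullet> \<alpha>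
    = (\<integral>x. phi_of \<epsilon> \<psi> x * ga x \<partial>gauss)"
proof -
  let ?\<phi> = "phi_of \<epsilon> \<psi>"
  let ?v = "\<lambda>x. ?\<phi> x *\<^sub>R x - grad ?\<phi> x"
  have vm[measurable]: "?v \<in> borel_measurable borel"
    using borel_measurable_integrable[OF vint] by simp
  have vi: "integrable gauss (\<lambda>x. f x *\<^sub>R ?v x)"
    using vint f_nonneg by (subst (asm) integrable_density) auto
  have V: "(\<integral>x. ?v x \<partial>density gauss (\<lambda>x. ennreal (f x))) \<bullet> \<alpha> = (\<integral>x. f x * (?v x \<bullet> \<alpha>) \<partial>gauss)"
    using f_nonneg vi by (subst integral_density) (auto simp flip: integral_inner_left)
  have vi': "integrable gauss (\<lambda>x. f x * (?v x \<bullet> \<alpha>))"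
    using integrable_inner_left[OF vi, of \<alpha>] by simp
  let ?u' = "\<lambda>x. ?\<phi> x * ga x + (grad ?\<phi> x \<bullet> \<alpha>) * f x"
  have eq: "?u' x - (?\<phi> x * f x) * (\<alpha> \<bullet> x) = ?\<phi> x * ga x - f x * (?v x \<bullet> \<alpha>)" for x
    by (simp add: inner_diff_left inner_commute algebra_simps)
  have "(\<integral>x. ?u' x - (?\<phi> x * f x) * (\<alpha> \<bullet> x) \<partial>gauss) = 0"
  proof (rule gauss_ibp[OF phi_f_int])
    show "integrable gauss (\<lambda>x. ?u' x - (?\<phi> x * f x) * (\<alpha> \<bullet> x))"
      unfolding eq using phi_ga(1) vi' by (rule Bochner_Integration.integrable_diff)
    fix x
    have "((\<lambda>t. ?\<phi> (x + t *\<^sub>R \<alpha>)) has_real_derivative grad ?\<phi> x \<bullet> \<alpha>) (at 0)"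
    proof -
      have 1: "((\<lambda>t. x + t *\<^sub>R \<alpha>) has_derivative (\<lambda>t. t *\<^sub>R \<alpha>)) (at (0::real))"
        by (auto intro!: derivative_eq_intros)
      have 2: "(?\<phi> has_derivative (\<lambda>h. grad ?\<phi> x \<bullet> h)) (at (x + 0 *\<^sub>R \<alpha>))"
        using grad_has_derivative[OF diff[of x]] by simp
      show ?thesis
        using diff_chain_at[OF 1 2] by (simp add: has_field_derivative_def comp_def mult_commute_abs)
    qed
    from DERIV_mult[OF this line_deriv]
    show "((\<lambda>t. ?\<phi> (x + t *\<^sub>R \<alpha>) * f (x + t *\<^sub>R \<alpha>)) has_real_derivative ?u' x) (at 0)"
      by (simp add: ga_def algebra_simps)
  qed
  then show ?thesis
    unfolding eq V using phi_ga(1) vi' by simp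
qed

end

section \<open>Reduction to the centered case\<close>

text \<open>The ratio \<open>gauss_dens (x + b) / gauss_dens x\<close>, so \<open>shift f b\<close>
  is the density of X - b when X has density \<open>f\<close>.\<close>

definition shift_weight :: "real^'n \<Rightarrow> real^'n \<Rightarrow> real" where
  "shift_weight b x = exp (- (b \<bullet> x + (norm b)\<^sup>2 / 2))"

lemma shift_eq: "shift f b x = shift_weight b x * f (x + b)"
  by (simp add: shift_def shift_weight_def)

lemma shift_weight_pos: "0 < shift_weight b x"
  by (simp add: shift_weight_def)

lemma gauss_dens_shift: "gauss_dens x * shift_weight b x = gauss_dens (x + b)"
proof -
  have "(norm (x + b))\<^sup>2 = (norm x)\<^sup>2 + 2 * (b \<bullet> x) + (norm b)\<^sup>2"
    unfolding power2_norm_eq_inner by (simp add: inner_add_left inner_add_right inner_commute)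
  then show ?thesis
    by (simp add: gauss_dens_def shift_weight_def add_divide_distrib flip: exp_add)
qed

lemma borel_measurable_shift_weight [measurable]: "shift_weight b \<in> borel_measurable borel"
  unfolding shift_weight_def by measurable

lemma gauss_shift:
  fixes h :: "real^'n \<Rightarrow> real"
  assumes h: "integrable gauss h"
  shows "integrable gauss (\<lambda>x. shift_weight b x * h (x + b))"
    and "(\<integral>x. shift_weight b x * h (x + b) \<partial>gauss) = (\<integral>x. h x \<partial>gauss)"
proof -
  have [measurable]: "h \<in> borel_measurable borel"
    using borel_measurable_integrable[OF h] by simp
  have eq: "gauss_dens x *\<^sub>R (shift_weight b x * h (x + b)) = (\<lambda>y. gauss_dens y *\<^sub>R h y) (x + b)" for x
    by (simp add: gauss_dens_shift flip: mult.assoc)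
  have i: "integrable lborel (\<lambda>y. gauss_dens y *\<^sub>R h y)"
    using h by (subst (asm) integrable_gauss_iff) auto
  show "integrable gauss (\<lambda>x. shift_weight b x * h (x + b))"
    by (subst integrable_gauss_iff, measurable) (unfold eq, rule integrable_lborel_translate[OF i])
  show "(\<integral>x. shift_weight b x * h (x + b) \<partial>gauss) = (\<integral>x. h x \<partial>gauss)"
    by (subst (1 2) integral_gauss_eq, measurable) (unfold eq, rule integral_lborel_translate, measurable)
qed

context c1_prob
begin

definition bc :: "real^'n" where "bc = barycenter f"

definition gs :: "real^'n \<Rightarrow> real^'n" where
  "gs x = shift_weight bc x *\<^sub>R (g (x + bc) - f (x + bc) *\<^sub>R bc)"

lemma f_vec_int: "integrable gauss (\<lambda>x. f x *\<^sub>R x)"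
proof (rule Bochner_Integration.integrable_bound)
  show "integrable gauss (\<lambda>x. f x + (norm x)\<^sup>2 * f x)" using f_int moment by simp
  have "f x * norm x \<le> f x * (1 + (norm x)\<^sup>2)" for x
  proof (intro mult_left_mono f_nonneg)
    show "norm x \<le> 1 + (norm x)\<^sup>2"
      using sum_squares_bound[of "norm x" 1] norm_ge_zero[of x] unfolding power_one mult_1_right by linarith
  qed
  then show "AE x in gauss. norm (f x *\<^sub>R x) \<le> norm (f x + (norm x)\<^sup>2 * f x)"
    using f_nonneg by (simp add: algebra_simps)
qed measurable

lemma f_inner_int: "integrable gauss (\<lambda>x. f x * (\<alpha> \<bullet> x))"
  and integral_f_inner: "(\<integral>x. f x * (\<alpha> \<bullet> x) \<partial>gauss) = \<alpha> \<bullet> bc"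
  using integrable_inner_right[OF f_vec_int, of \<alpha>] f_vec_int
  by (simp_all add: bc_def barycenter_def flip: integral_inner_right)

lemma g_inner_int: "integrable gauss (\<lambda>x. g x \<bullet> \<alpha>)"
  using g_int by simp

text \<open>Integration by parts for \<open>f\<close> itself. It evaluates the cross term when the
  Fisher information is recentered.\<close>

lemma integral_g_inner: "(\<integral>x. g x \<bullet> \<alpha> \<partial>gauss) = \<alpha> \<bullet> bc"
proof -
  have "(\<integral>x. g x \<bullet> \<alpha> - f x * (\<alpha> \<bullet> x) \<partial>gauss) = 0"
    by (rule gauss_ibp[OF f_int _ line_deriv])
      (intro Bochner_Integration.integrable_diff g_inner_int f_inner_int)
  then show ?thesis
    using g_inner_int f_inner_int by (simp add: integral_f_inner)
qed

text \<open>Shifting subtracts \<open>bc\<close> from the logarithmic gradient. Expanding the square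
  gives a cross term of -2 |bc|^2 and a quadratic term of |bc|^2.\<close>

lemma shift_fisher:
  "integrable gauss (\<lambda>x. (norm (gs x))\<^sup>2 / shift f bc x)"
  "(\<integral>x. (norm (gs x))\<^sup>2 / shift f bc x \<partial>gauss) = info f g 1 - (norm bc)\<^sup>2"
proof -
  let ?h = "\<lambda>x. (norm (g x))\<^sup>2 / f x - 2 * (g x \<bullet> bc) + (norm bc)\<^sup>2 * f x"
  have h: "integrable gauss ?h"
    by (intro Bochner_Integration.integrable_add Bochner_Integration.integrable_diff fisher
        integrable_mult_right g_inner_int f_int)
  have eq: "(norm (gs x))\<^sup>2 / shift f bc x = shift_weight bc x * ?h (x + bc)" for x
  proof (cases "f (x + bc) = 0")
    case True
    then show ?thesis by (simp add: gs_def g_zero shift_eq)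
  next
    case False
    have "(norm (g (x + bc) - f (x + bc) *\<^sub>R bc))\<^sup>2
        = (norm (g (x + bc)))\<^sup>2 - 2 * f (x + bc) * (g (x + bc) \<bullet> bc) + (f (x + bc))\<^sup>2 * (norm bc)\<^sup>2"
      unfolding power2_norm_eq_inner
      by (simp add: inner_diff_left inner_diff_right inner_commute power2_eq_square)
    then have "(norm (g (x + bc) - f (x + bc) *\<^sub>R bc))\<^sup>2 / f (x + bc) = ?h (x + bc)"
      using False by (simp add: diff_divide_distrib add_divide_distrib power2_eq_square[of "f (x + bc)"])
    moreover have "(norm (gs x))\<^sup>2 / shift f bc x
        = shift_weight bc x * ((norm (g (x + bc) - f (x + bc) *\<^sub>R bc))\<^sup>2 / f (x + bc))"
      using shift_weight_pos[of bc x]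
      by (simp add: gs_def shift_eq power_mult_distrib power2_eq_square[of "shift_weight bc x"])
    ultimately show ?thesis by simp
  qed
  show "integrable gauss (\<lambda>x. (norm (gs x))\<^sup>2 / shift f bc x)"
    unfolding eq by (rule gauss_shift(1)[OF h])
  have "(\<integral>x. (norm (gs x))\<^sup>2 / shift f bc x \<partial>gauss) = (\<integral>x. ?h x \<partial>gauss)"
    unfolding eq by (rule gauss_shift(2)[OF h])
  also have "\<dots> = info f g 1 - 2 * (bc \<bullet> bc) + (norm bc)\<^sup>2"
    using fisher g_inner_int f_int mass by (simp add: info_one integral_g_inner)
  finally show "(\<integral>x. (norm (gs x))\<^sup>2 / shift f bc x \<partial>gauss) = info f g 1 - (norm bc)\<^sup>2"
    by (simp add: power2_norm_eq_inner)
qed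

lemma c1_prob_shift: "c1_prob (shift f bc) gs"
proof unfold_locales
  fix x
  show "0 \<le> shift f bc x" unfolding shift_eq by (intro mult_nonneg_nonneg less_imp_le[OF shift_weight_pos] f_nonneg)
  have 1: "((\<lambda>x. f (x + bc)) has_derivative (\<lambda>h. g (x + bc) \<bullet> h)) (at x)"
  proof -
    have "((\<lambda>x. x + bc) has_derivative (\<lambda>h. h)) (at x)" by (auto intro!: derivative_eq_intros)
    from diff_chain_at[OF this deriv] show ?thesis by (simp add: comp_def)
  qed
  have 2: "(shift_weight bc has_derivative (\<lambda>h. - (bc \<bullet> h) * shift_weight bc x)) (at x)"
    unfolding shift_weight_def by (auto intro!: derivative_eq_intros)
  show "(shift f bc has_derivative (\<lambda>h. gs x \<bullet> h)) (at x)"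
    unfolding shift_eq[abs_def]
    by (rule has_derivative_eq_rhs[OF has_derivative_mult[OF 2 1]])
      (auto simp: gs_def fun_eq_iff inner_diff_left algebra_simps)
next
  have 1: "continuous_on UNIV (\<lambda>x. g (x + bc))" "continuous_on UNIV (\<lambda>x. f (x + bc))"
    by (auto intro!: continuous_on_compose2[OF g_cont] continuous_on_compose2[OF f_cont] continuous_intros)
  show "continuous_on UNIV gs"
    unfolding gs_def[abs_def] shift_weight_def by (intro continuous_intros 1) auto
next
  show "integrable gauss (shift f bc)" "(\<integral>x. shift f bc x \<partial>gauss) = 1"
    using gauss_shift[OF f_int, of bc] mass by (simp_all add: shift_eq[abs_def])
next
  show "integrable gauss (\<lambda>x. (norm (gs x))\<^sup>2 / shift f bc x)" by (rule shift_fisher(1))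
next
  have "integrable gauss (\<lambda>x. (norm (x - bc))\<^sup>2 * f x)"
  proof (rule Bochner_Integration.integrable_bound)
    show "integrable gauss (\<lambda>x. 2 * ((norm x)\<^sup>2 * f x) + 2 * (norm bc)\<^sup>2 * f x)"
      by (intro Bochner_Integration.integrable_add integrable_mult_right moment f_int)
    have "(norm (x - bc))\<^sup>2 \<le> 2 * (norm x)\<^sup>2 + 2 * (norm bc)\<^sup>2" for x
    proof -
      have "(norm (x - bc))\<^sup>2 \<le> (norm x + norm bc)\<^sup>2" by (intro power_mono norm_triangle_ineq4) auto
      then show ?thesis using sum_squares_bound[of "norm x" "norm bc"] unfolding power2_sum by linarith
    qed
    then have "(norm (x - bc))\<^sup>2 * f x \<le> (2 * (norm x)\<^sup>2 + 2 * (norm bc)\<^sup>2) * f x" for x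
      by (intro mult_right_mono f_nonneg)
    then show "AE x in gauss. norm ((norm (x - bc))\<^sup>2 * f x) \<le> norm (2 * ((norm x)\<^sup>2 * f x) + 2 * (norm bc)\<^sup>2 * f x)"
      using f_nonneg by (simp add: algebra_simps)
  qed measurable
  from gauss_shift(1)[OF this, of bc]
  show "integrable gauss (\<lambda>x. (norm x)\<^sup>2 * shift f bc x)"
    by (simp add: shift_eq mult_ac)
qed

text \<open>At y = x + bc the logarithm changes by - bc \<bullet> y + |bc|^2 / 2, whose mean is -
  |bc|^2 / 2. This is half the loss of Fisher information, so the deficit is invariant.\<close>

lemma shift_entropy: "(\<integral>x. shift f bc x * ln (shift f bc x) \<partial>gauss) = Ent f - (norm bc)\<^sup>2 / 2"
proof -
  let ?h = "\<lambda>x. f x * ln (f x) - f x * (bc \<bullet> x) + ((norm bc)\<^sup>2 / 2) * f x"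
  note ent = entropy_le_integral_info(1)[OF mass]
  have h: "integrable gauss ?h"
    by (intro Bochner_Integration.integrable_add Bochner_Integration.integrable_diff ent
        integrable_mult_right f_inner_int f_int)
  have eq: "shift f bc x * ln (shift f bc x) = shift_weight bc x * ?h (x + bc)" for x
  proof (cases "f (x + bc) = 0")
    case False
    then have "0 < f (x + bc)" using f_nonneg[of "x + bc"] by simp
    then have "ln (shift f bc x) = - (bc \<bullet> x + (norm bc)\<^sup>2 / 2) + ln (f (x + bc))"
      unfolding shift_eq by (simp add: ln_mult shift_weight_def)
    then have "shift f bc x * ln (shift f bc x)
        = (shift_weight bc x * f (x + bc)) * (- (bc \<bullet> x + (norm bc)\<^sup>2 / 2) + ln (f (x + bc)))"
      by (simp only: shift_eq)
    then show ?thesis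
      by (simp add: inner_add_right power2_norm_eq_inner algebra_simps)
  qed (simp add: shift_eq)
  have "(\<integral>x. shift f bc x * ln (shift f bc x) \<partial>gauss) = (\<integral>x. ?h x \<partial>gauss)"
    unfolding eq by (rule gauss_shift(2)[OF h])
  also have "\<dots> = Ent f - bc \<bullet> bc + (norm bc)\<^sup>2 / 2"
    using ent f_inner_int f_int mass by (simp add: Ent_def integral_f_inner)
  finally show ?thesis by (simp add: power2_norm_eq_inner)
qed

lemma cov_int: "integrable gauss (\<lambda>x. f x * ((x - bc) $ i * (x - bc) $ j))"
proof (rule Bochner_Integration.integrable_bound)
  have [measurable]: "(\<lambda>x. (x - bc) $ k) \<in> borel_measurable borel" for k
    unfolding cart_eq_inner_axis by measurable
  show "(\<lambda>x. f x * ((x - bc) $ i * (x - bc) $ j)) \<in> borel_measurable gauss" by measurable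
  interpret S: c1_prob "shift f bc" gs by (rule c1_prob_shift)
  have "integrable gauss (\<lambda>x. shift_weight (- bc) x * ((norm (x - bc))\<^sup>2 * shift f bc (x - bc)))"
    using gauss_shift(1)[OF S.moment, of "- bc"] by simp
  moreover have "shift_weight (- bc) x * ((norm (x - bc))\<^sup>2 * shift f bc (x - bc)) = (norm (x - bc))\<^sup>2 * f x" for x
  proof -
    have "shift_weight (- bc) x * shift_weight bc (x - bc) = 1"
      by (simp add: shift_weight_def inner_diff_right power2_norm_eq_inner flip: exp_add)
    then show ?thesis by (simp add: shift_eq mult_ac)
  qed
  ultimately show "integrable gauss (\<lambda>x. (norm (x - bc))\<^sup>2 * f x)" by simp
  have "\<bar>(x - bc) $ i * (x - bc) $ j\<bar> \<le> (norm (x - bc))\<^sup>2" for x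
    unfolding abs_mult power2_eq_square by (intro mult_mono component_le_norm_cart) auto
  then have "f x * \<bar>(x - bc) $ i * (x - bc) $ j\<bar> \<le> f x * (norm (x - bc))\<^sup>2" for x
    by (intro mult_left_mono f_nonneg)
  then show "AE x in gauss. norm (f x * ((x - bc) $ i * (x - bc) $ j)) \<le> norm ((norm (x - bc))\<^sup>2 * f x)"
    using f_nonneg by (simp add: abs_mult mult.commute)
qed

lemma covariance_form:
  assumes "norm \<alpha> = 1"
  shows "(\<integral>x. shift f bc x * (\<alpha> \<bullet> x)\<^sup>2 \<partial>gauss) - 1 = ((covariance f - mat 1) *v \<alpha>) \<bullet> \<alpha>"
proof -
  have sq: "f x * (\<alpha> \<bullet> (x - bc))\<^sup>2 = (\<Sum>i\<in>UNIV. \<Sum>j\<in>UNIV. \<alpha> $ i * \<alpha> $ j * (f x * ((x - bc) $ i * (x - bc) $ j)))" for x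
    unfolding power2_eq_square inner_vec_def by (simp add: sum_product sum_distrib_left mult_ac)
  have i: "integrable gauss (\<lambda>x. f x * (\<alpha> \<bullet> (x - bc))\<^sup>2)"
    unfolding sq by (intro Bochner_Integration.integrable_sum integrable_mult_right cov_int)
  have "(\<integral>x. shift f bc x * (\<alpha> \<bullet> x)\<^sup>2 \<partial>gauss) = (\<integral>x. f x * (\<alpha> \<bullet> (x - bc))\<^sup>2 \<partial>gauss)"
    using gauss_shift(2)[OF i, of bc] by (simp add: shift_eq mult.assoc)
  also have "\<dots> = (\<Sum>i\<in>UNIV. \<Sum>j\<in>UNIV. \<alpha> $ i * \<alpha> $ j * (\<integral>x. f x * ((x - bc) $ i * (x - bc) $ j) \<partial>gauss))"
    unfolding sq
    by (subst Bochner_Integration.integral_sum, intro Bochner_Integration.integrable_sum integrable_mult_right cov_int)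
      (subst Bochner_Integration.integral_sum, auto intro!: integrable_mult_right cov_int simp del: vector_minus_component)
  also have "\<dots> = (covariance f *v \<alpha>) \<bullet> \<alpha>"
    by (simp add: inner_vec_def matrix_vector_mult_def covariance_def sum_distrib_left sum_distrib_right
        bc_def mult_ac)
  finally show ?thesis
    using assms by (simp add: matrix_vector_mult_diff_rdistrib inner_diff_left flip: power2_norm_eq_inner)
qed

end

section \<open>Assembling the estimate for the supremum over test functions\<close>

lemma quadratic_form_le_qnorm:
  fixes A :: "real^'n^'n"
  assumes "norm \<alpha> = 1"
  shows "(A *v \<alpha>) \<bullet> \<alpha> \<le> qnorm A"
  unfolding qnorm_def
proof (rule cSup_upper)
  show "(A *v \<alpha>) \<bullet> \<alpha> \<in> {(A *v \<alpha>) \<bullet> \<alpha> |\<alpha>. norm \<alpha> = 1}" using assms by blast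
  \<comment> \<open>Compactness of the sphere bounds the set from above, without which
    \<open>Sup\<close> on the reals carries no information.\<close>
  have "compact ((\<lambda>\<alpha>. (A *v \<alpha>) \<bullet> \<alpha>) ` sphere 0 1)"
    by (intro compact_continuous_image continuous_intros
        linear_continuous_on[OF matrix_vector_mul_bounded_linear]) auto
  moreover have "{(A *v \<alpha>) \<bullet> \<alpha> |\<alpha>. norm \<alpha> = 1} = (\<lambda>\<alpha>. (A *v \<alpha>) \<bullet> \<alpha>) ` sphere 0 1" by auto
  ultimately show "bdd_above {(A *v \<alpha>) \<bullet> \<alpha> |\<alpha>. norm \<alpha> = 1}"
    by (metis compact_imp_bounded bounded_imp_bdd_above)
qed

text \<open>Makes the supremum nonnegative; over an empty set it would be minus infinity in
  \<open>ereal\<close>, and the fourth power would not be monotone.\<close>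

lemma zero_admissible: "(\<lambda>_. 0) \<in> admissible \<epsilon> (h :: real^'n \<Rightarrow> real)"
proof -
  have phi: "phi_of \<epsilon> (\<lambda>_. 0) = (\<lambda>_::real^'n. 0)"
    by (simp add: phi_of_def OU_def fun_eq_iff set_lebesgue_integral_def)
  have p: "partial (\<lambda>_::real^'n. 0) i = (\<lambda>_. 0)" for i
    by (simp add: partial_def fun_eq_iff frechet_derivative_const)
  have gr: "grad (\<lambda>_::real^'n. 0) x = 0" for x
    by (simp add: grad_def p vec_eq_iff)
  have "Ck 1 (\<lambda>_::real^'n. 0)" by (simp add: p)
  then show ?thesis
    unfolding admissible_def
    by (intro CollectI exI[of _ "\<lambda>_. 0"]) (simp add: phi gr OU_def set_integrable_def)
qed

text \<open>Infinite Fisher information is a separate alternative because \<open>enn2real\<close>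
  would send it to 0 in \<open>deficit\<close>.\<close>

theorem theorem4p2:
  fixes f :: "real^'n \<Rightarrow> real" and \<epsilon> :: real
  assumes "smooth f"
    and "\<And>x. f x \<ge> 0"
    and "(\<integral>\<^sup>+x. ennreal (f x) \<partial>gauss) = 1"
    and "(\<integral>\<^sup>+x. ennreal ((norm x)\<^sup>2 * f x) \<partial>gauss) < \<infinity>"
    and "0 < \<epsilon>" and "\<epsilon> \<le> 1"
  shows "Fisher f = \<infinity> \<or>
    Dtilde \<epsilon> (shift f (barycenter f)) ^ 4 / ereal (4 * \<epsilon> ^ 3)
      \<le> ereal (2 * deficit f + \<epsilon> * (qnorm (covariance f - mat 1))\<^sup>2)"
proof (cases "Fisher f = \<infinity>")
  case False
  have C1: "Ck 1 f" using assms(1) unfolding smooth_def by blast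
  have fc[measurable]: "f \<in> borel_measurable borel"
    using C1 by (intro borel_measurable_continuous_onI) simp
  have gc: "continuous_on UNIV (grad f)"
    using C1 unfolding grad_def[abs_def] by (intro continuous_on_vec_lambda) simp
  have [measurable]: "grad f \<in> borel_measurable borel"
    by (rule borel_measurable_continuous_onI[OF gc])
  have fi: "integrable gauss f"
    using assms(2,3) by (intro integrableI_nonneg) auto
  have fm: "(\<integral>x. f x \<partial>gauss) = 1"
    using nn_integral_eq_integral[OF fi] assms(2,3) by simp
  have Fi: "integrable gauss (\<lambda>x. (norm (grad f x))\<^sup>2 / f x)"
    using False assms(2) unfolding Fisher_def by (intro integrableI_nonneg) (auto simp: less_top)
  interpret P: c1_prob f "grad f"
  proof unfold_locales
    show "(f has_derivative (\<lambda>h. grad f x \<bullet> h)) (at x)" for x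
      using C1 by (intro grad_has_derivative) simp
    show "integrable gauss (\<lambda>x. (norm x)\<^sup>2 * f x)"
      using assms(2,4) by (intro integrableI_nonneg) auto
  qed (fact gc assms(2) fi Fi fm)+
  let ?b = "barycenter f"
  have b: "P.bc = ?b" by (simp add: P.bc_def)
  let ?f = "shift f ?b"
  interpret S: c1_prob ?f P.gs using P.c1_prob_shift unfolding b .
  have deficit: "2 * deficit f = info ?f P.gs 1 - 2 * (\<integral>x. ?f x * ln (?f x) \<partial>gauss)"
  proof -
    have "Fisher f = ennreal (info f (grad f) 1)"
      unfolding Fisher_def info_one using Fi assms(2) by (intro nn_integral_eq_integral) auto
    moreover have "0 \<le> info f (grad f) 1" by (rule wpair_mehler(3)[OF P.wpair_g]) auto
    ultimately have "enn2real (Fisher f) = info f (grad f) 1" by simp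
    then show ?thesis
      using P.shift_fisher(2) P.shift_entropy by (simp add: deficit_def info_one b)
  qed
  let ?q = "qnorm (covariance f - mat 1)"
  define X where "X = 2 * deficit f + \<epsilon> * ?q\<^sup>2"
  have X0: "0 \<le> X"
  proof -
    \<comment> \<open>Any direction shows that the deficit is nonnegative; this settles the case of
      a vanishing pairing and makes the fourth root below meaningful.\<close>
    interpret A: c1_prob_dir ?f P.gs "axis undefined 1"
      by unfold_locales simp
    have "0 \<le> integral {0..1} (\<lambda>\<rho>. \<rho> * (A.J \<rho> - A.cc)\<^sup>2)"
    proof (cases "(\<lambda>\<rho>. \<rho> * (A.J \<rho> - A.cc)\<^sup>2) integrable_on {0..1}")
      case True
      then show ?thesis by (rule Henstock_Kurzweil_Integration.integral_nonneg) auto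
    qed (simp add: not_integrable_integral)
    then show ?thesis using A.deficit_ge assms(5) unfolding X_def deficit by simp
  qed
  define V where "V \<phi> = (\<integral>x. (\<phi> x *\<^sub>R x - grad \<phi> x) \<partial>density gauss (\<lambda>x. ennreal (?f x)))" for \<phi>
  have main: "norm (V \<phi>) ^ 4 / (4 * \<epsilon> ^ 3) \<le> X" if adm: "\<phi> \<in> admissible \<epsilon> ?f" for \<phi>
  proof (cases "V \<phi> = 0")
    case True
    then show ?thesis using X0 by simp
  next
    case nz: False
    from adm obtain \<psi> where \<phi>: "\<phi> = phi_of \<epsilon> \<psi>" and \<psi>: "Ck 1 \<psi>"
      "\<And>t. 0 \<le> t \<Longrightarrow> (\<integral>\<^sup>+x. ennreal ((\<psi> x)\<^sup>2) * OU_nn t ?f x \<partial>gauss) \<le> 1"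
      and diff: "\<And>x. phi_of \<epsilon> \<psi> differentiable (at x)"
      and vint: "integrable (density gauss (\<lambda>x. ennreal (?f x))) (\<lambda>x. phi_of \<epsilon> \<psi> x *\<^sub>R x - grad (phi_of \<epsilon> \<psi>) x)"
      unfolding admissible_def by blast
    \<comment> \<open>The direction depends on the test function, and along it the component of the
      vector integral equals its norm.\<close>
    define \<alpha> where "\<alpha> = V \<phi> /\<^sub>R norm (V \<phi>)"
    have \<alpha>: "norm \<alpha> = 1" using nz by (simp add: \<alpha>_def)
    interpret T: test_function ?f P.gs \<alpha> \<psi> \<epsilon>
      by unfold_locales (use \<alpha> \<psi> assms in auto)
    have "V \<phi> \<bullet> \<alpha> = norm (V \<phi>)"
      using nz by (simp add: \<alpha>_def power2_norm_eq_inner[symmetric] power2_eq_square)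
    then have M: "norm (V \<phi>) = (\<integral>x. phi_of \<epsilon> \<psi> x * T.ga x \<partial>gauss)"
      using T.phi_ibp[OF diff vint] by (simp add: V_def \<phi>)
    have cc: "T.cc \<le> ?q"
      using quadratic_form_le_qnorm[OF \<alpha>, of "covariance f - mat 1"] P.covariance_form[OF \<alpha>]
      by (simp add: T.cc_def b)
    \<comment> \<open>\<open>?q\<close> may be negative, so squaring \<open>cc \<le> ?q\<close> is
      legitimate only for positive \<open>cc\<close>; otherwise the left side is 0.\<close>
    have "(max 0 T.cc)\<^sup>2 \<le> ?q\<^sup>2"
    proof (cases "T.cc \<le> 0")
      case False
      then show ?thesis using cc by (intro power_mono) auto
    qed simp
    then have "\<epsilon> * (max 0 T.cc)\<^sup>2 \<le> \<epsilon> * ?q\<^sup>2" using assms(5) by (intro mult_left_mono) auto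
    then show ?thesis
      using T.phi_ga_pow4[OF M] nz unfolding X_def deficit by simp
  qed
  \<comment> \<open>Taking the root first bounds every pairing by one real number, so the supremum
    is finite and only then raised to the fourth power.\<close>
  define R where "R = root 4 (4 * \<epsilon> ^ 3 * X)"
  have R4: "R ^ 4 = 4 * \<epsilon> ^ 3 * X" and R0: "0 \<le> R"
    using X0 assms(5) by (simp_all add: R_def)
  have "norm (V \<phi>) \<le> R" if "\<phi> \<in> admissible \<epsilon> ?f" for \<phi>
  proof -
    have "norm (V \<phi>) ^ 4 \<le> R ^ 4"
      using main[OF that] assms(5) unfolding R4 by (simp add: field_simps)
    then show ?thesis using R0 by (rule power_le_imp_le_base[of _ 3, simplified]) 
  qed
  then have D: "Dtilde \<epsilon> ?f \<le> ereal R"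
    unfolding Dtilde_def V_def by (intro SUP_least) simp
  have "ereal (norm (V (\<lambda>_. 0))) \<le> Dtilde \<epsilon> ?f"
    unfolding Dtilde_def V_def by (rule SUP_upper[OF zero_admissible])
  then have D0: "0 \<le> Dtilde \<epsilon> ?f" by (rule order_trans[rotated]) simp
  obtain d where d: "Dtilde \<epsilon> ?f = ereal d" "0 \<le> d" "d \<le> R"
    using D D0 by (cases "Dtilde \<epsilon> ?f") auto
  have "d ^ 4 / (4 * \<epsilon> ^ 3) \<le> R ^ 4 / (4 * \<epsilon> ^ 3)"
    using d assms(5) by (intro divide_right_mono power_mono) auto
  also have "\<dots> = X" unfolding R4 using assms(5) by simp
  finally have "d ^ 4 / (4 * \<epsilon> ^ 3) \<le> X" .
  then show ?thesis
    using assms(5) by (simp add: d(1) X_def)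
qed simp

end
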